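(* Let $\ell,\ell'$ be geodesic lines of $\mathbb{H}^2$ and $g,g'\in G_0$. Consider: (A) the left $\mathrm{AdS}$ crooked planes $g\mathsf{C}(\ell)$ and $g'\mathsf{C}(\ell')$ are disjoint; (B) the geodesic lines $g\cdot\ell$ and $g'\cdot\ell'$ are disjoint, and $g^{-1}g'\in\mathsf{SQ}(\ell)^{-1}\mathsf{SQ}(\ell')$, where $\ell,\ell'$ carry the transverse orientations that $g,g'$ take to transverse orientations of $g\cdot\ell$, $g'\cdot\ell'$ pointing away from each other. Then (A) implies (B). Moreover, if $\ell$ and $\ell'$ are disjoint and (with these transverse orientations) transversely oriented away from each other, then (B) implies (A).
   Context: $G_0=\mathrm{PSL}_2(\mathbb{R})$ acts on the hyperbolic plane $\mathbb{H}^2$; $\mathrm{AdS}^3$ is identified with $G_0$. For a geodesic line $\ell$ with closure $\overline\ell$ in $\mathbb{H}^2\cup\partial_\infty\mathbb{H}^2$, $\mathsf{C}(\ell)$ is the set of $h\in G_0$ having a nonrepelling fixed point in $\overline\ell$ (identity: every point; elliptic: its fixed point; parabolic: its fixed point at infinity; hyperbolic: its attracting fixed point). For a transversely oriented geodesic line $\ell$, the stem quadrant $\mathsf{SQ}(\ell)\subset G_0$ is the set of hyperbolic elements whose translation axis is orthogonal to $\ell$ and which translate towards the positive side of $\ell$. For subsets $A,B\subset G_0$, $AB=\{ab\}$ and $A^{-1}=\{a^{-1}\}$. *)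

theory Defs
  imports "HOL-Analysis.Analysis"
begin

text \<open>Upper half-plane model.  Points of the Riemann sphere (finite complex points and
  infinity); the closed hyperbolic plane is the upper half-plane plus the ideal boundary
  R \<union> {infinity}.\<close>

datatype pt = Fin complex | Infty

definition Hpl :: "pt set" where
  "Hpl = {Fin z | z. Im z > 0}"

definition bdry :: "pt set" where
  "bdry = {Fin (complex_of_real r) | r. True} \<union> {Infty}"

definition Hbar :: "pt set" where
  "Hbar = Hpl \<union> bdry"

definition mob :: "real \<Rightarrow> real \<Rightarrow> real \<Rightarrow> real \<Rightarrow> pt \<Rightarrow> pt" where
  "mob a b c d x = (case x of
      Fin z \<Rightarrow> (if of_real c * z + of_real d = 0 then Infty
                else Fin ((of_real a * z + of_real b) / (of_real c * z + of_real d)))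
    | Infty \<Rightarrow> (if c = 0 then Infty else Fin (of_real (a / c))))"

text \<open>G0 = PSL2(R), realised faithfully as the group of maps it induces
  (product = composition, inverse = inverse map).\<close>

definition G0 :: "(pt \<Rightarrow> pt) set" where
  "G0 = {mob a b c d | a b c d. a * d - b * c = 1}"

definition setmul :: "(pt \<Rightarrow> pt) set \<Rightarrow> (pt \<Rightarrow> pt) set \<Rightarrow> (pt \<Rightarrow> pt) set" where
  "setmul A B = {a \<circ> b | a b. a \<in> A \<and> b \<in> B}"

definition setinv :: "(pt \<Rightarrow> pt) set \<Rightarrow> (pt \<Rightarrow> pt) set" where
  "setinv A = inv ` A"

text \<open>Classification by the absolute value of the trace (independent of the sign of the
  representing matrix).\<close>

definition hyperbolic :: "(pt \<Rightarrow> pt) \<Rightarrow> bool" where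
  "hyperbolic h \<longleftrightarrow> (\<exists>a b c d. a * d - b * c = 1 \<and> h = mob a b c d \<and> \<bar>a + d\<bar> > 2)"

definition elliptic :: "(pt \<Rightarrow> pt) \<Rightarrow> bool" where
  "elliptic h \<longleftrightarrow> (\<exists>a b c d. a * d - b * c = 1 \<and> h = mob a b c d \<and> \<bar>a + d\<bar> < 2)"

definition parabolic :: "(pt \<Rightarrow> pt) \<Rightarrow> bool" where
  "parabolic h \<longleftrightarrow> h \<noteq> id \<and>
     (\<exists>a b c d. a * d - b * c = 1 \<and> h = mob a b c d \<and> \<bar>a + d\<bar> = 2)"

text \<open>Attracting fixed point of a hyperbolic element: an ideal fixed point where the
  derivative has modulus < 1 (in the chart z, resp. -1/z at infinity).\<close>

definition attracting :: "(pt \<Rightarrow> pt) \<Rightarrow> pt \<Rightarrow> bool" where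
  "attracting h x \<longleftrightarrow> x \<in> bdry \<and> h x = x \<and>
     (\<exists>a b c d. a * d - b * c = 1 \<and> h = mob a b c d \<and>
        (case x of Fin z \<Rightarrow> (c * Re z + d)\<^sup>2 > 1 | Infty \<Rightarrow> a\<^sup>2 > 1))"

definition nonrepelling :: "(pt \<Rightarrow> pt) \<Rightarrow> pt \<Rightarrow> bool" where
  "nonrepelling h x \<longleftrightarrow> x \<in> Hbar \<and> h x = x \<and>
     (h = id \<or> elliptic h \<or> parabolic h \<or> (hyperbolic h \<and> attracting h x))"

definition geod :: "pt \<Rightarrow> pt \<Rightarrow> pt set" where
  "geod p q = (case (p, q) of
      (Fin a, Fin b) \<Rightarrow> {Fin z | z. Im z > 0 \<and> cmod (z - (a + b) / 2) = cmod (a - b) / 2}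
    | (Fin a, Infty) \<Rightarrow> {Fin z | z. Im z > 0 \<and> Re z = Re a}
    | (Infty, Fin b) \<Rightarrow> {Fin z | z. Im z > 0 \<and> Re z = Re b}
    | (Infty, Infty) \<Rightarrow> {})"

definition is_ends :: "pt set \<Rightarrow> pt \<Rightarrow> pt \<Rightarrow> bool" where
  "is_ends L p q \<longleftrightarrow> p \<in> bdry \<and> q \<in> bdry \<and> p \<noteq> q \<and> L = geod p q"

definition is_geodesic :: "pt set \<Rightarrow> bool" where
  "is_geodesic L \<longleftrightarrow> (\<exists>p q. is_ends L p q)"

definition gclosure :: "pt set \<Rightarrow> pt set" where
  "gclosure L = L \<union> {p. \<exists>q. is_ends L p q}"

text \<open>The two sides (open half-planes) of a geodesic: connected components of its
  complement in the hyperbolic plane.  A transverse orientation is the choice of one side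
  (the positive side).\<close>

definition sides :: "pt set \<Rightarrow> pt set set" where
  "sides L = (\<lambda>C. Fin ` C) ` components ({z. Im z > 0} - {z. Fin z \<in> L})"

text \<open>Euclidean tangent direction of the geodesic with endpoints p, q at the point z
  (the upper half-plane model is conformal).\<close>

definition tdir :: "pt \<Rightarrow> pt \<Rightarrow> complex \<Rightarrow> complex" where
  "tdir p q z = (case (p, q) of
      (Fin a, Fin b) \<Rightarrow> \<i> * (z - (a + b) / 2)
    | _ \<Rightarrow> \<i>)"

definition orth_at :: "pt set \<Rightarrow> pt set \<Rightarrow> pt \<Rightarrow> bool" where
  "orth_at L M x \<longleftrightarrow> x \<in> L \<and> x \<in> M \<and>
     (\<exists>p q p' q' z. is_ends L p q \<and> is_ends M p' q' \<and> x = Fin z \<and>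
        Re (tdir p q z * cnj (tdir p' q' z)) = 0)"

definition is_axis :: "(pt \<Rightarrow> pt) \<Rightarrow> pt set \<Rightarrow> bool" where
  "is_axis h A \<longleftrightarrow> hyperbolic h \<and> (\<exists>p q. is_ends A p q \<and> h p = p \<and> h q = q)"

definition Cset :: "pt set \<Rightarrow> (pt \<Rightarrow> pt) set" where
  "Cset L = {h \<in> G0. \<exists>x \<in> gclosure L. nonrepelling h x}"

definition SQ :: "pt set \<Rightarrow> pt set \<Rightarrow> (pt \<Rightarrow> pt) set" where
  "SQ L P = {h. hyperbolic h \<and> (\<exists>A x. is_axis h A \<and> orth_at L A x \<and> h x \<in> P)}"

end

theory Submission
  imports Defs
begin

text \<open>Let \<open>l\<^sub>0\<close> be the imaginary axis and write \<open>l = k l\<^sub>0\<close>, \<open>l' = k' l\<^sub>0\<close>,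
  \<open>M = k\<^sup>-\<^sup>1 k'\<close> and \<open>N = (g k)\<^sup>-\<^sup>1 (g' k')\<close>.  The crooked planes meet iff \<open>h M = N h'\<close>
  for some \<open>h, h'\<close> in \<open>C(l\<^sub>0)\<close>.  A matrix \<open>h\<close> lies in \<open>C(l\<^sub>0)\<close> iff \<open>h D h\<^sup>T \<ge> D\<close> for some diagonal
  \<open>D \<ge> 0\<close>, \<open>D \<noteq> 0\<close>; pairing such forms by the polarised determinant shows that the planes are disjoint
  iff \<open>|N\<^sub>i\<^sub>j| > |M\<^sub>i\<^sub>j|\<close> for all \<open>i, j\<close> (when this fails, \<open>h\<close> and \<open>h'\<close> can be written down).
  After choosing the sides of \<open>l\<^sub>0\<close>, these inequalities make all entries of \<open>N\<close> positive.
  The stem quadrant of \<open>l\<^sub>0\<close> consists of the matrices with rows \<open>(a, b)\<close> and \<open>(c, a)\<close> with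
  positive entries, and (B) says that \<open>N = u M t\<close> for two such matrices.  If \<open>M\<close> is nonnegative, then
  \<open>N = u M t\<close> visibly has larger entries than \<open>M\<close>.  Conversely, \<open>u M = N t\<^sup>-\<^sup>1\<close> is a linear
  system for the entries of \<open>u\<close> and \<open>t\<^sup>-\<^sup>1\<close>, which has a positive solution close to an explicit one
  with a vanishing off-diagonal entry.\<close>

section \<open>The Moebius group\<close>

text \<open>The entries of \<open>M\<close> are, up to sign, determinants of an endpoint vector of
  \<open>l\<close> with one of \<open>l'\<close>; those of \<open>N\<close> belong likewise to
  \<open>g l\<close> and \<open>g' l'\<close>. Each inequality thus concerns one pair of ideal
  endpoints, and half-turns of the two lines reduce all pairs to the lower left entry. In (B)
  implies (A), terms of \<open>u M t\<close> could cancel if \<open>M\<close> had entries of both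
  signs; disjointness and outward orientation of \<open>l\<close> and \<open>l'\<close> exclude
  this. In the other direction the signs in \<open>M\<close> are arbitrary, so positivity alone does
  not produce \<open>u\<close> and \<open>t\<close>. That \<open>N\<^sup>-\<^sup>1 u M\<close> has
  equal diagonal entries is one linear equation in the off-diagonal entries \<open>b\<close>,
  \<open>c\<close> of \<open>u\<close>. Its solution with \<open>b = 0\<close> has
  \<open>c > 0\<close> only under a sign condition; transposing both matrices, and reversing their
  rows and columns, gives three further conditions that are equally good. If all four fail,
  \<open>M\<close> and \<open>N\<close> have proportional diagonals and proportional antidiagonals,
  and the perturbation starts from \<open>u = 1\<close> instead.\<close>

definition cp :: "complex \<Rightarrow> complex \<Rightarrow> pt" where
  "cp x y = (if y = 0 then Infty else Fin (x / y))"

lemma pt_cases_cp: obtains x y where "P = cp x y" "x \<noteq> 0 \<or> y \<noteq> 0"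
proof (cases P)
  case (Fin z) then show ?thesis using that[of z 1] by (simp add: cp_def)
next
  case Infty then show ?thesis using that[of 1 0] by (simp add: cp_def)
qed

lemma cp_eq_iff:
  assumes "x \<noteq> 0 \<or> y \<noteq> 0" "x' \<noteq> 0 \<or> y' \<noteq> 0"
  shows "cp x y = cp x' y' \<longleftrightarrow> x * y' = x' * y"
  using assms by (auto simp: cp_def field_simps)

lemma cp_simps [simp]: "cp z 1 = Fin z" "cp 1 0 = Infty"
  by (auto simp: cp_def)

lemma cp_minus [simp]: "cp (- x) (- y) = cp x y"
  by (simp add: cp_def)

lemma det_nonzero_vec:
  fixes x y :: complex
  assumes "a * d - b * c = (1::real)" "x \<noteq> 0 \<or> y \<noteq> 0"
  shows "of_real a * x + of_real b * y \<noteq> 0 \<or> of_real c * x + of_real d * y \<noteq> 0"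
proof (rule ccontr)
  assume n: "\<not> ?thesis"
  have e: "of_real a * of_real d - of_real b * of_real c = (1::complex)"
    using assms(1) by (metis of_real_1 of_real_diff of_real_mult)
  have "x = of_real d * (of_real a * x + of_real b * y) - of_real b * (of_real c * x + of_real d * y)"
    using e by algebra
  moreover have "y = of_real a * (of_real c * x + of_real d * y) - of_real c * (of_real a * x + of_real b * y)"
    using e by algebra
  ultimately show False using n assms(2) by auto
qed

text \<open>\<open>cp x y\<close> is the point with homogeneous coordinates \<open>[x : y]\<close>.
  In them \<open>mob\<close> acts linearly, and its case distinctions at the pole and at infinity
  disappear. The zero vector must be excluded, as \<open>cp 0 0\<close> is \<open>Infty\<close> by
  default.\<close>

lemma mob_cp:
  assumes "a * d - b * c = 1" "x \<noteq> 0 \<or> y \<noteq> 0"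
  shows "mob a b c d (cp x y) = cp (of_real a * x + of_real b * y) (of_real c * x + of_real d * y)"
proof (cases "y = 0")
  case True
  then show ?thesis using assms by (auto simp: cp_def mob_def)
next
  case False
  have "of_real c * (x / y) + of_real d = (of_real c * x + of_real d * y) / y"
       "of_real a * (x / y) + of_real b = (of_real a * x + of_real b * y) / y"
    using False by (auto simp: field_simps)
  then show ?thesis using False by (simp add: cp_def mob_def)
qed

lemma mob_comp:
  assumes "a * d - b * c = 1" "a' * d' - b' * c' = 1"
  shows "mob a b c d \<circ> mob a' b' c' d' =
    mob (a * a' + b * c') (a * b' + b * d') (c * a' + d * c') (c * b' + d * d')"
proof
  fix P
  obtain x y where P: "P = cp x y" "x \<noteq> 0 \<or> y \<noteq> 0" by (rule pt_cases_cp)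
  have det: "(a * a' + b * c') * (c * b' + d * d') - (a * b' + b * d') * (c * a' + d * c') = 1"
    using assms by algebra
  show "(mob a b c d \<circ> mob a' b' c' d') P =
    mob (a * a' + b * c') (a * b' + b * d') (c * a' + d * c') (c * b' + d * d') P"
    unfolding P(1) o_def mob_cp[OF assms(2) P(2)] mob_cp[OF det P(2)]
      mob_cp[OF assms(1) det_nonzero_vec[OF assms(2) P(2)]]
    by (simp add: algebra_simps)
qed

lemma mob_id [simp]: "mob 1 0 0 1 = id"
proof
  fix P show "mob 1 0 0 1 P = id P" by (cases P) (simp_all add: mob_def)
qed

lemma mob_minus:
  assumes "a * d - b * c = 1"
  shows "mob (- a) (- b) (- c) (- d) = mob a b c d"
proof
  fix P
  obtain x y where P: "P = cp x y" "x \<noteq> 0 \<or> y \<noteq> 0" by (rule pt_cases_cp)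
  have "(-a) * (-d) - (-b) * (-c) = 1" using assms by simp
  from mob_cp[OF this P(2)] mob_cp[OF assms P(2)]
  show "mob (- a) (- b) (- c) (- d) P = mob a b c d P"
    unfolding P(1) by (metis (no_types, lifting) cp_minus minus_add_distrib mult_minus_left of_real_minus)
qed

text \<open>Agreement at three points decides: \<open>[1 : 0]\<close> and \<open>[0 : 1]\<close>
  make corresponding columns proportional, \<open>[1 : 1]\<close> makes the two factors equal, and
  the determinants make their product 1.\<close>

lemma mob_eqD:
  assumes "a * d - b * c = 1" "a' * d' - b' * c' = 1" and eq: "mob a b c d = mob a' b' c' d'"
  shows "(a = a' \<and> b = b' \<and> c = c' \<and> d = d') \<or> (a = -a' \<and> b = -b' \<and> c = -c' \<and> d = -d')"
proof -
  have *: "of_real ((a * x + b * y) * (c' * x + d' * y)) = (of_real ((a' * x + b' * y) * (c * x + d * y)) :: complex)"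
    if "x \<noteq> 0 \<or> y \<noteq> 0" for x y :: real
  proof -
    have n: "complex_of_real x \<noteq> 0 \<or> complex_of_real y \<noteq> 0" using that by simp
    have "cp (of_real a * of_real x + of_real b * of_real y) (of_real c * of_real x + of_real d * of_real y)
        = cp (of_real a' * of_real x + of_real b' * of_real y) (of_real c' * of_real x + of_real d' * of_real y)"
      using mob_cp[OF assms(1) n] mob_cp[OF assms(2) n] eq by simp
    then show ?thesis
      using cp_eq_iff[OF det_nonzero_vec[OF assms(1) n] det_nonzero_vec[OF assms(2) n]] by simp
  qed
  then have **: "(a * x + b * y) * (c' * x + d' * y) = (a' * x + b' * y) * (c * x + d * y)"
    if "x \<noteq> 0 \<or> y \<noteq> 0" for x y using that of_real_eq_iff by metis
  have 1: "a * c' = a' * c" "b * d' = b' * d" "(a + b) * (c' + d') = (a' + b') * (c + d)"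
    using **[of 1 0] **[of 0 1] **[of 1 1] by simp_all
  \<comment> \<open>Cramer's rule for the factors that take the columns of the second matrix to
    those of the first.\<close>
  define l where "l = a * d' - b' * c"
  define m where "m = a' * d - b * c'"
  have la: "a = l * a'" and lc: "c = l * c'" and mb: "b = m * b'" and md: "d = m * d'"
    unfolding l_def m_def using 1(1,2) assms(2) by algebra+
  have "l * m = 1" using assms(1,2) unfolding la lc mb md by algebra
  moreover have "l = m" using 1(3) assms(2) unfolding la lc mb md by algebra
  ultimately have "l = 1 \<and> m = 1 \<or> l = -1 \<and> m = -1"
    using square_eq_1_iff by blast
  then show ?thesis using la lc mb md by auto
qed

section \<open>Group operations in \<open>G0\<close>\<close>

lemma G0E:
  assumes "g \<in> G0" obtains a b c d where "g = mob a b c d" "a * d - b * c = 1"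
  using assms unfolding G0_def by blast

lemma mob_G0 [intro]: "a * d - b * c = 1 \<Longrightarrow> mob a b c d \<in> G0"
  unfolding G0_def by blast

lemma mob_inverse:
  assumes "a * d - b * c = 1"
  shows "mob a b c d \<circ> mob d (-b) (-c) a = id" "mob d (-b) (-c) a \<circ> mob a b c d = id"
proof -
  have d': "d * a - (-b) * (-c) = 1" using assms by (simp add: algebra_simps)
  show "mob a b c d \<circ> mob d (-b) (-c) a = id"
    unfolding mob_comp[OF assms d'] using assms by (simp add: algebra_simps)
  show "mob d (-b) (-c) a \<circ> mob a b c d = id"
    unfolding mob_comp[OF d' assms] using assms by (simp add: algebra_simps)
qed

lemma inv_mob:
  assumes "a * d - b * c = 1" shows "inv (mob a b c d) = mob d (-b) (-c) a"
  using mob_inverse[OF assms] by (metis inv_unique_comp)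

lemma bij_G0: "g \<in> G0 \<Longrightarrow> bij g"
  by (metis G0E mob_inverse o_bij)

lemma inv_G0 [intro]: assumes "g \<in> G0" shows "inv g \<in> G0"
proof -
  obtain a b c d where g: "g = mob a b c d" "a * d - b * c = 1" using assms by (rule G0E)
  show ?thesis unfolding g(1) inv_mob[OF g(2)] using g(2) by (intro mob_G0) (simp add: algebra_simps)
qed

lemma comp_G0 [intro]: assumes "g \<in> G0" "h \<in> G0" shows "g \<circ> h \<in> G0"
proof -
  obtain a b c d where g: "g = mob a b c d" "a * d - b * c = 1" using assms(1) by (rule G0E)
  obtain a' b' c' d' where h: "h = mob a' b' c' d'" "a' * d' - b' * c' = 1" using assms(2) by (rule G0E)
  show ?thesis unfolding g(1) h(1) mob_comp[OF g(2) h(2)]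
    by (rule mob_G0) (use g(2) h(2) in algebra)
qed

lemma G0_inv_comp:
  assumes "g \<in> G0"
  shows "inv g \<circ> g = id" "g \<circ> inv g = id" "inv (inv g) = g" "inv g (g x) = x" "g (inv g x) = x"
  using bij_G0[OF assms] by (auto simp: bij_is_inj bij_is_surj inv_inv_eq surj_f_inv_f fun_eq_iff)

lemma inv_comp_G0: "g \<in> G0 \<Longrightarrow> h \<in> G0 \<Longrightarrow> inv (g \<circ> h) = inv h \<circ> inv g"
  using bij_G0 o_inv_distrib by blast

section \<open>Crooked planes and matrix entries\<close>

text \<open>The alternatives are: fixing \<open>Infty\<close> without repelling it, fixing 0 without
  repelling it, and being elliptic with fixed point on the imaginary axis. The identity falls under
  the first two.\<close>

definition Cset_matrix :: "real \<Rightarrow> real \<Rightarrow> real \<Rightarrow> real \<Rightarrow> bool" where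
  "Cset_matrix a b c d \<longleftrightarrow> a * d - b * c = 1 \<and> (c = 0 \<and> a\<^sup>2 \<ge> 1 \<or> b = 0 \<and> d\<^sup>2 \<ge> 1 \<or> a = d \<and> b * c < 0)"

lemma Cset_matrix_minus: "Cset_matrix (-a) (-b) (-c) (-d) = Cset_matrix a b c d"
  unfolding Cset_matrix_def by simp

text \<open>Conjugation by the half-turn \<open>z -> -1/z\<close>, which exchanges the two ends of
  the imaginary axis.\<close>

lemma Cset_matrix_rot: "Cset_matrix d (-c) (-b) a = Cset_matrix a b c d"
  unfolding Cset_matrix_def by (auto simp: algebra_simps)

text \<open>This is \<open>h M = N h'\<close> for matrices. In the group it holds only up to sign,
  but by \<open>Cset_matrix_minus\<close> the sign can be absorbed in \<open>h'\<close>.\<close>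

definition meets :: "real \<Rightarrow> real \<Rightarrow> real \<Rightarrow> real \<Rightarrow> real \<Rightarrow> real \<Rightarrow> real \<Rightarrow> real \<Rightarrow> bool" where
  "meets m11 m12 m21 m22 n11 n12 n21 n22 \<longleftrightarrow>
    (\<exists>a b c d a' b' c' d'. Cset_matrix a b c d \<and> Cset_matrix a' b' c' d' \<and>
      a * m11 + b * m21 = n11 * a' + n12 * c' \<and> a * m12 + b * m22 = n11 * b' + n12 * d' \<and>
      c * m11 + d * m21 = n21 * a' + n22 * c' \<and> c * m12 + d * m22 = n21 * b' + n22 * d')"

lemma meetsI:
  assumes "Cset_matrix a b c d" "Cset_matrix a' b' c' d'"
    "a * m11 + b * m21 = n11 * a' + n12 * c'" "a * m12 + b * m22 = n11 * b' + n12 * d'"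
    "c * m11 + d * m21 = n21 * a' + n22 * c'" "c * m12 + d * m22 = n21 * b' + n22 * d'"
  shows "meets m11 m12 m21 m22 n11 n12 n21 n22"
  unfolding meets_def using assms by blast

lemma meetsE:
  assumes "meets m11 m12 m21 m22 n11 n12 n21 n22"
  obtains a b c d a' b' c' d' where "Cset_matrix a b c d" "Cset_matrix a' b' c' d'"
    "a * m11 + b * m21 = n11 * a' + n12 * c'" "a * m12 + b * m22 = n11 * b' + n12 * d'"
    "c * m11 + d * m21 = n21 * a' + n22 * c'" "c * m12 + d * m22 = n21 * b' + n22 * d'"
  using assms unfolding meets_def by blast

text \<open>\<open>M\<close> and \<open>N\<close> are multiplied on the right by the half-turn
  matrix and \<open>h'\<close> is conjugated by it, which amounts to exchanging the ends of
  \<open>l'\<close>.\<close>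

lemma meets_flip_cols:
  assumes "meets m12 (-m11) m22 (-m21) n12 (-n11) n22 (-n21)"
  shows "meets m11 m12 m21 m22 n11 n12 n21 n22"
proof (rule meetsE[OF assms])
  fix a b c d a' b' c' d'
  assume *: "Cset_matrix a b c d" "Cset_matrix a' b' c' d'"
    "a * m12 + b * m22 = n12 * a' + -n11 * c'" "a * -m11 + b * -m21 = n12 * b' + -n11 * d'"
    "c * m12 + d * m22 = n22 * a' + -n21 * c'" "c * -m11 + d * -m21 = n22 * b' + -n21 * d'"
  show ?thesis
    by (rule meetsI[of a b c d d' "-c'" "-b'" a']) (use * in \<open>simp_all add: Cset_matrix_rot\<close>)
qed

text \<open>The same on the left, with the inverse half-turn and \<open>h\<close>: the ends of
  \<open>l\<close> are exchanged.\<close>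

lemma meets_flip_rows:
  assumes "meets m21 m22 (-m11) (-m12) n21 n22 (-n11) (-n12)"
  shows "meets m11 m12 m21 m22 n11 n12 n21 n22"
proof (rule meetsE[OF assms])
  fix a b c d a' b' c' d'
  assume *: "Cset_matrix a b c d" "Cset_matrix a' b' c' d'"
    "a * m21 + b * -m11 = n21 * a' + n22 * c'" "a * m22 + b * -m12 = n21 * b' + n22 * d'"
    "c * m21 + d * -m11 = -n11 * a' + -n12 * c'" "c * m22 + d * -m12 = -n11 * b' + -n12 * d'"
  show ?thesis
    by (rule meetsI[of d "-c" "-b" a a' b' c' d']) (use * in \<open>simp_all add: Cset_matrix_rot\<close>)
qed

text \<open>Both elements fix \<open>Infty\<close>, and \<open>h'\<close> is unipotent. The lower
  left entry of \<open>h M = N h'\<close> forces the diagonal \<open>r\<close>, \<open>1/r\<close>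
  of \<open>h\<close>, the two diagonal entries determine \<open>b\<close> and \<open>b'\<close>,
  and the upper right entry follows from the determinants. The bound on \<open>r\<close> says that
  \<open>h\<close> does not repel \<open>Infty\<close>.\<close>

lemma meets_triangular:
  assumes M: "m11 * m22 - m12 * m21 = 1" and N: "n11 * n22 - n12 * n21 = 1"
    and "n21 \<noteq> 0" "r\<^sup>2 \<ge> 1" and r: "m21 = r * n21"
  shows "meets m11 m12 m21 m22 n11 n12 n21 n22"
proof -
  have r0: "r \<noteq> 0" using assms(4) by auto
  define b where "b = (n11 - r * m11) / m21"
  define b' where "b' = (m22 / r - n22) / n21"
  have b: "b * m21 = n11 - r * m11" "n21 * b' = m22 / r - n22"
    using assms(3) r r0 by (auto simp: b_def b'_def)
  have "m21 * (r * m12 + b * m22) = m21 * r * m12 + m22 * (n11 - r * m11)"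
    unfolding b(1)[symmetric] by (simp add: algebra_simps)
  also have "\<dots> = n11 * m22 - r * (m11 * m22 - m12 * m21)" by (simp add: algebra_simps)
  also have "\<dots> = n11 * m22 - r * (n11 * n22 - n12 * n21)" unfolding M N by simp
  also have "\<dots> = r * (n11 * (m22 / r - n22) + n12 * n21)"
    using r0 by (simp add: field_simps)
  also have "\<dots> = m21 * (n11 * b' + n12)"
    unfolding b(2)[symmetric] r by (simp add: algebra_simps)
  finally have e: "r * m12 + b * m22 = n11 * b' + n12" using r0 assms(3) r by simp
  show ?thesis
    by (rule meetsI[of r b 0 "1/r" 1 b' 0 1])
       (use b e r r0 assms(3,4) in \<open>simp_all add: Cset_matrix_def\<close>)
qed

text \<open>Now \<open>M\<close> and \<open>N\<close> are upper triangular, so the diagonals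
  \<open>r\<close> and \<open>s\<close> of \<open>h\<close> and \<open>h'\<close> are only tied by
  \<open>r m11 = n11 s\<close>. One of them can be set to 1 such that the other has modulus at least
  1, and then neither element repels \<open>Infty\<close>.\<close>

lemma meets_shared_end:
  assumes M: "m11 * m22 - m12 * m21 = 1" and N: "n11 * n22 - n12 * n21 = 1"
    and "n21 = 0" "m21 = 0"
  shows "meets m11 m12 m21 m22 n11 n12 n21 n22"
proof -
  have nz: "m11 * m22 = 1" "n11 * n22 = 1" using assms by auto
  then have nz': "m11 \<noteq> 0" "n11 \<noteq> 0" by auto
  have inv: "m22 = 1 / m11" "n22 = 1 / n11" using nz nz' by (auto simp: field_simps)
  obtain r s where rs: "r \<noteq> 0" "s \<noteq> 0" "r * m11 = n11 * s" "r\<^sup>2 \<ge> 1" "s\<^sup>2 \<ge> 1"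
  proof (cases "\<bar>n11\<bar> \<le> \<bar>m11\<bar>")
    case True
    then have "(m11 / n11)\<^sup>2 \<ge> 1" using nz' by (simp add: power_divide abs_le_square_iff)
    then show ?thesis using nz' that[of 1 "m11 / n11"] by auto
  next
    case False
    then have "(n11 / m11)\<^sup>2 \<ge> 1" using nz' by (simp add: power_divide abs_le_square_iff)
    then show ?thesis using nz' that[of "n11 / m11" 1] by auto
  qed
  define b' where "b' = (r * m12 - n12 / s) / n11"
  have "r * m12 = n11 * b' + n12 / s" using nz' by (simp add: b'_def)
  moreover have "m22 / r = n22 / s" using rs nz' unfolding inv by (simp add: field_simps)
  ultimately show ?thesis
    by (intro meetsI[of r 0 0 "1/r" s b' 0 "1/s"])
       (use assms(3,4) rs in \<open>simp_all add: Cset_matrix_def\<close>)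
qed

text \<open>A matrix preserving the positive form \<open>diag(1, \<delta>)\<close> fixes an interior point of the line.\<close>

lemma meets_interior_end:
  assumes M: "m11 * m22 - m12 * m21 = 1" and N: "n11 * n22 - n12 * n21 = 1"
    and n0: "n21 = 0" and m0: "m21 \<noteq> 0"
  shows "meets m11 m12 m21 m22 n11 n12 n21 n22"
proof -
  have n: "n11 * n22 = 1" "n22 \<noteq> 0" using N n0 by auto
  \<comment> \<open>The aim is an \<open>h\<close> fixing \<open>Infty\<close> for which
    \<open>h' = N\<^sup>-\<^sup>1 h M\<close> preserves \<open>diag(1, \<delta>)\<close>, that is,
    for which \<open>h M\<close> and \<open>N\<close> transform this form in the same way. With this
    \<open>\<delta>\<close>, equality of the lower right entries reads
    \<open>r\<^sup>2 = 1 + \<delta> m22\<^sup>2 / m21\<^sup>2\<close>, so that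
    \<open>r\<^sup>2 \<ge> 1\<close> is automatic.\<close>
  define \<delta> where "\<delta> = m21\<^sup>2 / n22\<^sup>2"
  have \<delta>: "\<delta> > 0" "n22\<^sup>2 * \<delta> = m21\<^sup>2" using m0 n by (auto simp: \<delta>_def)
  define z where "z = m21\<^sup>2 + \<delta> * m22\<^sup>2"
  define r where "r = sqrt (z / m21\<^sup>2)"
  have z: "z > 0" using \<delta>(1) m0 unfolding z_def by (simp add: add_pos_nonneg)
  have r: "r > 0" "r\<^sup>2 * m21\<^sup>2 = z" using z m0 by (auto simp: r_def)
  have r1: "r\<^sup>2 \<ge> 1" using z m0 \<delta>(1) by (simp add: r_def z_def)
  \<comment> \<open>Makes the off-diagonal entries of the two transformed forms agree, which is
    \<open>X\<close> below; \<open>Z\<close> is the agreement of the lower right entries.\<close>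
  define b where "b = (\<delta> * n12 * n22 * r\<^sup>2 - r\<^sup>2 * (m11 * m21 + \<delta> * m12 * m22)) / (r * z)"
  define k11 where "k11 = r * m11 + b * m21"
  define k12 where "k12 = r * m12 + b * m22"
  define k21 where "k21 = m21 / r"
  define k22 where "k22 = m22 / r"
  have kr: "r * k21 = m21" "r * k22 = m22" using r(1) by (auto simp: k21_def k22_def)
  have k_det: "k11 * k22 - k12 * k21 = 1"
  proof -
    have "k11 * k22 - k12 * k21 = (r * k22) * m11 - (r * k21) * m12 + b * (m21 * k22 - m22 * k21)"
      unfolding k11_def k12_def by (simp add: algebra_simps)
    also have "\<dots> = 1" unfolding kr using M by (simp add: k21_def k22_def algebra_simps)
    finally show ?thesis .
  qed
  have Z: "k21\<^sup>2 + \<delta> * k22\<^sup>2 = n22\<^sup>2 * \<delta>"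
  proof -
    have "r\<^sup>2 * (k21\<^sup>2 + \<delta> * k22\<^sup>2) = (r * k21)\<^sup>2 + \<delta> * (r * k22)\<^sup>2"
      by (simp add: power_mult_distrib algebra_simps)
    also have "\<dots> = r\<^sup>2 * (n22\<^sup>2 * \<delta>)" unfolding kr \<delta>(2) r(2) z_def by simp
    finally show ?thesis using r(1) by simp
  qed
  have X: "k11 * k21 + \<delta> * k12 * k22 = n12 * n22 * \<delta>"
  proof -
    have "r * (k11 * k21 + \<delta> * k12 * k22) = k11 * (r * k21) + \<delta> * k12 * (r * k22)"
      by (simp add: algebra_simps)
    also have "\<dots> = r * (m11 * m21 + \<delta> * m12 * m22) + b * z"
      unfolding kr unfolding k11_def k12_def z_def by (simp add: algebra_simps power2_eq_square)
    also have "\<dots> = r * (n12 * n22 * \<delta>)"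
      using r(1) z by (simp add: b_def field_simps power2_eq_square)
    finally show ?thesis using r(1) by simp
  qed
  define a' where "a' = n22 * k11 - n12 * k21"
  define b' where "b' = n22 * k12 - n12 * k22"
  \<comment> \<open>As \<open>n21 = 0\<close>, the diagonal entries of
    \<open>N\<^sup>-\<^sup>1 h M\<close> are \<open>a'\<close> and \<open>n11 * k22\<close>. They
    coincide because a matrix of determinant 1 preserving \<open>diag(1, \<delta>)\<close> has equal
    diagonal entries.\<close>
  have "(\<delta> * n22) * (n22 * k11 - n12 * k21) = (n22\<^sup>2 * \<delta>) * k11 - (n12 * n22 * \<delta>) * k21"
    by (simp add: algebra_simps power2_eq_square)
  also have "\<dots> = \<delta> * (k22 * (k11 * k22 - k12 * k21))"
    unfolding Z[symmetric] X[symmetric] by (simp add: algebra_simps power2_eq_square)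
  also have "\<dots> = \<delta> * n22 * (n11 * k22)" unfolding k_det using n(1) by (simp add: algebra_simps)
  finally have a': "a' = n11 * k22" using \<delta>(1) n(2) by (simp add: a'_def)
  have "n22 * (\<delta> * b') = (n22\<^sup>2 * \<delta>) * k12 - (n12 * n22 * \<delta>) * k22"
    by (simp add: b'_def algebra_simps power2_eq_square)
  also have "\<dots> = - k21 * (k11 * k22 - k12 * k21)"
    unfolding Z[symmetric] X[symmetric] by (simp add: algebra_simps power2_eq_square)
  also have "\<dots> = n22 * (- (n11 * k21))" unfolding k_det using n(1) by (simp add: algebra_simps)
  finally have "\<delta> * b' = - (n11 * k21)" using n(2) mult_left_cancel by blast
  then have b': "n11 * k21 = - (\<delta> * b')" by simp
  have det: "a' * a' + b' * (\<delta> * b') = 1"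
  proof -
    have "a' * a' + b' * (\<delta> * b') = a' * (n11 * k22) - b' * (n11 * k21)"
      using a' b' by simp
    also have "\<dots> = (n11 * n22) * (k11 * k22 - k12 * k21)"
      unfolding a'_def b'_def by (simp add: algebra_simps)
    finally show ?thesis using n k_det by simp
  qed
  have S: "Cset_matrix a' b' (- (\<delta> * b')) a'"
  proof (cases "b' = 0")
    case True then show ?thesis using det by (simp add: Cset_matrix_def power2_eq_square)
  next
    case False
    then have "\<delta> * (b' * b') > 0" using \<delta>(1) not_real_square_gt_zero mult_pos_pos by blast
    then have "b' * - (\<delta> * b') < 0" by (simp add: algebra_simps)
    then show ?thesis using det by (simp add: Cset_matrix_def)
  qed
  have e: "n11 * a' + n12 * - (\<delta> * b') = k11" "n11 * b' + n12 * a' = k12"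
  proof -
    have "n11 * a' + n12 * - (\<delta> * b') = n11 * a' + n12 * (n11 * k21)" using b' by simp
    also have "\<dots> = (n11 * n22) * k11" by (simp add: a'_def algebra_simps)
    finally show "n11 * a' + n12 * - (\<delta> * b') = k11" using n by simp
    have "n11 * b' + n12 * a' = (n11 * n22) * k12" unfolding a' by (simp add: b'_def algebra_simps)
    then show "n11 * b' + n12 * a' = k12" using n by simp
  qed
  have e': "n22 * - (\<delta> * b') = k21" "n22 * a' = k22"
    using n(1) unfolding b'[symmetric] a' by (simp_all add: algebra_simps)
  show ?thesis
    by (rule meetsI[of r b 0 "1/r" a' b' "- (\<delta> * b')" a'])
       (use S e e' n0 r r1 in \<open>simp_all add: Cset_matrix_def k11_def k12_def k21_def k22_def\<close>)
qed

lemma meets_if_lower_left_le: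
  assumes "m11 * m22 - m12 * m21 = 1" "n11 * n22 - n12 * n21 = 1" and le: "\<bar>n21\<bar> \<le> \<bar>m21\<bar>"
  shows "meets m11 m12 m21 m22 n11 n12 n21 n22"
proof (cases "n21 = 0")
  case True
  then show ?thesis using meets_shared_end meets_interior_end assms(1,2) by blast
next
  case False
  have "(m21 / n21)\<^sup>2 \<ge> 1" using le False by (simp add: power_divide abs_le_square_iff)
  then show ?thesis using assms(1,2) False by (intro meets_triangular[where r = "m21 / n21"]) auto
qed

text \<open>Half-turns on the left and on the right bring each entry, up to sign, to the lower left
  corner, where \<open>meets_if_lower_left_le\<close> applies.\<close>

lemma meets_or_all_gt:
  assumes "m11 * m22 - m12 * m21 = 1" "n11 * n22 - n12 * n21 = 1"
    and "\<not> meets m11 m12 m21 m22 n11 n12 n21 n22"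
  shows "\<bar>m11\<bar> < \<bar>n11\<bar> \<and> \<bar>m12\<bar> < \<bar>n12\<bar> \<and> \<bar>m21\<bar> < \<bar>n21\<bar> \<and> \<bar>m22\<bar> < \<bar>n22\<bar>"
proof (intro conjI)
  show "\<bar>m21\<bar> < \<bar>n21\<bar>" using meets_if_lower_left_le assms not_less by blast
  show "\<bar>m22\<bar> < \<bar>n22\<bar>"
    using meets_if_lower_left_le[of m12 "-m21" "-m11" m22 n12 "-n21" "-n11" n22] assms
      meets_flip_cols by force
  show "\<bar>m11\<bar> < \<bar>n11\<bar>"
  proof (rule ccontr)
    assume "\<not> ?thesis"
    then have "meets m21 m22 (-m11) (-m12) n21 n22 (-n11) (-n12)"
      using assms(1,2) by (intro meets_if_lower_left_le) (auto simp: algebra_simps)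
    then show False using assms(3) meets_flip_rows by blast
  qed
  show "\<bar>m12\<bar> < \<bar>n12\<bar>"
  proof (rule ccontr)
    assume "\<not> ?thesis"
    then have "meets m22 (-m21) (-m12) m11 n22 (-n21) (-n12) n11"
      using assms(1,2) by (intro meets_if_lower_left_le) (auto simp: algebra_simps)
    then have "meets m22 (-m21) (-m12) (- (-m11)) n22 (-n21) (-n12) (- (-n11))" by simp
    then have "meets m21 m22 (-m11) (-m12) n21 n22 (-n11) (-n12)" by (rule meets_flip_cols)
    then show False using assms(3) meets_flip_rows by blast
  qed
qed

text \<open>The following inequalities say \<open>h D h\<^sup>T \<ge> D\<close> for a nonzero \<open>D = diag(x\<^sub>1, x\<^sub>2) \<ge> 0\<close>, tested
  against rank one forms and against the form \<open>\<alpha> v\<^sub>1\<^sup>2 + 2 \<beta> v\<^sub>1 v\<^sub>2 + \<gamma> v\<^sub>2\<^sup>2\<close>, respectively.\<close>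

lemma Cset_matrix_form_le:
  assumes "Cset_matrix a b c d"
  obtains x1 x2 where "x1 \<ge> 0" "x2 \<ge> 0" "x1 + x2 > 0"
    "\<And>v1 v2. x1 * (c * v1 + d * v2)\<^sup>2 + x2 * (a * v1 + b * v2)\<^sup>2 \<le> x1 * v2\<^sup>2 + x2 * v1\<^sup>2"
proof -
  have det: "a * d - b * c = 1" using assms by (simp add: Cset_matrix_def)
  consider "c = 0" "a\<^sup>2 \<ge> 1" | "b = 0" "d\<^sup>2 \<ge> 1" | "a = d" "b * c < 0"
    using assms unfolding Cset_matrix_def by blast
  then show ?thesis
  proof cases
    case 1
    have "d\<^sup>2 \<le> 1" 
    proof -
      have "a\<^sup>2 * d\<^sup>2 = 1" using det 1 by (metis mult_zero_right power_mult_distrib power_one diff_zero)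
      then show ?thesis using 1(2) mult_right_mono[of 1 "a\<^sup>2" "d\<^sup>2"] by simp
    qed
    then have "(d * v)\<^sup>2 \<le> v\<^sup>2" for v by (simp add: power_mult_distrib mult_left_le_one_le)
    then show ?thesis using 1 that[of 1 0] by simp
  next
    case 2
    have "a\<^sup>2 \<le> 1" 
    proof -
      have "a\<^sup>2 * d\<^sup>2 = 1" using det 2 by (metis mult_zero_left power_mult_distrib power_one diff_zero)
      then show ?thesis using 2(2) mult_left_mono[of 1 "d\<^sup>2" "a\<^sup>2"] by simp
    qed
    then have "(a * v)\<^sup>2 \<le> v\<^sup>2" for v by (simp add: power_mult_distrib mult_left_le_one_le)
    then show ?thesis using 2 that[of 0 1] by simp
  next
    case 3
    \<comment> \<open>The weights \<open>s * b\<close> and \<open>- s * c\<close> are the absolute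
      values of \<open>b\<close> and \<open>c\<close>, which have opposite signs here. With them the
      elliptic element preserves the form exactly.\<close>
    define s where "s = (if b > 0 then 1 else -1 :: real)"
    have "s * b > 0" "- s * c > 0" using 3 by (auto simp: s_def mult_less_0_iff)
    moreover have "s * b * (c * v1 + d * v2)\<^sup>2 + - s * c * (a * v1 + b * v2)\<^sup>2
      = (a * d - b * c) * (s * b * v2\<^sup>2 + - s * c * v1\<^sup>2)" for v1 v2
      using 3 by (simp add: algebra_simps power2_eq_square)
    ultimately show ?thesis using that[of "s * b" "- s * c"] det by simp
  qed
qed

lemma Cset_matrix_form_ge:
  assumes "Cset_matrix a b c d"
  obtains x1 x2 where "x1 \<ge> 0" "x2 \<ge> 0" "x1 + x2 > 0"
    "\<And>\<alpha> \<beta> \<gamma> :: real. \<alpha> \<ge> 0 \<Longrightarrow> \<gamma> \<ge> 0 \<Longrightarrow> x1 * \<alpha> + x2 * \<gamma> \<le>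
       x1 * (\<alpha> * a\<^sup>2 + 2 * \<beta> * a * c + \<gamma> * c\<^sup>2) + x2 * (\<alpha> * b\<^sup>2 + 2 * \<beta> * b * d + \<gamma> * d\<^sup>2)"
proof -
  have det: "a * d - b * c = 1" using assms by (simp add: Cset_matrix_def)
  consider "c = 0" "a\<^sup>2 \<ge> 1" | "b = 0" "d\<^sup>2 \<ge> 1" | "a = d" "b * c < 0"
    using assms unfolding Cset_matrix_def by blast
  then show ?thesis
  proof cases
    case 1
    have "\<alpha> \<le> \<alpha> * a\<^sup>2" if "\<alpha> \<ge> 0" for \<alpha> :: real using mult_left_mono[OF 1(2) that] by simp
    then show ?thesis using 1 that[of 1 0] by simp
  next
    case 2
    have "\<alpha> \<le> \<alpha> * d\<^sup>2" if "\<alpha> \<ge> 0" for \<alpha> :: real using mult_left_mono[OF 2(2) that] by simp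
    then show ?thesis using 2 that[of 0 1] by simp
  next
    case 3
    define s where "s = (if b > 0 then 1 else -1 :: real)"
    have "s * b > 0" "- s * c > 0" using 3 by (auto simp: s_def mult_less_0_iff)
    moreover have "s * b * (\<alpha> * a\<^sup>2 + 2 * \<beta> * a * c + \<gamma> * c\<^sup>2) + - s * c * (\<alpha> * b\<^sup>2 + 2 * \<beta> * b * d + \<gamma> * d\<^sup>2)
      = (a * d - b * c) * (s * b * \<alpha> + - s * c * \<gamma>)" for \<alpha> \<beta> \<gamma>
      using 3 by (simp add: algebra_simps power2_eq_square)
    ultimately show ?thesis using that[of "s * b" "- s * c"] det by simp
  qed
qed

text \<open>Pairing the form of \<open>h\<close> with the form of \<open>h'\<close> transported by
  \<open>N\<close> gives a weighted sum of the squared entries of \<open>N\<close>, with weights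
  \<open>x\<^sub>i y\<^sub>j\<close> that are nonnegative and not all zero. Passing from
  \<open>N\<close> to \<open>N h' = h M\<close> does not decrease the value, and removing
  \<open>h\<close> does not decrease it either, so the value for \<open>N\<close> is at most that
  for \<open>M\<close>. Smaller entries of \<open>M\<close> contradict this.\<close>

lemma not_meets_if_all_gt:
  assumes gt: "\<bar>m11\<bar> < \<bar>n11\<bar>" "\<bar>m12\<bar> < \<bar>n12\<bar>" "\<bar>m21\<bar> < \<bar>n21\<bar>" "\<bar>m22\<bar> < \<bar>n22\<bar>"
  shows "\<not> meets m11 m12 m21 m22 n11 n12 n21 n22"
proof
  assume "meets m11 m12 m21 m22 n11 n12 n21 n22"
  then obtain a b c d a' b' c' d' where *: "Cset_matrix a b c d" "Cset_matrix a' b' c' d'" and e: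
    "a * m11 + b * m21 = n11 * a' + n12 * c'" "a * m12 + b * m22 = n11 * b' + n12 * d'"
    "c * m11 + d * m21 = n21 * a' + n22 * c'" "c * m12 + d * m22 = n21 * b' + n22 * d'"
    by (rule meetsE)
  obtain x1 x2 where x: "x1 \<ge> 0" "x2 \<ge> 0" "x1 + x2 > 0" and
    le: "\<And>v1 v2. x1 * (c * v1 + d * v2)\<^sup>2 + x2 * (a * v1 + b * v2)\<^sup>2 \<le> x1 * v2\<^sup>2 + x2 * v1\<^sup>2"
    using Cset_matrix_form_le[OF *(1)] by metis
  obtain y1 y2 where y: "y1 \<ge> 0" "y2 \<ge> 0" "y1 + y2 > 0" and
    ge: "\<And>\<alpha> \<beta> \<gamma> :: real. \<alpha> \<ge> 0 \<Longrightarrow> \<gamma> \<ge> 0 \<Longrightarrow> y1 * \<alpha> + y2 * \<gamma> \<le>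
       y1 * (\<alpha> * a'\<^sup>2 + 2 * \<beta> * a' * c' + \<gamma> * c'\<^sup>2) + y2 * (\<alpha> * b'\<^sup>2 + 2 * \<beta> * b' * d' + \<gamma> * d'\<^sup>2)"
    using Cset_matrix_form_ge[OF *(2)] by metis
  define L where "L v1 v2 = x1 * v2\<^sup>2 + x2 * v1\<^sup>2" for v1 v2 :: real
  have leL: "L (a * v1 + b * v2) (c * v1 + d * v2) \<le> L v1 v2" for v1 v2
    unfolding L_def by (rule le)
  have sq: "m11\<^sup>2 < n11\<^sup>2" "m12\<^sup>2 < n12\<^sup>2" "m21\<^sup>2 < n21\<^sup>2" "m22\<^sup>2 < n22\<^sup>2"
    using gt by (simp_all add: power2_strict_mono)
  have lt: "L u1 u2 < L v1 v2" if "u1\<^sup>2 < v1\<^sup>2" "u2\<^sup>2 < v2\<^sup>2" for u1 u2 v1 v2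
  proof (cases "x1 > 0")
    case True
    then have "x1 * u2\<^sup>2 < x1 * v2\<^sup>2" "x2 * u1\<^sup>2 \<le> x2 * v1\<^sup>2"
      using that x by (auto intro: mult_left_mono)
    then show ?thesis unfolding L_def by linarith
  next
    case False
    then have "x1 = 0" "x2 > 0" using x by auto
    then show ?thesis using that by (simp add: L_def)
  qed
  have "y1 * L n11 n21 + y2 * L n12 n22
    \<le> y1 * L (n11 * a' + n12 * c') (n21 * a' + n22 * c') + y2 * L (n11 * b' + n12 * d') (n21 * b' + n22 * d')"
  proof -
    have pos: "L n11 n21 \<ge> 0" "L n12 n22 \<ge> 0" using x by (simp_all add: L_def)
    show ?thesis
      \<comment> \<open>Together with \<open>L n11 n21\<close> and \<open>L n12 n22\<close>, this
        \<open>\<beta>\<close> completes the Gram matrix of the columns of \<open>N\<close> under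
        \<open>L\<close>; the right-hand side then becomes \<open>L\<close> on the columns of
        \<open>N h'\<close>.\<close>
      using ge[OF pos, of "x1 * n21 * n22 + x2 * n11 * n12"]
      by (simp add: L_def algebra_simps power2_eq_square)
  qed
  also have "\<dots> = y1 * L (a * m11 + b * m21) (c * m11 + d * m21) + y2 * L (a * m12 + b * m22) (c * m12 + d * m22)"
    unfolding e ..
  also have "\<dots> \<le> y1 * L m11 m21 + y2 * L m12 m22"
    by (intro add_mono mult_left_mono leL y)
  also have "\<dots> < y1 * L n11 n21 + y2 * L n12 n22"
  proof (cases "y1 > 0")
    case True
    then have "y1 * L m11 m21 < y1 * L n11 n21" "y2 * L m12 m22 \<le> y2 * L n12 n22"
      using lt[of m11 n11 m21 n21] lt[of m12 n12 m22 n22] sq y by (auto intro: mult_left_mono)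
    then show ?thesis by linarith
  next
    case False
    then have "y1 = 0" "y2 > 0" using y by auto
    then show ?thesis using lt sq by simp
  qed
  finally show False by simp
qed

section \<open>Stem quadrants and matrix entries\<close>

text \<open>Here \<open>u M = N t\<^sup>-\<^sup>1\<close> for the multiples \<open>u\<close> and \<open>t\<close>, up to sign, of stem quadrant matrices with
  rows \<open>(1, b)\<close>, \<open>(c, 1)\<close> and \<open>(p, q)\<close>, \<open>(r, p)\<close>; the determinants \<open>1 - b c = p\<^sup>2 - q r\<close> cancel.\<close>

definition stem_factor :: "real \<Rightarrow> real \<Rightarrow> real \<Rightarrow> real \<Rightarrow> real \<Rightarrow> real \<Rightarrow> real \<Rightarrow> real \<Rightarrow> bool" where
  "stem_factor m11 m12 m21 m22 n11 n12 n21 n22 \<longleftrightarrow> (\<exists>b c p q r.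
     b > 0 \<and> c > 0 \<and> b * c < 1 \<and> p * q > 0 \<and> p * r > 0 \<and>
     m11 + b * m21 = p * n11 - r * n12 \<and> m12 + b * m22 = p * n12 - q * n11 \<and>
     c * m11 + m21 = p * n21 - r * n22 \<and> c * m12 + m22 = p * n22 - q * n21)"

text \<open>Determinants of both sides of \<open>u M = N t\<^sup>-\<^sup>1\<close>. Because of this
  a single square root will normalise both factors.\<close>

lemma stem_factor_det:
  fixes b c p q r :: real
  assumes "m11 * m22 - m12 * m21 = 1" "n11 * n22 - n12 * n21 = 1"
    and "m11 + b * m21 = p * n11 - r * n12" "m12 + b * m22 = p * n12 - q * n11"
    "c * m11 + m21 = p * n21 - r * n22" "c * m12 + m22 = p * n22 - q * n21"
  shows "1 - b * c = p\<^sup>2 - q * r"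
proof -
  have "1 - b * c = (1 - b * c) * (m11 * m22 - m12 * m21)" using assms(1) by simp
  also have "\<dots> = (m11 + b * m21) * (c * m12 + m22) - (m12 + b * m22) * (c * m11 + m21)"
    by (simp add: algebra_simps)
  also have "\<dots> = (p\<^sup>2 - q * r) * (n11 * n22 - n12 * n21)"
    unfolding assms(3-6) by (simp add: algebra_simps power2_eq_square)
  finally show ?thesis using assms(2) by simp
qed

text \<open>Transposing \<open>N = u M t\<close> gives
  \<open>N\<^sup>T = t\<^sup>T M\<^sup>T u\<^sup>T\<close>, and the shape of a stem quadrant matrix
  survives transposition. The roles of the two factors are exchanged.\<close>

lemma stem_factor_transpose:
  assumes M: "m11 * m22 - m12 * m21 = 1" and N: "n11 * n22 - n12 * n21 = 1"
    and "stem_factor m11 m21 m12 m22 n11 n21 n12 n22"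
  shows "stem_factor m11 m12 m21 m22 n11 n12 n21 n22"
proof -
  obtain b c p q r where pos: "b > 0" "c > 0" "b * c < 1" "p * q > 0" "p * r > 0"
    and e: "m11 + b * m12 = p * n11 - r * n21" "m21 + b * m22 = p * n21 - q * n11"
     "c * m11 + m12 = p * n12 - r * n22" "c * m21 + m22 = p * n22 - q * n12"
    using assms(3) unfolding stem_factor_def by blast
  have D: "1 - b * c = p\<^sup>2 - q * r"
    by (rule stem_factor_det[of m11 m22 m21 m12 n11 n22 n21 n12])
       (use M N e in \<open>simp_all add: mult.commute\<close>)
  have nz: "1 - b * c \<noteq> 0" and p0: "p \<noteq> 0" using pos by auto
  then have pp: "p * p > 0" by (metis not_real_square_gt_zero)
  \<comment> \<open>The transposed system multiplied by the adjugates of both factors; division by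
    \<open>p\<close> then gives the new left factor the diagonal 1.\<close>
  have f: "p * m11 + r * m21 = n11 - b * n12" "p * m12 + r * m22 = n12 - c * n11"
     "q * m11 + p * m21 = n21 - b * n22" "q * m12 + p * m22 = n22 - c * n21"
  proof -
    have "(1 - b * c) * (p * m11 + r * m21) = p * ((m11 + b * m12) - b * (c * m11 + m12)) + r * ((m21 + b * m22) - b * (c * m21 + m22))"
      by (simp add: algebra_simps)
    also have "\<dots> = (p\<^sup>2 - q * r) * (n11 - b * n12)" unfolding e by (simp add: algebra_simps power2_eq_square)
    finally show "p * m11 + r * m21 = n11 - b * n12" using D nz by simp
    have "(1 - b * c) * (p * m12 + r * m22) = p * ((c * m11 + m12) - c * (m11 + b * m12)) + r * ((c * m21 + m22) - c * (m21 + b * m22))"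
      by (simp add: algebra_simps)
    also have "\<dots> = (p\<^sup>2 - q * r) * (n12 - c * n11)" unfolding e by (simp add: algebra_simps power2_eq_square)
    finally show "p * m12 + r * m22 = n12 - c * n11" using D nz by simp
    have "(1 - b * c) * (q * m11 + p * m21) = q * ((m11 + b * m12) - b * (c * m11 + m12)) + p * ((m21 + b * m22) - b * (c * m21 + m22))"
      by (simp add: algebra_simps)
    also have "\<dots> = (p\<^sup>2 - q * r) * (n21 - b * n22)" unfolding e by (simp add: algebra_simps power2_eq_square)
    finally show "q * m11 + p * m21 = n21 - b * n22" using D nz by simp
    have "(1 - b * c) * (q * m12 + p * m22) = q * ((c * m11 + m12) - c * (m11 + b * m12)) + p * ((c * m21 + m22) - c * (m21 + b * m22))"
      by (simp add: algebra_simps)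
    also have "\<dots> = (p\<^sup>2 - q * r) * (n22 - c * n21)" unfolding e by (simp add: algebra_simps power2_eq_square)
    finally show "q * m12 + p * m22 = n22 - c * n21" using D nz by simp
  qed
  have "r / p > 0" "q / p > 0" using pos by (auto simp: zero_less_divide_iff zero_less_mult_iff)
  moreover have "(r / p) * (q / p) < 1"
  proof -
    have "q * r < p\<^sup>2" using D pos by simp
    then show ?thesis using p0 by (simp add: power2_eq_square[symmetric] mult.commute)
  qed
  moreover have "(1 / p) * (c / p) > 0" "(1 / p) * (b / p) > 0"
    using divide_pos_pos[OF pos(2) pp] divide_pos_pos[OF pos(1) pp] by simp_all
  moreover have "m11 + r / p * m21 = 1 / p * n11 - b / p * n12" "m12 + r / p * m22 = 1 / p * n12 - c / p * n11"
     "q / p * m11 + m21 = 1 / p * n21 - b / p * n22" "q / p * m12 + m22 = 1 / p * n22 - c / p * n21"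
    using f p0 by (simp_all add: field_simps)
  ultimately show ?thesis unfolding stem_factor_def by blast
qed

text \<open>Reversing rows and columns is conjugation by the permutation matrix with rows
  \<open>(0, 1)\<close> and \<open>(1, 0)\<close>, under which a stem quadrant matrix just exchanges
  its off-diagonal entries.\<close>

lemma stem_factor_swap:
  assumes "stem_factor m22 m21 m12 m11 n22 n21 n12 n11"
  shows "stem_factor m11 m12 m21 m22 n11 n12 n21 n22"
proof -
  obtain b c p q r where "b > 0" "c > 0" "b * c < 1" "p * q > 0" "p * r > 0"
     "m22 + b * m12 = p * n22 - r * n21" "m21 + b * m11 = p * n21 - q * n22"
     "c * m22 + m12 = p * n12 - r * n11" "c * m21 + m11 = p * n11 - q * n12"
    using assms unfolding stem_factor_def by blast
  then have "c > 0 \<and> b > 0 \<and> c * b < 1 \<and> p * r > 0 \<and> p * q > 0 \<and>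
     m11 + c * m21 = p * n11 - q * n12 \<and> m12 + c * m22 = p * n12 - r * n11 \<and>
     b * m11 + m21 = p * n21 - q * n22 \<and> b * m12 + m22 = p * n22 - r * n21"
    by (simp add: add.commute mult.commute[of c b])
  then show ?thesis unfolding stem_factor_def by blast
qed

text \<open>\<open>p\<close>, \<open>-q\<close> and \<open>-r\<close> are read off from
  \<open>N\<^sup>-\<^sup>1 u M\<close>, and \<open>E\<close> says that its two diagonal entries
  agree. The number \<open>s\<close> witnesses that \<open>p\<close>, \<open>q\<close> and
  \<open>r\<close> have a common sign.\<close>

lemma stem_factorI:
  fixes m11 m12 m21 m22 n11 n12 n21 n22 b c :: real
  defines "p \<equiv> n22 * m11 - n12 * m21 + b * (n22 * m21) - c * (n12 * m11)"
    and "q \<equiv> n12 * m22 - n22 * m12 - b * (n22 * m22) + c * (n12 * m12)"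
    and "r \<equiv> n21 * m11 - n11 * m21 + b * (n21 * m21) - c * (n11 * m11)"
  assumes N: "n11 * n22 - n12 * n21 = 1"
    and E: "n22 * m11 - n12 * m21 + n21 * m12 - n11 * m22 + b * (n22 * m21 + n21 * m22)
      = c * (n12 * m11 + n11 * m12)"
    and "b > 0" "c > 0" "b * c < 1" "s * p > 0" "s * q > 0" "s * r > 0"
  shows "stem_factor m11 m12 m21 m22 n11 n12 n21 n22"
proof -
  have s: "p * q > 0" "p * r > 0"
    using assms(9-11) by (auto simp: zero_less_mult_iff)
  have p': "p = n11 * m22 - n21 * m12 - b * (n21 * m22) + c * (n11 * m12)"
    using E unfolding p_def by (simp add: algebra_simps)
  have "p * n11 - r * n12 = (n11 * n22 - n12 * n21) * (m11 + b * m21)"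
    unfolding p_def r_def by (simp add: algebra_simps)
  moreover have "p * n12 - q * n11 = (n11 * n22 - n12 * n21) * (m12 + b * m22)"
    unfolding p' q_def by (simp add: algebra_simps)
  moreover have "p * n21 - r * n22 = (n11 * n22 - n12 * n21) * (c * m11 + m21)"
    unfolding p_def r_def by (simp add: algebra_simps)
  moreover have "p * n22 - q * n21 = (n11 * n22 - n12 * n21) * (c * m12 + m22)"
    unfolding p' q_def by (simp add: algebra_simps)
  ultimately have "m11 + b * m21 = p * n11 - r * n12 \<and> m12 + b * m22 = p * n12 - q * n11 \<and>
     c * m11 + m21 = p * n21 - r * n22 \<and> c * m12 + m22 = p * n22 - q * n21"
    using N by simp
  then show ?thesis unfolding stem_factor_def using s assms(6-8) by blast
qed

section \<open>Positive solutions of the linear system by perturbation\<close>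

lemma eventually_at_right_pos:
  fixes f :: "real \<Rightarrow> real"
  assumes "isCont f 0" "f 0 > 0"
  shows "\<forall>\<^sub>F e in at_right 0. f e > 0"
  using assms order_tendstoD(1) filterlim_at_split isCont_def by metis

text \<open>The equations have an explicit solution with \<open>b = 0\<close>, which is then perturbed.\<close>

lemma stem_factor_perturb:
  assumes M: "m11 * m22 - m12 * m21 = 1" and N: "n11 * n22 - n12 * n21 = 1"
    and n: "n11 > 0" "n12 > 0" and m: "\<bar>m11\<bar> < n11" "\<bar>m12\<bar> < n12"
    and TS: "(n22 * m11 - n12 * m21 + n21 * m12 - n11 * m22) * (n12 * m11 + n11 * m12) > 0"
  shows "stem_factor m11 m12 m21 m22 n11 n12 n21 n22"
proof -
  \<comment> \<open>Condition \<open>E\<close> of \<open>stem_factorI\<close> becomes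
    \<open>c S = T + b (n22 m21 + n21 m22)\<close>. At \<open>b = 0\<close> its solution is
    \<open>c = T / S\<close>, which is positive precisely by the hypothesis
    \<open>TS\<close>.\<close>
  define T where "T = n22 * m11 - n12 * m21 + n21 * m12 - n11 * m22"
  define S where "S = n12 * m11 + n11 * m12"
  define c where "c b = (T + b * (n22 * m21 + n21 * m22)) / S" for b
  define p where "p b = n22 * m11 - n12 * m21 + b * (n22 * m21) - c b * (n12 * m11)" for b
  define q where "q b = n12 * m22 - n22 * m12 - b * (n22 * m22) + c b * (n12 * m12)" for b
  define r where "r b = n21 * m11 - n11 * m21 + b * (n21 * m21) - c b * (n11 * m11)" for b
  have S0: "S \<noteq> 0" and c0: "c 0 > 0" using TS
    by (auto simp: c_def T_def[symmetric] S_def[symmetric] zero_less_divide_iff zero_less_mult_iff)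
  have Sc: "S * c 0 = T" using S0 by (simp add: c_def)
  \<comment> \<open>Since both determinants are 1, the values of \<open>S p\<close>,
    \<open>S q\<close>, \<open>S r\<close> at 0 collapse to \<open>m11 m12 + n11 n12\<close>,
    \<open>n12\<^sup>2 - m12\<^sup>2\<close> and \<open>n11\<^sup>2 - m11\<^sup>2\<close>. The
    inequalities for the first row make them positive, and \<open>S\<close> serves as the common
    sign.\<close>
  have "S * p 0 = S * (n22 * m11 - n12 * m21) - (S * c 0) * (n12 * m11)"
    by (simp only: p_def) (simp add: algebra_simps)
  also have "\<dots> = m11 * m12 * (n11 * n22 - n12 * n21) + n11 * n12 * (m11 * m22 - m12 * m21)"
    unfolding Sc unfolding T_def S_def by (simp add: algebra_simps)
  also have "\<dots> > 0"
  proof -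
    have "\<bar>m11 * m12\<bar> < n11 * n12" unfolding abs_mult using m by (intro mult_strict_mono') auto
    then show ?thesis unfolding M N by simp
  qed
  finally have p0: "S * p 0 > 0" .
  have "S * q 0 = S * (n12 * m22 - n22 * m12) + (S * c 0) * (n12 * m12)"
    by (simp only: q_def) (simp add: algebra_simps)
  also have "\<dots> = n12\<^sup>2 * (m11 * m22 - m12 * m21) - m12\<^sup>2 * (n11 * n22 - n12 * n21)"
    unfolding Sc unfolding T_def S_def by (simp add: algebra_simps power2_eq_square)
  also have "\<dots> > 0" unfolding M N using m n power2_strict_mono[of m12 n12] by simp
  finally have q0: "S * q 0 > 0" .
  have "S * r 0 = S * (n21 * m11 - n11 * m21) - (S * c 0) * (n11 * m11)"
    by (simp only: r_def) (simp add: algebra_simps)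
  also have "\<dots> = n11\<^sup>2 * (m11 * m22 - m12 * m21) - m11\<^sup>2 * (n11 * n22 - n12 * n21)"
    unfolding Sc unfolding T_def S_def by (simp add: algebra_simps power2_eq_square)
  also have "\<dots> > 0" unfolding M N using m n power2_strict_mono[of m11 n11] by simp
  finally have r0: "S * r 0 > 0" .
  have "\<forall>\<^sub>F b in at_right 0. b > 0 \<and> c b > 0 \<and> 1 - b * c b > 0 \<and> S * p b > 0 \<and> S * q b > 0 \<and> S * r b > 0"
  proof (intro eventually_conj)
    show "\<forall>\<^sub>F b in at_right 0. (b::real) > 0" by (simp add: eventually_at_right_less)
    have "isCont c 0" unfolding c_def using S0 by (intro continuous_intros) auto
    note cont = continuous_intros this
    show "\<forall>\<^sub>F b in at_right 0. c b > 0" using c0 cont by (intro eventually_at_right_pos)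
    show "\<forall>\<^sub>F b in at_right 0. 1 - b * c b > 0"
      by (rule eventually_at_right_pos) (auto intro!: cont)
    show "\<forall>\<^sub>F b in at_right 0. S * p b > 0"
      by (rule eventually_at_right_pos) (use p0 in \<open>auto simp: p_def intro!: cont\<close>)
    show "\<forall>\<^sub>F b in at_right 0. S * q b > 0"
      by (rule eventually_at_right_pos) (use q0 in \<open>auto simp: q_def intro!: cont\<close>)
    show "\<forall>\<^sub>F b in at_right 0. S * r b > 0"
      by (rule eventually_at_right_pos) (use r0 in \<open>auto simp: r_def intro!: cont\<close>)
  qed
  then obtain b where b: "b > 0" "c b > 0" "1 - b * c b > 0" "S * p b > 0" "S * q b > 0" "S * r b > 0"
    using eventually_happens[of _ "at_right (0::real)"] by (auto simp: trivial_limit_at_right_real)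
  have "T + b * (n22 * m21 + n21 * m22) = c b * S" using S0 by (simp add: c_def)
  then show ?thesis
    by (intro stem_factorI[of n11 n22 n12 n21 m11 m21 m12 m22 b "c b" S])
       (use N b in \<open>simp_all add: T_def S_def p_def q_def r_def\<close>)
qed

text \<open>By \<open>T\<close> the diagonal of \<open>M\<close> is \<open>x\<close> times that of
  \<open>N\<close> and the antidiagonal \<open>y\<close> times that of \<open>N\<close>. Then
  \<open>E\<close> holds along the whole ray \<open>(b, c) = k (n11 n12, n21 n22)\<close>. At
  \<open>k = 0\<close>, where \<open>u = 1\<close>, the numbers \<open>p\<close>, \<open>q\<close>,
  \<open>r\<close> have the sign of \<open>x\<close>, because the determinants force
  \<open>y\<^sup>2 < x\<^sup>2\<close>; a small \<open>k > 0\<close> keeps these signs.\<close>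

lemma stem_factor_common_axis:
  assumes M: "m11 * m22 - m12 * m21 = 1" and N: "n11 * n22 - n12 * n21 = 1"
    and n: "n11 > 0" "n12 > 0" "n21 > 0" "n22 > 0"
    and m: "\<bar>m11\<bar> < n11" "\<bar>m12\<bar> < n12" "\<bar>m21\<bar> < n21" "\<bar>m22\<bar> < n22"
    and T: "n22 * m11 = n11 * m22" "n21 * m12 = n12 * m21"
  shows "stem_factor m11 m12 m21 m22 n11 n12 n21 n22"
proof -
  define x where "x = m11 / n11"
  define y where "y = m12 / n12"
  have x: "m11 = n11 * x" "m22 = n22 * x" and y: "m12 = n12 * y" "m21 = n21 * y"
    using n T by (auto simp: x_def y_def field_simps)
  define A where "A = n11 * n22"
  define B where "B = n12 * n21"
  have AB: "A > 0" "B > 0" "A - B = 1" using n N by (auto simp: A_def B_def)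
  have xy1: "A * x\<^sup>2 - B * y\<^sup>2 = 1" using M unfolding x y A_def B_def by (simp add: algebra_simps power2_eq_square)
  have "\<bar>y\<bar> < 1" using n m by (simp add: y_def)
  then have y2: "y\<^sup>2 < 1" by (simp add: abs_square_less_1)
  have "A * (1 - x\<^sup>2) = B * (1 - y\<^sup>2)" using AB xy1 by (simp add: algebra_simps)
  also have "\<dots> < A * (1 - y\<^sup>2)" using AB y2 by (intro mult_strict_right_mono) auto
  finally have "y\<^sup>2 < x\<^sup>2" using AB by simp
  then have yx: "\<bar>y\<bar> < \<bar>x\<bar>" by (simp add: abs_le_square_iff not_le[symmetric])
  have BA: "\<bar>B * y\<bar> < \<bar>A * x\<bar>" unfolding abs_mult using AB yx by (intro mult_strict_mono') auto
  have s1: "x * (A * x - B * y) > 0" and s2: "x * (x - y) > 0"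
  proof -
    have "x > 0 \<or> x < 0" using yx by auto
    then show "x * (A * x - B * y) > 0"
    proof
      assume "x > 0"
      then show ?thesis using BA AB(1) by (intro mult_pos_pos) auto
    next
      assume "x < 0"
      then have "A * x < 0" using AB(1) by (simp add: mult_less_0_iff)
      then show ?thesis using BA \<open>x < 0\<close> by (intro mult_neg_neg) auto
    qed
    show "x * (x - y) > 0" using yx by (auto simp: zero_less_mult_iff)
  qed
  define p where "p k = n22 * m11 - n12 * m21 + (k * (n11 * n12)) * (n22 * m21) - (k * (n21 * n22)) * (n12 * m11)" for k
  define q where "q k = n12 * m22 - n22 * m12 - (k * (n11 * n12)) * (n22 * m22) + (k * (n21 * n22)) * (n12 * m12)" for k
  define r where "r k = n21 * m11 - n11 * m21 + (k * (n11 * n12)) * (n21 * m21) - (k * (n21 * n22)) * (n11 * m11)" for k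
  have p0: "x * p 0 > 0" using s1 by (simp add: p_def x y A_def B_def algebra_simps)
  have "x * q 0 = n12 * n22 * (x * (x - y))" by (simp add: q_def x y algebra_simps)
  also have "\<dots> > 0" by (rule mult_pos_pos[OF mult_pos_pos[OF n(2,4)] s2])
  finally have q0: "x * q 0 > 0" .
  have "x * r 0 = n11 * n21 * (x * (x - y))" by (simp add: r_def x y algebra_simps)
  also have "\<dots> > 0" by (rule mult_pos_pos[OF mult_pos_pos[OF n(1,3)] s2])
  finally have r0: "x * r 0 > 0" .
  have "\<forall>\<^sub>F k in at_right 0. k > 0 \<and> 1 - (k * (n11 * n12)) * (k * (n21 * n22)) > 0 \<and> x * p k > 0 \<and> x * q k > 0 \<and> x * r k > 0"
  proof (intro eventually_conj)
    show "\<forall>\<^sub>F k in at_right 0. (k::real) > 0" by (simp add: eventually_at_right_less)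
    show "\<forall>\<^sub>F k in at_right 0. 1 - (k * (n11 * n12)) * (k * (n21 * n22)) > 0"
      by (rule eventually_at_right_pos) (auto intro!: continuous_intros)
    show "\<forall>\<^sub>F k in at_right 0. x * p k > 0"
      by (rule eventually_at_right_pos) (use p0 in \<open>auto simp: p_def intro!: continuous_intros\<close>)
    show "\<forall>\<^sub>F k in at_right 0. x * q k > 0"
      by (rule eventually_at_right_pos) (use q0 in \<open>auto simp: q_def intro!: continuous_intros\<close>)
    show "\<forall>\<^sub>F k in at_right 0. x * r k > 0"
      by (rule eventually_at_right_pos) (use r0 in \<open>auto simp: r_def intro!: continuous_intros\<close>)
  qed
  then obtain k where k: "k > 0" "1 - (k * (n11 * n12)) * (k * (n21 * n22)) > 0"
      "x * p k > 0" "x * q k > 0" "x * r k > 0"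
    using eventually_happens[of _ "at_right (0::real)"] by (auto simp: trivial_limit_at_right_real)
  have E: "n22 * m11 - n12 * m21 + n21 * m12 - n11 * m22 + (k * (n11 * n12)) * (n22 * m21 + n21 * m22)
      = (k * (n21 * n22)) * (n12 * m11 + n11 * m12)"
    by (simp add: x y algebra_simps)
  show ?thesis
    by (rule stem_factorI[OF N E, of x])
       (use k n in \<open>simp_all only: p_def q_def r_def mult_pos_pos diff_gt_0_iff_gt\<close>)
qed

text \<open>With \<open>x\<close>, \<open>y\<close>, \<open>z\<close>, \<open>w\<close> the
  quotients of the entries of \<open>M\<close> by those of \<open>N\<close>, the conditions
  \<open>s\<close> say that all four versions of the sign hypothesis of
  \<open>stem_factor_perturb\<close> fail. A nonzero \<open>T\<close> or \<open>T'\<close> orders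
  \<open>x\<close> against \<open>w\<close> or \<open>y\<close> against \<open>z\<close>, through
  \<open>T + T'\<close> or \<open>T - T'\<close>, and the bounds on the sums contradict this
  order.\<close>

lemma stem_factor_signs:
  fixes A B x y z w T T' :: real
  assumes AB: "A > 0" "B > 0" and T: "T + T' = A * (x - w)" "T - T' = B * (y - z)"
    and s: "T * (x + y) \<le> 0" "T * (z + w) \<ge> 0" "T' * (x + z) \<le> 0" "T' * (y + w) \<ge> 0"
  shows "T = 0 \<and> T' = 0"
proof -
  have xw: "x > w" if "T + T' > 0" using that AB unfolding T by (simp add: zero_less_mult_iff)
  have xw': "x < w" if "T + T' < 0" using that AB unfolding T by (simp add: mult_less_0_iff)
  have yz: "y > z" if "T - T' > 0" using that AB unfolding T by (simp add: zero_less_mult_iff)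
  have yz': "y < z" if "T - T' < 0" using that AB unfolding T by (simp add: mult_less_0_iff)
  have sT: "x + y \<le> 0 \<and> z + w \<ge> 0" if "T > 0" using that s by (simp add: mult_le_0_iff zero_le_mult_iff)
  have sT': "x + y \<ge> 0 \<and> z + w \<le> 0" if "T < 0" using that s by (simp add: mult_le_0_iff zero_le_mult_iff)
  have sU: "x + z \<le> 0 \<and> y + w \<ge> 0" if "T' > 0" using that s by (simp add: mult_le_0_iff zero_le_mult_iff)
  have sU': "x + z \<ge> 0 \<and> y + w \<le> 0" if "T' < 0" using that s by (simp add: mult_le_0_iff zero_le_mult_iff)
  show ?thesis
  proof (cases T "0::real" rule: linorder_cases)
    case less
    have "False"
    proof (cases T' "0::real" rule: linorder_cases)
      case less then show False using xw' sT' sU' \<open>T < 0\<close> by linarith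
    next
      case equal then show False using xw' yz' sT' \<open>T < 0\<close> by linarith
    next
      case greater then show False using yz' sT' sU \<open>T < 0\<close> by linarith
    qed
    then show ?thesis ..
  next
    case greater
    have "False"
    proof (cases T' "0::real" rule: linorder_cases)
      case less then show False using yz sT sU' \<open>T > 0\<close> by linarith
    next
      case equal then show False using xw yz sT \<open>T > 0\<close> by linarith
    next
      case greater then show False using xw sT sU \<open>T > 0\<close> by linarith
    qed
    then show ?thesis ..
  next
    case equal
    have "\<not> T' > 0" using xw yz' sU equal by linarith
    moreover have "\<not> T' < 0" using xw' yz sU' equal by linarith
    ultimately show ?thesis using equal by simp
  qed
qed

text \<open>Reversal of rows and columns turns \<open>T\<close> into \<open>-T\<close>,
  transposition turns it into \<open>T'\<close>. The first four cases are
  \<open>stem_factor_perturb\<close> for the four resulting pairs of matrices; in the last case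
  \<open>T\<close> and \<open>T'\<close> both vanish.\<close>

lemma stem_factor_exists:
  assumes M: "m11 * m22 - m12 * m21 = 1" and N: "n11 * n22 - n12 * n21 = 1"
    and n: "n11 > 0" "n12 > 0" "n21 > 0" "n22 > 0"
    and m: "\<bar>m11\<bar> < n11" "\<bar>m12\<bar> < n12" "\<bar>m21\<bar> < n21" "\<bar>m22\<bar> < n22"
  shows "stem_factor m11 m12 m21 m22 n11 n12 n21 n22"
proof -
  define T where "T = n22 * m11 - n12 * m21 + n21 * m12 - n11 * m22"
  define T' where "T' = n22 * m11 - n21 * m12 + n12 * m21 - n11 * m22"
  have M': "m22 * m11 - m21 * m12 = 1" "m22 * m11 - m12 * m21 = 1" "m11 * m22 - m21 * m12 = 1"
    and N': "n22 * n11 - n21 * n12 = 1" "n22 * n11 - n12 * n21 = 1" "n11 * n22 - n21 * n12 = 1"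
    using M N by (simp_all add: mult.commute)
  consider "T * (n12 * m11 + n11 * m12) > 0" | "T * (n21 * m22 + n22 * m21) < 0"
    | "T' * (n21 * m11 + n11 * m21) > 0" | "T' * (n12 * m22 + n22 * m12) < 0"
    | "T * (n12 * m11 + n11 * m12) \<le> 0" "T * (n21 * m22 + n22 * m21) \<ge> 0"
      "T' * (n21 * m11 + n11 * m21) \<le> 0" "T' * (n12 * m22 + n22 * m12) \<ge> 0"
    by linarith
  then show ?thesis
  proof cases
    case 1
    then show ?thesis using stem_factor_perturb M N n m unfolding T_def by blast
  next
    case 2
    then have "(n11 * m22 - n21 * m12 + n12 * m21 - n22 * m11) * (n21 * m22 + n22 * m21) > 0"
      unfolding T_def by (simp add: mult_less_0_iff zero_less_mult_iff) linarith
    then show ?thesis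
      by (rule stem_factor_swap[OF stem_factor_perturb[OF M'(1) N'(1) n(4,3) m(4,3)]])
  next
    case 3
    then show ?thesis unfolding T'_def
      by (intro stem_factor_transpose[OF M N stem_factor_perturb[OF M'(3) N'(3) n(1,3) m(1,3)]]) simp
  next
    case 4
    then have "(n11 * m22 - n12 * m21 + n21 * m12 - n22 * m11) * (n12 * m22 + n22 * m12) > 0"
      unfolding T'_def by (simp add: mult_less_0_iff zero_less_mult_iff) linarith
    then show ?thesis
      by (rule stem_factor_transpose[OF M N stem_factor_swap[OF stem_factor_perturb[OF M'(2) N'(2) n(4,2) m(4,2)]]])
  next
    case 5
    define x where "x = m11 / n11"
    define y where "y = m12 / n12"
    define z where "z = m21 / n21"
    define w where "w = m22 / n22"
    have e: "m11 = n11 * x" "m12 = n12 * y" "m21 = n21 * z" "m22 = n22 * w"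
      using n by (simp_all add: x_def y_def z_def w_def)
    have f: "n12 * m11 + n11 * m12 = n11 * n12 * (x + y)" "n21 * m22 + n22 * m21 = n21 * n22 * (z + w)"
      "n21 * m11 + n11 * m21 = n11 * n21 * (x + z)" "n12 * m22 + n22 * m12 = n12 * n22 * (y + w)"
      unfolding e by (simp_all add: algebra_simps)
    have pp: "n11 * n12 > 0" "n21 * n22 > 0" "n11 * n21 > 0" "n12 * n22 > 0" using n by simp_all
    have cancel: "(t * (k * u) \<le> 0 \<longleftrightarrow> t * u \<le> 0) \<and> (0 \<le> t * (k * u) \<longleftrightarrow> 0 \<le> t * u)" if "k > 0" for t k u :: real
      using that by (simp add: mult_le_0_iff zero_le_mult_iff)
    have "T = 0 \<and> T' = 0"
    proof (rule stem_factor_signs[of "2 * (n11 * n22)" "2 * (n12 * n21)" _ _ x w y z])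
      show "T + T' = 2 * (n11 * n22) * (x - w)" "T - T' = 2 * (n12 * n21) * (y - z)"
        unfolding T_def T'_def e by (simp_all add: algebra_simps)
    qed (use n 5[unfolded f] cancel pp in auto)
    then show ?thesis
      by (intro stem_factor_common_axis) (use M N n m in \<open>simp_all add: T_def T'_def\<close>)
  qed
qed

section \<open>Geodesics and equivariance\<close>

abbreviation rp :: "real \<Rightarrow> real \<Rightarrow> pt" where
  "rp x y \<equiv> cp (of_real x) (of_real y)"

lemma bdry_cases_rp:
  assumes "p \<in> bdry" obtains x y where "p = rp x y" "x \<noteq> 0 \<or> y \<noteq> 0"
proof -
  from assms consider r where "p = Fin (of_real r)" | "p = Infty" unfolding bdry_def by blast
  then show ?thesis
  proof cases
    case 1 then show ?thesis using that[of r 1] by simp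
  next
    case 2 then show ?thesis using that[of 1 0] by simp
  qed
qed

lemma rp_bdry: "rp x y \<in> bdry"
  unfolding cp_def bdry_def by (auto simp flip: of_real_divide)

lemma rp_eq_iff:
  assumes "x \<noteq> 0 \<or> y \<noteq> 0" "x' \<noteq> 0 \<or> y' \<noteq> 0"
  shows "rp x y = rp x' y' \<longleftrightarrow> x * y' = x' * y"
  using assms by (subst cp_eq_iff) (auto simp flip: of_real_mult)

lemma mob_rp:
  assumes "a * d - b * c = 1" "x \<noteq> 0 \<or> y \<noteq> 0"
  shows "mob a b c d (rp x y) = rp (a * x + b * y) (c * x + d * y)"
  using assms by (subst mob_cp) auto

lemma det_nonzero_vec_real:
  fixes a b c d x y :: real
  assumes "a * d - b * c = 1" "x \<noteq> 0 \<or> y \<noteq> 0"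
  shows "a * x + b * y \<noteq> 0 \<or> c * x + d * y \<noteq> 0"
  using det_nonzero_vec[OF assms(1), of x y] assms(2)
  by (simp flip: of_real_mult of_real_add)

lemma G0_bdry: assumes "g \<in> G0" "p \<in> bdry" shows "g p \<in> bdry"
  using assms mob_rp by (metis G0E bdry_cases_rp rp_bdry)

lemma mob_Fin:
  assumes "a * d - b * c = 1" "Im z > 0"
  shows "of_real c * z + of_real d \<noteq> 0"
    "mob a b c d (Fin z) = Fin ((of_real a * z + of_real b) / (of_real c * z + of_real d))"
    "Im ((of_real a * z + of_real b) / (of_real c * z + of_real d)) > 0"
    "Re ((of_real a * z + of_real b) / (of_real c * z + of_real d)) =
      (a * c * (cmod z)\<^sup>2 + (a * d + b * c) * Re z + b * d) / (cmod (of_real c * z + of_real d))\<^sup>2"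
proof -
  show n: "of_real c * z + of_real d \<noteq> 0"
  proof
    assume "of_real c * z + of_real d = 0"
    from arg_cong[OF this, of Re] arg_cong[OF this, of Im] assms show False by auto
  qed
  then show "mob a b c d (Fin z) = Fin ((of_real a * z + of_real b) / (of_real c * z + of_real d))"
    by (simp add: mob_def)
  have "Im ((of_real a * z + of_real b) / (of_real c * z + of_real d)) = Im z / (cmod (of_real c * z + of_real d))\<^sup>2"
  proof -
    have "a * Im z * (c * Re z + d) - (a * Re z + b) * (c * Im z) = (a * d - b * c) * Im z"
      by (simp add: algebra_simps)
    then show ?thesis using assms(1) by (simp add: Im_divide cmod_power2)
  qed
  then show "Im ((of_real a * z + of_real b) / (of_real c * z + of_real d)) > 0"
    using n assms(2) by simp
  have "(a * Re z + b) * (c * Re z + d) + (a * Im z) * (c * Im z)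
    = a * c * (cmod z)\<^sup>2 + (a * d + b * c) * Re z + b * d"
    unfolding cmod_power2 by (simp add: algebra_simps power2_eq_square)
  then show "Re ((of_real a * z + of_real b) / (of_real c * z + of_real d)) =
      (a * c * (cmod z)\<^sup>2 + (a * d + b * c) * Re z + b * d) / (cmod (of_real c * z + of_real d))\<^sup>2"
    by (simp add: Re_divide cmod_power2)
qed

lemma G0_Hpl: assumes "g \<in> G0" "p \<in> Hpl" shows "g p \<in> Hpl"
  using assms mob_Fin(2,3) unfolding Hpl_def by (auto elim!: G0E)

text \<open>Thales' theorem: the equation says that the real part of
  \<open>(v2 z - v1) * cnj (w2 z - w1)\<close> vanishes, so the ends are seen from \<open>z\<close>
  under a right angle. Being homogeneous in the endpoint vectors, it covers half circles and
  vertical lines alike.\<close>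

lemma geod_rp:
  assumes "v1 \<noteq> 0 \<or> v2 \<noteq> 0" "w1 \<noteq> 0 \<or> w2 \<noteq> 0" "rp v1 v2 \<noteq> rp w1 w2"
  shows "geod (rp v1 v2) (rp w1 w2) =
    {Fin z | z. Im z > 0 \<and> v2 * w2 * (cmod z)\<^sup>2 - (v1 * w2 + v2 * w1) * Re z + v1 * w1 = 0}"
proof -
  have d: "v1 * w2 \<noteq> w1 * v2" using assms rp_eq_iff by metis
  consider "v2 \<noteq> 0" "w2 \<noteq> 0" | "v2 = 0" "w2 \<noteq> 0" | "v2 \<noteq> 0" "w2 = 0" using d by fastforce
  then show ?thesis
  proof cases
    case 1
    have "cmod (z - (of_real v1 / of_real v2 + of_real w1 / of_real w2) / 2) = cmod (of_real v1 / of_real v2 - of_real w1 / of_real w2) / 2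
      \<longleftrightarrow> v2 * w2 * (cmod z)\<^sup>2 - (v1 * w2 + v2 * w1) * Re z + v1 * w1 = 0" for z
    proof -
      define a where "a = v1 / v2"
      define b where "b = w1 / w2"
      have ab: "v1 = a * v2" "w1 = b * w2" using 1 by (auto simp: a_def b_def)
      have "cmod (z - (of_real a + of_real b) / 2) = cmod (of_real a - of_real b) / 2
        \<longleftrightarrow> (cmod (z - (of_real a + of_real b) / 2))\<^sup>2 = (cmod (of_real a - of_real b) / 2)\<^sup>2"
        by (intro power2_eq_iff_nonneg[symmetric]) auto
      also have "\<dots> \<longleftrightarrow> (cmod (z - (of_real a + of_real b) / 2))\<^sup>2 - (cmod (of_real a - of_real b) / 2)\<^sup>2 = 0"
        by simp
      also have "(cmod (z - (of_real a + of_real b) / 2))\<^sup>2 - (cmod (of_real a - of_real b) / 2)\<^sup>2 = 0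
          \<longleftrightarrow> (cmod z)\<^sup>2 - (a + b) * Re z + a * b = 0"
      proof -
        have "(cmod (z - (of_real a + of_real b) / 2))\<^sup>2 - (cmod (of_real a - of_real b) / 2)\<^sup>2
          = (cmod z)\<^sup>2 - (a + b) * Re z + a * b"
          by (simp add: cmod_power2 power_divide) (simp add: power2_eq_square field_simps)
        then show ?thesis by (simp only:)
      qed
      also have "\<dots> \<longleftrightarrow> v2 * w2 * ((cmod z)\<^sup>2 - (a + b) * Re z + a * b) = 0" using 1 by simp
      also have "v2 * w2 * ((cmod z)\<^sup>2 - (a + b) * Re z + a * b)
        = v2 * w2 * (cmod z)\<^sup>2 - (v1 * w2 + v2 * w1) * Re z + v1 * w1"
        unfolding ab by (simp add: algebra_simps)
      finally show ?thesis by (simp add: a_def b_def)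
    qed
    then show ?thesis using 1 by (simp add: geod_def cp_def)
  next
    case 2
    then have "v1 \<noteq> 0" using d by auto
    then show ?thesis using 2 by (auto simp: geod_def cp_def field_simps)
  next
    case 3
    then have "w1 \<noteq> 0" using d by auto
    then show ?thesis using 3 by (auto simp: geod_def cp_def field_simps)
  qed
qed

lemma G0_inj: "g \<in> G0 \<Longrightarrow> g x = g y \<longleftrightarrow> x = y"
  by (metis G0_inv_comp(4))

text \<open>The equation of \<open>geod_rp\<close> is covariant: after clearing the denominator
  \<open>D\<close>, the equation of the image is the original one times the squared
  determinant.\<close>

lemma geod_image_subset:
  assumes "g \<in> G0" "p \<in> bdry" "q \<in> bdry" "p \<noteq> q"
  shows "g ` geod p q \<subseteq> geod (g p) (g q)"
proof -
  obtain a b c d where g: "g = mob a b c d" "a * d - b * c = 1" using assms(1) by (rule G0E)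
  obtain v1 v2 where p: "p = rp v1 v2" and v: "v1 \<noteq> 0 \<or> v2 \<noteq> 0" using assms(2) by (rule bdry_cases_rp)
  obtain w1 w2 where q: "q = rp w1 w2" and w: "w1 \<noteq> 0 \<or> w2 \<noteq> 0" using assms(3) by (rule bdry_cases_rp)
  define v1' where "v1' = a * v1 + b * v2"
  define v2' where "v2' = c * v1 + d * v2"
  define w1' where "w1' = a * w1 + b * w2"
  define w2' where "w2' = c * w1 + d * w2"
  have v': "v1' \<noteq> 0 \<or> v2' \<noteq> 0" and w': "w1' \<noteq> 0 \<or> w2' \<noteq> 0"
    using det_nonzero_vec_real[OF g(2)] v w unfolding v1'_def v2'_def w1'_def w2'_def by blast+
  have gp: "g p = rp v1' v2'" and gq: "g q = rp w1' w2'"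
    unfolding p q g(1) v1'_def v2'_def w1'_def w2'_def using mob_rp[OF g(2)] v w by auto
  have ne: "rp v1' v2' \<noteq> rp w1' w2'" using gp gq assms(1,4) G0_inj by metis
  show ?thesis
  proof
    fix y assume "y \<in> g ` geod p q"
    then obtain z where y: "y = g (Fin z)" and z: "Im z > 0"
      and e: "v2 * w2 * (cmod z)\<^sup>2 - (v1 * w2 + v2 * w1) * Re z + v1 * w1 = 0"
      using geod_rp[OF v w] assms(4) unfolding p q by auto
    define N where "N = of_real a * z + of_real b"
    define D where "D = of_real c * z + of_real d"
    note m = mob_Fin[OF g(2) z, folded N_def D_def]
    have "(cmod D)\<^sup>2 * (v2' * w2' * (cmod (N / D))\<^sup>2 - (v1' * w2' + v2' * w1') * Re (N / D) + v1' * w1')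
      = v2' * w2' * (cmod N)\<^sup>2 - (v1' * w2' + v2' * w1') * (a * c * (cmod z)\<^sup>2 + (a * d + b * c) * Re z + b * d) + v1' * w1' * (cmod D)\<^sup>2"
      using m(1) unfolding m(4) by (simp add: norm_divide power_divide field_simps)
    also have "\<dots> = (a * d - b * c)\<^sup>2 * (v2 * w2 * (cmod z)\<^sup>2 - (v1 * w2 + v2 * w1) * Re z + v1 * w1)"
      unfolding N_def D_def v1'_def v2'_def w1'_def w2'_def
      by (simp add: cmod_power2) (simp add: algebra_simps power2_eq_square)
    finally have "v2' * w2' * (cmod (N / D))\<^sup>2 - (v1' * w2' + v2' * w1') * Re (N / D) + v1' * w1' = 0"
      unfolding e using m(1) by simp
    moreover have "y = Fin (N / D)" using y m(2) unfolding g(1) by simp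
    ultimately show "y \<in> geod (g p) (g q)"
      unfolding gp gq geod_rp[OF v' w' ne] using m(3) by simp
  qed
qed

lemma geod_image:
  assumes g: "g \<in> G0" and "p \<in> bdry" "q \<in> bdry" "p \<noteq> q"
  shows "g ` geod p q = geod (g p) (g q)"
proof
  show "g ` geod p q \<subseteq> geod (g p) (g q)" using assms by (rule geod_image_subset)
  have "inv g ` geod (g p) (g q) \<subseteq> geod p q"
    using geod_image_subset[of "inv g" "g p" "g q"] assms inv_G0 G0_bdry G0_inj G0_inv_comp(4)[OF g] by auto
  then have "g ` inv g ` geod (g p) (g q) \<subseteq> g ` geod p q" by blast
  then show "geod (g p) (g q) \<subseteq> g ` geod p q" by (simp add: image_image G0_inv_comp(5)[OF g])
qed

lemma is_ends_image: "g \<in> G0 \<Longrightarrow> is_ends L p q \<Longrightarrow> is_ends (g ` L) (g p) (g q)"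
  unfolding is_ends_def using geod_image G0_bdry G0_inj by metis

lemma G0_image_inv: "g \<in> G0 \<Longrightarrow> inv g ` g ` L = L" "g \<in> G0 \<Longrightarrow> g ` inv g ` L = L"
  by (simp_all add: image_image G0_inv_comp)

section \<open>Conjugation and fixed points\<close>

lemma gclosure_image_subset: 
  assumes "g \<in> G0" "x \<in> gclosure L" shows "g x \<in> gclosure (g ` L)"
  using assms is_ends_image unfolding gclosure_def by blast

text \<open>Besides determinant and trace, the conjugate matrix keeps each eigenvalue on the
  transported eigenvector; the last clause is what carries attracting fixed points along.\<close>

lemma conj_mob:
  assumes k: "k1 * k4 - k2 * k3 = 1" and h: "a * d - b * c = 1"
  obtains a' b' c' d' where "a' * d' - b' * c' = 1" "a' + d' = a + d"
    "mob k1 k2 k3 k4 \<circ> mob a b c d \<circ> inv (mob k1 k2 k3 k4) = mob a' b' c' d'"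
    "\<And>x y l. a * x + b * y = l * x \<Longrightarrow> c * x + d * y = l * y \<Longrightarrow>
      a' * (k1 * x + k2 * y) + b' * (k3 * x + k4 * y) = l * (k1 * x + k2 * y) \<and>
      c' * (k1 * x + k2 * y) + d' * (k3 * x + k4 * y) = l * (k3 * x + k4 * y)"
proof -
  define a' where "a' = (k1 * a + k2 * c) * k4 - (k1 * b + k2 * d) * k3"
  define b' where "b' = - (k1 * a + k2 * c) * k2 + (k1 * b + k2 * d) * k1"
  define c' where "c' = (k3 * a + k4 * c) * k4 - (k3 * b + k4 * d) * k3"
  define d' where "d' = - (k3 * a + k4 * c) * k2 + (k3 * b + k4 * d) * k1"
  have "a' * d' - b' * c' = (k1 * k4 - k2 * k3)\<^sup>2 * (a * d - b * c)"
    unfolding a'_def b'_def c'_def d'_def by (simp add: algebra_simps power2_eq_square)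
  then have 1: "a' * d' - b' * c' = 1" using k h by simp
  have "a' + d' = (k1 * k4 - k2 * k3) * (a + d)"
    unfolding a'_def d'_def by (simp add: algebra_simps)
  then have 2: "a' + d' = a + d" using k by simp
  have dk: "k4 * k1 - (- k2) * (- k3) = 1" using k by (simp add: mult.commute)
  have "(k1 * a + k2 * c) * (k3 * b + k4 * d) - (k1 * b + k2 * d) * (k3 * a + k4 * c)
    = (k1 * k4 - k2 * k3) * (a * d - b * c)"
    by (simp add: algebra_simps)
  then have dm: "(k1 * a + k2 * c) * (k3 * b + k4 * d) - (k1 * b + k2 * d) * (k3 * a + k4 * c) = 1"
    using k h by simp
  have 3: "mob k1 k2 k3 k4 \<circ> mob a b c d \<circ> inv (mob k1 k2 k3 k4) = mob a' b' c' d'"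
  proof -
    have "a' = (k1 * a + k2 * c) * k4 + (k1 * b + k2 * d) * - k3"
      "b' = (k1 * a + k2 * c) * - k2 + (k1 * b + k2 * d) * k1"
      "c' = (k3 * a + k4 * c) * k4 + (k3 * b + k4 * d) * - k3"
      "d' = (k3 * a + k4 * c) * - k2 + (k3 * b + k4 * d) * k1"
      by (simp_all add: a'_def b'_def c'_def d'_def algebra_simps)
    then show ?thesis by (simp only: inv_mob[OF k] mob_comp[OF k h] mob_comp[OF dm dk])
  qed
  have 4: "a' * (k1 * x + k2 * y) + b' * (k3 * x + k4 * y) = l * (k1 * x + k2 * y) \<and>
      c' * (k1 * x + k2 * y) + d' * (k3 * x + k4 * y) = l * (k3 * x + k4 * y)"
    if "a * x + b * y = l * x" "c * x + d * y = l * y" for x y l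
  proof
    have "a' * (k1 * x + k2 * y) + b' * (k3 * x + k4 * y) = (k1 * k4 - k2 * k3) * (k1 * (a * x + b * y) + k2 * (c * x + d * y))"
      unfolding a'_def b'_def by (simp add: algebra_simps)
    then show "a' * (k1 * x + k2 * y) + b' * (k3 * x + k4 * y) = l * (k1 * x + k2 * y)"
      unfolding that k by (simp add: algebra_simps)
    have "c' * (k1 * x + k2 * y) + d' * (k3 * x + k4 * y) = (k1 * k4 - k2 * k3) * (k3 * (a * x + b * y) + k4 * (c * x + d * y))"
      unfolding c'_def d'_def by (simp add: algebra_simps)
    then show "c' * (k1 * x + k2 * y) + d' * (k3 * x + k4 * y) = l * (k3 * x + k4 * y)"
      unfolding that k by (simp add: algebra_simps)
  qed
  show ?thesis using that[OF 1 2 3 4] .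
qed

text \<open>At a fixed point with eigenvalue \<open>l\<close> the derivative is
  \<open>1 / l\<^sup>2\<close>, and \<open>l\<close> is \<open>c z + d\<close> at a finite point
  \<open>z\<close> and \<open>a\<close> at infinity. The eigenvector form depends on no chart and is
  therefore suited to conjugation.\<close>

lemma attracting_iff_eigenvector:
  "attracting h p \<longleftrightarrow> (\<exists>a b c d x y l. a * d - b * c = 1 \<and> h = mob a b c d \<and> p = rp x y \<and> (x \<noteq> 0 \<or> y \<noteq> 0) \<and>
     a * x + b * y = l * x \<and> c * x + d * y = l * y \<and> l\<^sup>2 > 1)" (is "_ \<longleftrightarrow> ?R")
proof
  assume "attracting h p"
  then obtain a b c d where p: "p \<in> bdry" "h p = p" and m: "a * d - b * c = 1" "h = mob a b c d"
    and l: "case p of Fin z \<Rightarrow> (c * Re z + d)\<^sup>2 > 1 | Infty \<Rightarrow> a\<^sup>2 > 1"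
    unfolding attracting_def by blast
  obtain x y where xy: "p = rp x y" "x \<noteq> 0 \<or> y \<noteq> 0" using p(1) by (rule bdry_cases_rp)
  have "rp (a * x + b * y) (c * x + d * y) = rp x y" using p(2) mob_rp[OF m(1) xy(2)] xy m(2) by simp
  then have e: "(a * x + b * y) * y = x * (c * x + d * y)"
    using rp_eq_iff[OF det_nonzero_vec_real[OF m(1) xy(2)] xy(2)] by simp
  show ?R
  proof (cases "y = 0")
    case True
    then have "c = 0" using e xy(2) by simp
    moreover have "a\<^sup>2 > 1" using l xy(1) True by (simp add: cp_def)
    moreover have "a * x + b * y = a * x" "c * x + d * y = a * y" using True \<open>c = 0\<close> by simp_all
    ultimately show ?thesis using xy m by blast
  next
    case False
    then have "(c * (x / y) + d)\<^sup>2 > 1" using l xy by (simp add: cp_def flip: of_real_divide)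
    moreover have "a * x + b * y = (c * (x / y) + d) * x" "c * x + d * y = (c * (x / y) + d) * y"
      using e False by (auto simp: field_simps)
    ultimately show ?thesis using xy m by blast
  qed
next
  assume ?R
  then obtain a b c d x y l where m: "a * d - b * c = 1" "h = mob a b c d" and xy: "p = rp x y" "x \<noteq> 0 \<or> y \<noteq> 0"
     and e: "a * x + b * y = l * x" "c * x + d * y = l * y" and l: "l\<^sup>2 > 1" by blast
  have l0: "l \<noteq> 0" using l by auto
  have "h p = p" unfolding m(2) xy(1) mob_rp[OF m(1) xy(2)] e
    using l0 xy(2) by (subst rp_eq_iff) auto
  moreover have "case p of Fin z \<Rightarrow> (c * Re z + d)\<^sup>2 > 1 | Infty \<Rightarrow> a\<^sup>2 > 1"
  proof (cases "y = 0")
    case True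
    then show ?thesis using xy e l by (simp add: cp_def)
  next
    case False
    then have "c * (x / y) + d = l" using e(2) by (simp add: field_simps)
    then show ?thesis using False xy l by (simp add: cp_def flip: of_real_divide)
  qed
  ultimately show "attracting h p" unfolding attracting_def xy(1) using rp_bdry m by blast
qed

lemma conj_class:
  assumes "k \<in> G0"
  shows "hyperbolic h \<Longrightarrow> hyperbolic (k \<circ> h \<circ> inv k)"
    and "elliptic h \<Longrightarrow> elliptic (k \<circ> h \<circ> inv k)"
    and "parabolic h \<Longrightarrow> parabolic (k \<circ> h \<circ> inv k)"
    and "attracting h p \<Longrightarrow> attracting (k \<circ> h \<circ> inv k) (k p)"
proof -
  obtain k1 k2 k3 k4 where k: "k = mob k1 k2 k3 k4" "k1 * k4 - k2 * k3 = 1" using assms by (rule G0E)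
  show "hyperbolic h \<Longrightarrow> hyperbolic (k \<circ> h \<circ> inv k)"
    unfolding hyperbolic_def k(1) by (metis conj_mob[OF k(2)])
  show "elliptic h \<Longrightarrow> elliptic (k \<circ> h \<circ> inv k)"
    unfolding elliptic_def k(1) by (metis conj_mob[OF k(2)])
  show "parabolic (k \<circ> h \<circ> inv k)" if "parabolic h"
  proof -
    have "k \<circ> h \<circ> inv k \<noteq> id"
    proof
      assume "k \<circ> h \<circ> inv k = id"
      then have "h = inv k \<circ> id \<circ> k" using G0_inv_comp[OF assms] by (auto simp: fun_eq_iff) (metis)
      then show False using that G0_inv_comp[OF assms] by (simp add: parabolic_def)
    qed
    moreover have "\<exists>a b c d. a * d - b * c = 1 \<and> k \<circ> h \<circ> inv k = mob a b c d \<and> \<bar>a + d\<bar> = 2"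
      using that unfolding parabolic_def k(1) by (metis conj_mob[OF k(2)])
    ultimately show ?thesis unfolding parabolic_def by blast
  qed
  show "attracting (k \<circ> h \<circ> inv k) (k p)" if att: "attracting h p"
  proof -
    obtain a b c d x y l where m: "a * d - b * c = 1" "h = mob a b c d" and xy: "p = rp x y" "x \<noteq> 0 \<or> y \<noteq> 0"
      and e: "a * x + b * y = l * x" "c * x + d * y = l * y" and l: "l\<^sup>2 > 1"
      using att unfolding attracting_iff_eigenvector by blast
    obtain a' b' c' d' where *: "a' * d' - b' * c' = 1"
      "mob k1 k2 k3 k4 \<circ> mob a b c d \<circ> inv (mob k1 k2 k3 k4) = mob a' b' c' d'"
      "a' * (k1 * x + k2 * y) + b' * (k3 * x + k4 * y) = l * (k1 * x + k2 * y)"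
      "c' * (k1 * x + k2 * y) + d' * (k3 * x + k4 * y) = l * (k3 * x + k4 * y)"
      by (rule conj_mob[OF k(2) m(1)]) (use e in blast)
    have "k p = rp (k1 * x + k2 * y) (k3 * x + k4 * y)"
      unfolding k(1) xy(1) using mob_rp[OF k(2) xy(2)] .
    moreover have "k1 * x + k2 * y \<noteq> 0 \<or> k3 * x + k4 * y \<noteq> 0"
      using det_nonzero_vec_real[OF k(2) xy(2)] .
    ultimately show ?thesis unfolding attracting_iff_eigenvector m(2) using * l unfolding k(1) by blast
  qed
qed

lemma conj_nonrepelling:
  assumes k: "k \<in> G0" and "nonrepelling h p" shows "nonrepelling (k \<circ> h \<circ> inv k) (k p)"
proof -
  have "k p \<in> Hbar" using assms G0_Hpl G0_bdry unfolding nonrepelling_def Hbar_def by blast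
  moreover have "(k \<circ> h \<circ> inv k) (k p) = k p"
    using assms G0_inv_comp(4)[OF k] by (simp add: nonrepelling_def)
  moreover have "k \<circ> h \<circ> inv k = id" if "h = id" using that G0_inv_comp[OF k] by simp
  ultimately show ?thesis using assms conj_class[OF k] unfolding nonrepelling_def by blast
qed

lemma conj_Cset:
  assumes k: "k \<in> G0" and h: "h \<in> Cset L" shows "k \<circ> h \<circ> inv k \<in> Cset (k ` L)"
  using assms conj_nonrepelling gclosure_image_subset unfolding Cset_def
  by (smt (verit) comp_G0 inv_G0 mem_Collect_eq)

lemma conj_conj: "k \<in> G0 \<Longrightarrow> k \<circ> (inv k \<circ> h \<circ> inv (inv k)) \<circ> inv k = h"
  by (simp add: fun_eq_iff G0_inv_comp)

lemma Cset_image: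
  assumes k: "k \<in> G0" shows "Cset (k ` L) = (\<lambda>h. k \<circ> h \<circ> inv k) ` Cset L"
proof
  show "(\<lambda>h. k \<circ> h \<circ> inv k) ` Cset L \<subseteq> Cset (k ` L)" using conj_Cset[OF k] by blast
  show "Cset (k ` L) \<subseteq> (\<lambda>h. k \<circ> h \<circ> inv k) ` Cset L"
  proof
    fix h assume "h \<in> Cset (k ` L)"
    then have "inv k \<circ> h \<circ> inv (inv k) \<in> Cset L"
      using conj_Cset[OF inv_G0[OF k], of h "k ` L"] G0_image_inv[OF k] by simp
    then show "h \<in> (\<lambda>h. k \<circ> h \<circ> inv k) ` Cset L" using conj_conj[OF k, of h] by (metis imageI)
  qed
qed

section \<open>The imaginary axis\<close>

definition l0 :: "pt set" where "l0 = {Fin z | z. Im z > 0 \<and> Re z = 0}"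
definition Hp :: "pt set" where "Hp = {Fin z | z. Im z > 0 \<and> Re z > 0}"
definition Hm :: "pt set" where "Hm = {Fin z | z. Im z > 0 \<and> Re z < 0}"

lemma is_ends_l0: "is_ends l0 (Fin 0) Infty" "is_ends l0 Infty (Fin 0)"
proof -
  have "Fin 0 \<in> bdry" "Infty \<in> bdry" using rp_bdry[of 0 1] rp_bdry[of 1 0] by simp_all
  then show "is_ends l0 (Fin 0) Infty" "is_ends l0 Infty (Fin 0)"
    by (simp_all add: is_ends_def l0_def geod_def)
qed

lemma ends_l0:
  assumes "is_ends l0 p q" shows "p = Fin 0 \<and> q = Infty \<or> p = Infty \<and> q = Fin 0"
proof -
  have pq: "p \<in> bdry" "q \<in> bdry" "p \<noteq> q" "l0 = geod p q" using assms by (auto simp: is_ends_def)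
  obtain v1 v2 where p: "p = rp v1 v2" and v: "v1 \<noteq> 0 \<or> v2 \<noteq> 0" using pq(1) by (rule bdry_cases_rp)
  obtain w1 w2 where q: "q = rp w1 w2" and w: "w1 \<noteq> 0 \<or> w2 \<noteq> 0" using pq(2) by (rule bdry_cases_rp)
  have "Fin (Complex 0 y) \<in> geod p q" if "y > 0" for y using that unfolding pq(4)[symmetric] l0_def by auto
  then have "v2 * w2 * y\<^sup>2 + v1 * w1 = 0" if "y > 0" for y
    using that geod_rp[OF v w] pq(3) unfolding p q by (auto simp: cmod_power2)
  \<comment> \<open>The equation is affine in \<open>y\<^sup>2\<close>, so two heights on the axis
    make both coefficients vanish.\<close>
  from this[of 1] this[of 2] have e: "v2 * w2 + v1 * w1 = 0" "4 * (v2 * w2) + v1 * w1 = 0" by simp_all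
  from e have "v2 * w2 = 0" by linarith
  moreover from e have "v1 * w1 = 0" by linarith
  ultimately have "v2 = 0 \<or> w2 = 0" "v1 = 0 \<or> w1 = 0" by simp_all
  then show ?thesis using v w unfolding p q by (auto simp: cp_def)
qed

lemma gclosure_l0: "gclosure l0 = l0 \<union> {Fin 0, Infty}"
  using is_ends_l0 ends_l0 unfolding gclosure_def by blast

text \<open>The classifying predicates quantify over all representing matrices. There are only two,
  so a property can be tested on a given matrix and its negative.\<close>

lemma mob_representative:
  assumes "a * d - b * c = 1"
  shows "(\<exists>a' b' c' d'. a' * d' - b' * c' = 1 \<and> mob a b c d = mob a' b' c' d' \<and> Q a' b' c' d')
    \<longleftrightarrow> Q a b c d \<or> Q (-a) (-b) (-c) (-d)"
proof
  assume "\<exists>a' b' c' d'. a' * d' - b' * c' = 1 \<and> mob a b c d = mob a' b' c' d' \<and> Q a' b' c' d'"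
  then obtain a' b' c' d' where *: "a' * d' - b' * c' = 1" "mob a b c d = mob a' b' c' d'" "Q a' b' c' d'" by blast
  then show "Q a b c d \<or> Q (-a) (-b) (-c) (-d)" using mob_eqD[OF assms *(1,2)] by auto
next
  have "(-a) * (-d) - (-b) * (-c) = 1" using assms by simp
  moreover assume "Q a b c d \<or> Q (-a) (-b) (-c) (-d)"
  ultimately show "\<exists>a' b' c' d'. a' * d' - b' * c' = 1 \<and> mob a b c d = mob a' b' c' d' \<and> Q a' b' c' d'"
    using assms mob_minus[OF assms] by metis
qed

lemma abs_uminus_add: "\<bar>- a + - d\<bar> = \<bar>a + d :: real\<bar>"
  by linarith

lemma elliptic_mob:
  assumes "a * d - b * c = 1" shows "elliptic (mob a b c d) \<longleftrightarrow> \<bar>a + d\<bar> < 2"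
  unfolding elliptic_def mob_representative[OF assms, of "\<lambda>a b c d. \<bar>a + d\<bar> < 2"] abs_uminus_add by simp

lemma parabolic_mob:
  assumes "a * d - b * c = 1" shows "parabolic (mob a b c d) \<longleftrightarrow> mob a b c d \<noteq> id \<and> \<bar>a + d\<bar> = 2"
  unfolding parabolic_def mob_representative[OF assms, of "\<lambda>a b c d. \<bar>a + d\<bar> = 2"] abs_uminus_add by simp

lemma hyperbolic_mob:
  assumes "a * d - b * c = 1" shows "hyperbolic (mob a b c d) \<longleftrightarrow> \<bar>a + d\<bar> > 2"
  unfolding hyperbolic_def mob_representative[OF assms, of "\<lambda>a b c d. \<bar>a + d\<bar> > 2"] abs_uminus_add by simp

lemma attracting_Infty:
  assumes "a * d - b * c = 1" "c = 0"
  shows "attracting (mob a b c d) Infty \<longleftrightarrow> a\<^sup>2 > 1"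
proof -
  have "Infty \<in> bdry" "mob a b c d Infty = Infty" using is_ends_l0 assms by (auto simp: is_ends_def mob_def)
  then show ?thesis
    using mob_representative[OF assms(1), of "\<lambda>a b c d. a\<^sup>2 > 1"] by (simp add: attracting_def)
qed

lemma attracting_zero:
  assumes "a * d - b * c = 1" "b = 0"
  shows "attracting (mob a b c d) (Fin 0) \<longleftrightarrow> d\<^sup>2 > 1"
proof -
  have "Fin 0 \<in> bdry" "mob a b c d (Fin 0) = Fin 0" using is_ends_l0 assms by (auto simp: is_ends_def mob_def)
  then show ?thesis
    using mob_representative[OF assms(1), of "\<lambda>a b c d. d\<^sup>2 > 1"] by (simp add: attracting_def)
qed

text \<open>For triangular matrices: the trace satisfies
  \<open>(a + d)\<^sup>2 = (a - d)\<^sup>2 + 4\<close>. Hence an element fixing an end of the axis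
  is never elliptic, and it is hyperbolic unless \<open>a = d\<close>.\<close>

lemma sum_inverse_abs:
  fixes a d :: real
  assumes "a * d = 1"
  shows "\<bar>a + d\<bar> \<ge> 2" "\<bar>a + d\<bar> = 2 \<longleftrightarrow> a\<^sup>2 = 1"
proof -
  have e: "(a + d)\<^sup>2 = (a - d)\<^sup>2 + 2\<^sup>2" using assms by (simp add: power2_eq_square algebra_simps)
  then have "2\<^sup>2 \<le> (a + d)\<^sup>2" by simp
  then show "\<bar>a + d\<bar> \<ge> 2" using abs_le_square_iff[of 2 "a + d"] by simp
  have "\<bar>a + d\<bar> = 2 \<longleftrightarrow> (a + d)\<^sup>2 = 2\<^sup>2" 
    using power2_eq_iff_nonneg[of "\<bar>a + d\<bar>" 2] by simp
  also have "\<dots> \<longleftrightarrow> a = d" using e by simp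
  also have "\<dots> \<longleftrightarrow> a\<^sup>2 = 1"
  proof
    assume "a\<^sup>2 = 1"
    then have "a * (a - d) = 0" using assms by (simp add: power2_eq_square algebra_simps)
    then show "a = d" using assms by auto
  qed (use assms in \<open>simp add: power2_eq_square\<close>)
  finally show "\<bar>a + d\<bar> = 2 \<longleftrightarrow> a\<^sup>2 = 1" .
qed

lemma Cset_l0:
  assumes det: "a * d - b * c = 1"
  shows "mob a b c d \<in> Cset l0 \<longleftrightarrow> Cset_matrix a b c d"
proof
  assume "mob a b c d \<in> Cset l0"
  then obtain x where x: "x \<in> l0 \<or> x = Fin 0 \<or> x = Infty" and "nonrepelling (mob a b c d) x"
    unfolding Cset_def gclosure_l0 by blast
  then have fix_: "mob a b c d x = x" and n: "mob a b c d = id \<or> elliptic (mob a b c d) \<or> parabolic (mob a b c d) \<or>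
      attracting (mob a b c d) x" unfolding nonrepelling_def by auto
  have id': "a = d \<and> b = 0 \<and> c = 0 \<and> a\<^sup>2 = 1" if "mob a b c d = id"
    using mob_eqD[OF det, of 1 1 0 0] that det by auto
  from x consider "x \<in> l0" | "x = Fin 0" | "x = Infty" by blast
  then show "Cset_matrix a b c d"
  proof cases
    case 1
    then obtain z where z: "x = Fin z" "Im z > 0" "Re z = 0" by (auto simp: l0_def)
    \<comment> \<open>At \<open>z = i y\<close> the imaginary part of the fixed point equation gives
      \<open>a = d\<close> and the real part gives \<open>b = - c y\<^sup>2\<close>; hence
      \<open>b c < 0\<close> unless the element is the identity.\<close>
    have e: "of_real a * z + of_real b = z * (of_real c * z + of_real d)"
      using fix_ mob_Fin(1,2)[OF det z(2)] unfolding z(1) by (simp add: field_simps)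
    from arg_cong[OF e, of Im] z have "a * Im z = d * Im z" by simp
    then have ad: "a = d" using z by simp
    from arg_cong[OF e, of Re] z have b: "b = - (c * (Im z)\<^sup>2)" by (simp add: power2_eq_square)
    show ?thesis
    proof (cases "c = 0")
      case True then show ?thesis using det ad by (simp add: Cset_matrix_def power2_eq_square)
    next
      case False
      have "b * c = - (c\<^sup>2 * (Im z)\<^sup>2)" unfolding b by (simp add: power2_eq_square)
      also have "\<dots> < 0" using False z by simp
      finally show ?thesis using det ad by (simp add: Cset_matrix_def)
    qed
  next
    case 2
    then have b: "b = 0" using fix_ det by (auto simp: mob_def split: if_splits)
    then have ad: "d * a = 1" using det by (simp add: mult.commute)
    have "d\<^sup>2 \<ge> 1"
      using n id' sum_inverse_abs[OF ad] attracting_zero[OF det b] elliptic_mob[OF det] parabolic_mob[OF det]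
      unfolding 2 by (auto simp: add.commute)
    then show ?thesis using b det by (simp add: Cset_matrix_def)
  next
    case 3
    then have c: "c = 0" using fix_ det by (auto simp: mob_def split: if_splits)
    then have ad: "a * d = 1" using det by simp
    have "a\<^sup>2 \<ge> 1"
      using n id' sum_inverse_abs[OF ad] attracting_Infty[OF det c] elliptic_mob[OF det] parabolic_mob[OF det]
      unfolding 3 by auto
    then show ?thesis using c det by (simp add: Cset_matrix_def)
  qed
next
  assume "Cset_matrix a b c d"
  then consider "c = 0" "a\<^sup>2 \<ge> 1" | "b = 0" "d\<^sup>2 \<ge> 1" | "a = d" "b * c < 0"
    unfolding Cset_matrix_def by blast
  then have "\<exists>x \<in> gclosure l0. nonrepelling (mob a b c d) x"
  proof cases
    case 1
    then have ad: "a * d = 1" using det by simp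
    have "nonrepelling (mob a b c d) Infty"
    proof -
      have "Infty \<in> Hbar" "mob a b c d Infty = Infty" using 1 by (simp_all add: Hbar_def bdry_def mob_def)
      moreover have "mob a b c d = id \<or> parabolic (mob a b c d) \<or> hyperbolic (mob a b c d) \<and> attracting (mob a b c d) Infty"
        using sum_inverse_abs[OF ad] 1 unfolding attracting_Infty[OF det 1(1)] hyperbolic_mob[OF det] parabolic_mob[OF det]
        by fastforce
      ultimately show ?thesis unfolding nonrepelling_def by blast
    qed
    then show ?thesis unfolding gclosure_l0 by blast
  next
    case 2
    then have ad: "d * a = 1" using det by (simp add: mult.commute)
    have "nonrepelling (mob a b c d) (Fin 0)"
    proof -
      have "Fin 0 \<in> bdry" using is_ends_l0 by (simp add: is_ends_def)
      then have "Fin 0 \<in> Hbar" "mob a b c d (Fin 0) = Fin 0" using 2 ad by (auto simp: Hbar_def mob_def)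
      moreover have "mob a b c d = id \<or> parabolic (mob a b c d) \<or> hyperbolic (mob a b c d) \<and> attracting (mob a b c d) (Fin 0)"
        using sum_inverse_abs[OF ad] 2 unfolding attracting_zero[OF det 2(1)] hyperbolic_mob[OF det] parabolic_mob[OF det]
        by (fastforce simp: add.commute)
      ultimately show ?thesis unfolding nonrepelling_def by blast
    qed
    then show ?thesis unfolding gclosure_l0 by blast
  next
    case 3
    \<comment> \<open>The height of the fixed point, from \<open>b = - c y\<^sup>2\<close>.\<close>
    define y where "y = sqrt (- b / c)"
    have c0: "c \<noteq> 0" using 3 by auto
    have pos: "- b / c > 0" using 3(2) by (auto simp: mult_less_0_iff divide_less_0_iff)
    then have y: "y > 0" "y\<^sup>2 = - b / c" by (simp_all add: y_def)
    let ?z = "Complex 0 y"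
    have "mob a b c d (Fin ?z) = Fin ?z"
    proof -
      have "of_real a * ?z + of_real b = ?z * (of_real c * ?z + of_real d)"
        using 3 y c0 by (simp add: complex_eq_iff power2_eq_square field_simps)
      then show ?thesis using mob_Fin(1,2)[OF det, of ?z] y by (simp add: field_simps)
    qed
    moreover have "a\<^sup>2 < 1" using det 3 by (simp add: power2_eq_square)
    then have "\<bar>a + d\<bar> < 2" using 3 abs_square_less_1[of a] by simp
    then have "elliptic (mob a b c d)" using elliptic_mob[OF det] by simp
    moreover have "Fin ?z \<in> l0" "Fin ?z \<in> Hbar" using y by (auto simp: l0_def Hbar_def Hpl_def)
    ultimately show ?thesis unfolding gclosure_l0 nonrepelling_def by blast
  qed
  then show "mob a b c d \<in> Cset l0" using mob_G0[OF det] unfolding Cset_def by blast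
qed

lemma geodesic_image_l0:
  assumes "is_geodesic l" obtains k where "k \<in> G0" "l = k ` l0"
proof -
  obtain p q where pq: "p \<in> bdry" "q \<in> bdry" "p \<noteq> q" "l = geod p q"
    using assms unfolding is_geodesic_def is_ends_def by blast
  obtain v1 v2 where p: "p = rp v1 v2" and v: "v1 \<noteq> 0 \<or> v2 \<noteq> 0" using pq(1) by (rule bdry_cases_rp)
  obtain w1 w2 where q: "q = rp w1 w2" and w: "w1 \<noteq> 0 \<or> w2 \<noteq> 0" using pq(2) by (rule bdry_cases_rp)
  define \<delta> where "\<delta> = w1 * v2 - v1 * w2"
  have \<delta>: "\<delta> \<noteq> 0" using pq(3) rp_eq_iff[OF v w] unfolding p q \<delta>_def by auto
  \<comment> \<open>The columns are the endpoint vectors, as images of \<open>Infty\<close> and 0;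
    one of them is rescaled to make the determinant 1.\<close>
  define k where "k = mob (w1 / \<delta>) v1 (w2 / \<delta>) v2"
  have "w1 / \<delta> * v2 - v1 * (w2 / \<delta>) = (w1 * v2 - v1 * w2) / \<delta>" by (simp add: diff_divide_distrib)
  also have "\<dots> = 1" using \<delta> by (simp add: \<delta>_def)
  finally have det: "w1 / \<delta> * v2 - v1 * (w2 / \<delta>) = 1" .
  have "k (Fin 0) = p" unfolding k_def p using mob_rp[OF det, of 0 1] by simp
  moreover have "k Infty = q"
  proof -
    have "k Infty = rp (w1 / \<delta>) (w2 / \<delta>)" unfolding k_def using mob_rp[OF det, of 1 0] by simp
    also have "\<dots> = q" unfolding q using \<delta> w by (subst rp_eq_iff) auto
    finally show ?thesis .
  qed
  moreover have "k \<in> G0" unfolding k_def using det by (rule mob_G0)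
  ultimately show ?thesis using that is_ends_image[OF _ is_ends_l0(1), of k] pq(4) unfolding is_ends_def by metis
qed

lemma ends_image_l0:
  assumes "k \<in> G0" "is_ends (k ` l0) p q"
  shows "p = k (Fin 0) \<and> q = k Infty \<or> p = k Infty \<and> q = k (Fin 0)"
proof -
  have "is_ends l0 (inv k p) (inv k q)"
    using is_ends_image[OF inv_G0[OF assms(1)] assms(2)] G0_image_inv[OF assms(1)] by simp
  then show ?thesis using ends_l0 G0_inv_comp(5)[OF assms(1)] by metis
qed

lemma ends_unique:
  assumes "is_ends L p q" "is_ends L p' q'" shows "p = p' \<and> q = q' \<or> p = q' \<and> q = p'"
proof -
  have "is_geodesic L" using assms is_geodesic_def by blast
  then obtain k where "k \<in> G0" "L = k ` l0" by (rule geodesic_image_l0)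
  then show ?thesis using ends_image_l0 assms by metis
qed

text \<open>The right-hand side is \<open>i\<close> times the gradient of the polynomial in
  \<open>geod_rp\<close>, hence tangent to its zero set. It treats circles and vertical lines
  uniformly.\<close>

lemma tdir_gradient:
  assumes "v1 \<noteq> 0 \<or> v2 \<noteq> 0" "w1 \<noteq> 0 \<or> w2 \<noteq> 0" "rp v1 v2 \<noteq> rp w1 w2"
  obtains \<kappa> :: real where "\<kappa> \<noteq> 0"
    "of_real \<kappa> * tdir (rp v1 v2) (rp w1 w2) z = \<i> * (of_real (2 * v2 * w2) * z - of_real (v1 * w2 + v2 * w1))"
proof (cases "v2 = 0 \<or> w2 = 0")
  case False
  then show ?thesis using that[of "2 * v2 * w2"] by (simp add: tdir_def cp_def field_simps)
next
  case True
  have "v1 * w2 \<noteq> w1 * v2" using assms rp_eq_iff by metis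
  then show ?thesis using True that[of "- (v1 * w2 + v2 * w1)"] by (auto simp: tdir_def cp_def mult.commute)
qed

text \<open>Two intersecting geodesics are orthogonal iff their ends are harmonic, with cross ratio
  -1. The condition involves endpoint vectors only through their determinants.\<close>

lemma tdir_orth_iff:
  assumes v: "v1 \<noteq> 0 \<or> v2 \<noteq> 0" and w: "w1 \<noteq> 0 \<or> w2 \<noteq> 0" and vw: "rp v1 v2 \<noteq> rp w1 w2"
    and v': "v1' \<noteq> 0 \<or> v2' \<noteq> 0" and w': "w1' \<noteq> 0 \<or> w2' \<noteq> 0" and vw': "rp v1' v2' \<noteq> rp w1' w2'"
    and z: "Fin z \<in> geod (rp v1 v2) (rp w1 w2)" "Fin z \<in> geod (rp v1' v2') (rp w1' w2')"
  shows "Re (tdir (rp v1 v2) (rp w1 w2) z * cnj (tdir (rp v1' v2') (rp w1' w2') z)) = 0 \<longleftrightarrow>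
    (v1 * v2' - v2 * v1') * (w1 * w2' - w2 * w1') + (v1 * w2' - v2 * w1') * (w1 * v2' - w2 * v1') = 0"
proof -
  define A where "A = v2 * w2"
  define B where "B = - (v1 * w2 + v2 * w1)"
  define C where "C = v1 * w1"
  define A' where "A' = v2' * w2'"
  define B' where "B' = - (v1' * w2' + v2' * w1')"
  define C' where "C' = v1' * w1'"
  let ?t = "tdir (rp v1 v2) (rp w1 w2) z" and ?t' = "tdir (rp v1' v2') (rp w1' w2') z"
  have F: "A * (cmod z)\<^sup>2 + B * Re z + C = 0" "A' * (cmod z)\<^sup>2 + B' * Re z + C' = 0"
  proof -
    have "v2 * w2 * (cmod z)\<^sup>2 - (v1 * w2 + v2 * w1) * Re z + v1 * w1 = 0"
      "v2' * w2' * (cmod z)\<^sup>2 - (v1' * w2' + v2' * w1') * Re z + v1' * w1' = 0"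
      using z unfolding geod_rp[OF v w vw] geod_rp[OF v' w' vw'] by auto
    then show "A * (cmod z)\<^sup>2 + B * Re z + C = 0" "A' * (cmod z)\<^sup>2 + B' * Re z + C' = 0"
      unfolding A_def B_def C_def A'_def B'_def C'_def by (simp_all only: mult_minus_left diff_conv_add_uminus)
  qed
  obtain \<kappa> where k: "\<kappa> \<noteq> 0" "of_real \<kappa> * ?t = \<i> * (of_real (2 * A) * z + of_real B)"
    using tdir_gradient[OF v w vw, of z] unfolding A_def B_def by (metis (no_types, lifting) diff_conv_add_uminus mult.assoc of_real_minus)
  obtain \<kappa>' where k': "\<kappa>' \<noteq> 0" "of_real \<kappa>' * ?t' = \<i> * (of_real (2 * A') * z + of_real B')"
    using tdir_gradient[OF v' w' vw', of z] unfolding A'_def B'_def by (metis (no_types, lifting) diff_conv_add_uminus mult.assoc of_real_minus)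
  have "\<kappa> * \<kappa>' * Re (?t * cnj ?t') = Re ((of_real \<kappa> * ?t) * cnj (of_real \<kappa>' * ?t'))"
    by (simp add: algebra_simps)
  also have "\<dots> = 4 * A * A' * (cmod z)\<^sup>2 + 2 * (A * B' + A' * B) * Re z + B * B'"
    unfolding k(2) k'(2) cmod_power2 by (simp add: algebra_simps power2_eq_square)
  \<comment> \<open>Multiples of the two vanishing equations are split off. What remains is the
    polarised discriminant of the two quadratic polynomials, in which \<open>z\<close> no longer
    occurs.\<close>
  also have "\<dots> = 2 * A' * (A * (cmod z)\<^sup>2 + B * Re z + C) + 2 * A * (A' * (cmod z)\<^sup>2 + B' * Re z + C') + (B * B' - 2 * A * C' - 2 * A' * C)"
    by (simp add: algebra_simps)
  also have "\<dots> = B * B' - 2 * A * C' - 2 * A' * C" unfolding F by simp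
  also have "\<dots> = - ((v1 * v2' - v2 * v1') * (w1 * w2' - w2 * w1') + (v1 * w2' - v2 * w1') * (w1 * v2' - w2 * v1'))"
    unfolding A_def B_def C_def A'_def B'_def C'_def by (simp add: algebra_simps)
  finally show ?thesis using k(1) k'(1) by (metis mult_eq_0_iff neg_equal_0_iff_equal)
qed

text \<open>The criterion of \<open>tdir_orth_iff\<close> uses only determinants of endpoint
  vectors, and matrices of determinant 1 preserve these; angles need not be transported.\<close>

lemma orth_at_image:
  assumes k: "k \<in> G0" and "orth_at L M x" shows "orth_at (k ` L) (k ` M) (k x)"
proof -
  obtain a b c d where m: "k = mob a b c d" "a * d - b * c = 1" using k by (rule G0E)
  obtain p q p' q' z where x: "x \<in> L" "x \<in> M" "x = Fin z" and L: "is_ends L p q" and M: "is_ends M p' q'"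
    and o: "Re (tdir p q z * cnj (tdir p' q' z)) = 0" using assms(2) unfolding orth_at_def by blast
  obtain v1 v2 where p: "p = rp v1 v2" and v: "v1 \<noteq> 0 \<or> v2 \<noteq> 0" using L bdry_cases_rp unfolding is_ends_def by metis
  obtain w1 w2 where q: "q = rp w1 w2" and w: "w1 \<noteq> 0 \<or> w2 \<noteq> 0" using L bdry_cases_rp unfolding is_ends_def by metis
  obtain v1' v2' where p': "p' = rp v1' v2'" and v': "v1' \<noteq> 0 \<or> v2' \<noteq> 0" using M bdry_cases_rp unfolding is_ends_def by metis
  obtain w1' w2' where q': "q' = rp w1' w2'" and w': "w1' \<noteq> 0 \<or> w2' \<noteq> 0" using M bdry_cases_rp unfolding is_ends_def by metis
  note kL = is_ends_image[OF k L] and kM = is_ends_image[OF k M]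
  have "z \<in> {z. Im z > 0}" using x L geod_rp[OF v w] unfolding is_ends_def p q by auto
  then obtain z' where z': "k x = Fin z'" using mob_Fin(2)[OF m(2)] x(3) m(1) by blast
  note nz = det_nonzero_vec_real[OF m(2)]
  note kp = mob_rp[OF m(2) v, folded m(1) p] and kq = mob_rp[OF m(2) w, folded m(1) q]
   and kp' = mob_rp[OF m(2) v', folded m(1) p'] and kq' = mob_rp[OF m(2) w', folded m(1) q']
  have det: "(a * x1 + b * x2) * (c * y1 + d * y2) - (c * x1 + d * x2) * (a * y1 + b * y2) = x1 * y2 - x2 * y1" for x1 x2 y1 y2
  proof -
    have "(a * x1 + b * x2) * (c * y1 + d * y2) - (c * x1 + d * x2) * (a * y1 + b * y2) = (a * d - b * c) * (x1 * y2 - x2 * y1)"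
      by (simp add: algebra_simps)
    then show ?thesis using m(2) by simp
  qed
  have "Re (tdir (k p) (k q) z' * cnj (tdir (k p') (k q') z')) = 0"
    unfolding kp kq kp' kq'
  proof (subst tdir_orth_iff[OF nz[OF v] nz[OF w] _ nz[OF v'] nz[OF w']])
    show "rp (a * v1 + b * v2) (c * v1 + d * v2) \<noteq> rp (a * w1 + b * w2) (c * w1 + d * w2)"
      "rp (a * v1' + b * v2') (c * v1' + d * v2') \<noteq> rp (a * w1' + b * w2') (c * w1' + d * w2')"
      using kL kM unfolding is_ends_def kp kq kp' kq' by blast+
    show "Fin z' \<in> geod (rp (a * v1 + b * v2) (c * v1 + d * v2)) (rp (a * w1 + b * w2) (c * w1 + d * w2))"
      "Fin z' \<in> geod (rp (a * v1' + b * v2') (c * v1' + d * v2')) (rp (a * w1' + b * w2') (c * w1' + d * w2'))"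
      using kL kM x z' unfolding is_ends_def kp kq kp' kq' by (metis imageI)+
    show "((a * v1 + b * v2) * (c * v1' + d * v2') - (c * v1 + d * v2) * (a * v1' + b * v2')) *
       ((a * w1 + b * w2) * (c * w1' + d * w2') - (c * w1 + d * w2) * (a * w1' + b * w2')) +
       ((a * v1 + b * v2) * (c * w1' + d * w2') - (c * v1 + d * v2) * (a * w1' + b * w2')) *
       ((a * w1 + b * w2) * (c * v1' + d * v2') - (c * w1 + d * w2) * (a * v1' + b * v2')) = 0"
      unfolding det using o x L M unfolding p q p' q' is_ends_def
      by (subst (asm) tdir_orth_iff[OF v w _ v' w']) auto
  qed
  then show ?thesis unfolding orth_at_def using x kL kM z' by blast
qed

lemma conj_SQ:
  assumes k: "k \<in> G0" and "h \<in> SQ L P" shows "k \<circ> h \<circ> inv k \<in> SQ (k ` L) (k ` P)"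
proof -
  obtain A x where h: "hyperbolic h" "is_axis h A" "orth_at L A x" "h x \<in> P" using assms(2) unfolding SQ_def by blast
  have "is_axis (k \<circ> h \<circ> inv k) (k ` A)"
    using h(1,2) conj_class(1)[OF k] is_ends_image[OF k] G0_inv_comp(4)[OF k] unfolding is_axis_def by fastforce
  moreover have "(k \<circ> h \<circ> inv k) (k x) \<in> k ` P" using h(4) G0_inv_comp(4)[OF k] by simp
  ultimately show ?thesis using orth_at_image[OF k h(3)] conj_class(1)[OF k h(1)] unfolding SQ_def by blast
qed

lemma SQ_image:
  assumes k: "k \<in> G0" shows "SQ (k ` L) (k ` P) = (\<lambda>h. k \<circ> h \<circ> inv k) ` SQ L P"
proof
  show "(\<lambda>h. k \<circ> h \<circ> inv k) ` SQ L P \<subseteq> SQ (k ` L) (k ` P)" using conj_SQ[OF k] by blast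
  show "SQ (k ` L) (k ` P) \<subseteq> (\<lambda>h. k \<circ> h \<circ> inv k) ` SQ L P"
  proof
    fix h assume "h \<in> SQ (k ` L) (k ` P)"
    then have "inv k \<circ> h \<circ> inv (inv k) \<in> SQ L P"
      using conj_SQ[OF inv_G0[OF k], of h "k ` L" "k ` P"] G0_image_inv[OF k] by simp
    then show "h \<in> (\<lambda>h. k \<circ> h \<circ> inv k) ` SQ L P" using conj_conj[OF k, of h] by (metis imageI)
  qed
qed

text \<open>An axis orthogonal to \<open>l0\<close> has opposite ends \<open>x\<close> and
  \<open>-x\<close>. Both solve \<open>c x\<^sup>2 + (d - a) x - b = 0\<close>, whose odd part gives
  \<open>a = d\<close> and whose even part gives \<open>b = c x\<^sup>2\<close>, so \<open>b\<close>
  and \<open>c\<close> have the same sign. With \<open>a > 0\<close> this sign is the side towards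
  which points of \<open>l0\<close> move.\<close>

lemma SQ_l0:
  assumes "s = 1 \<or> s = -1" and P: "P = {Fin z | z. Im z > 0 \<and> s * Re z > 0}"
  shows "SQ l0 P = {mob a b c a | a b c. a * a - b * c = 1 \<and> a > 0 \<and> s * b > 0 \<and> s * c > 0}"
proof
  show "SQ l0 P \<subseteq> {mob a b c a | a b c. a * a - b * c = 1 \<and> a > 0 \<and> s * b > 0 \<and> s * c > 0}"
  proof
    fix h assume "h \<in> SQ l0 P"
    then obtain A x where h: "hyperbolic h" "is_axis h A" "orth_at l0 A x" "h x \<in> P" unfolding SQ_def by blast
    obtain p q where A: "is_ends A p q" and fix_: "h p = p" "h q = q" using h(2) unfolding is_axis_def by blast
    obtain p1 q1 p' q' z where x: "x \<in> l0" "x \<in> A" "x = Fin z" and e1: "is_ends l0 p1 q1" and e2: "is_ends A p' q'"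
      and o: "Re (tdir p1 q1 z * cnj (tdir p' q' z)) = 0" using h(3) unfolding orth_at_def by blast
    have fix': "h p' = p'" "h q' = q'" using ends_unique[OF A e2] fix_ by auto
    obtain v1 v2 where p: "p' = rp v1 v2" and v: "v1 \<noteq> 0 \<or> v2 \<noteq> 0" using e2 bdry_cases_rp unfolding is_ends_def by metis
    obtain w1 w2 where q: "q' = rp w1 w2" and w: "w1 \<noteq> 0 \<or> w2 \<noteq> 0" using e2 bdry_cases_rp unfolding is_ends_def by metis
    have o': "Re (tdir (Fin 0) Infty z * cnj (tdir p' q' z)) = 0"
      using o ends_l0[OF e1] by (auto simp: tdir_def)
    \<comment> \<open>Harmonicity with the ends 0 and \<open>Infty\<close> says that the ends of the
      axis are opposite.\<close>
    have vw: "v1 * w2 + v2 * w1 = 0" "v1 * w2 \<noteq> w1 * v2"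
    proof -
      have ne: "rp 0 1 \<noteq> rp 1 0" "rp v1 v2 \<noteq> rp w1 w2" using e2 p q by (auto simp: is_ends_def)
      have "Fin z \<in> geod (rp 0 1) (rp 1 0)" "Fin z \<in> geod (rp v1 v2) (rp w1 w2)"
        using x e2 is_ends_l0 p q unfolding is_ends_def by auto
      then show "v1 * w2 + v2 * w1 = 0" using tdir_orth_iff[of 0 1 1 0 v1 v2 w1 w2 z] v w ne o' p q by (simp add: algebra_simps)
      show "v1 * w2 \<noteq> w1 * v2" using ne rp_eq_iff[OF v w] by metis
    qed
    have nz: "v1 \<noteq> 0" "v2 \<noteq> 0" "w1 \<noteq> 0" "w2 \<noteq> 0" using vw v w by auto
    obtain a b c d where m: "a * d - b * c = 1" "h = mob a b c d" and tr: "\<bar>a + d\<bar> > 2" using h(1) unfolding hyperbolic_def by blast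
    have E1: "(a * v1 + b * v2) * v2 = v1 * (c * v1 + d * v2)"
      using fix'(1) unfolding p m(2) mob_rp[OF m(1) v] by (subst (asm) rp_eq_iff[OF det_nonzero_vec_real[OF m(1) v] v])
    have E2: "(a * w1 + b * w2) * w2 = w1 * (c * w1 + d * w2)"
      using fix'(2) unfolding q m(2) mob_rp[OF m(1) w] by (subst (asm) rp_eq_iff[OF det_nonzero_vec_real[OF m(1) w] w])
    define \<rho> where "\<rho> = w2 / v2"
    have \<rho>: "w2 = \<rho> * v2" "w1 = - \<rho> * v1" "\<rho> \<noteq> 0" using vw(1) nz by (auto simp: \<rho>_def field_simps)
    have "\<rho>\<^sup>2 * ((- a * v1 + b * v2) * v2) = \<rho>\<^sup>2 * (- v1 * (- c * v1 + d * v2))"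
      using E2 unfolding \<rho>(1,2) by (simp add: algebra_simps power2_eq_square)
    then have E2': "(- a * v1 + b * v2) * v2 = - v1 * (- c * v1 + d * v2)"
      using \<rho>(3) by (metis mult_left_cancel power_not_zero)
    have "2 * (v1 * v2) * (a - d) = ((a * v1 + b * v2) * v2 - v1 * (c * v1 + d * v2)) -
        ((- a * v1 + b * v2) * v2 - (- v1 * (- c * v1 + d * v2)))"
      by (simp add: algebra_simps)
    then have "2 * (v1 * v2) * (a - d) = 0" using E1 E2' by simp
    then have ad: "d = a" using nz by simp
    have bc: "b * v2\<^sup>2 = c * v1\<^sup>2" using E1 unfolding ad by (simp add: algebra_simps power2_eq_square)
    have "\<bar>a\<bar> > 1" using tr unfolding ad by simp
    then have a1: "a * a > 1" using abs_le_square_iff[of a 1] by (simp add: power2_eq_square not_le[symmetric])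
    then have "b * c > 0" using m(1) ad by simp
    \<comment> \<open>Selects the representative with positive diagonal.\<close>
    define \<sigma> where "\<sigma> = (if a > 0 then 1 else -1 :: real)"
    have \<sigma>: "\<sigma> * a > 0" "\<sigma> * \<sigma> = 1" "\<sigma> = 1 \<or> \<sigma> = -1" using a1 by (auto simp: \<sigma>_def not_less le_less)
    have hs: "h = mob (\<sigma> * a) (\<sigma> * b) (\<sigma> * c) (\<sigma> * a)"
      using \<sigma>(3) mob_minus[OF m(1)] unfolding m(2) ad by auto
    have det: "(\<sigma> * a) * (\<sigma> * a) - (\<sigma> * b) * (\<sigma> * c) = 1" using \<sigma>(3) m(1) ad by auto
    have z: "Im z > 0" "Re z = 0" using x by (auto simp: l0_def)
    have "s * ((\<sigma> * a) * (\<sigma> * c) * (cmod z)\<^sup>2 + (\<sigma> * b) * (\<sigma> * a)) > 0"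
    proof -
      have "s * Re ((of_real (\<sigma> * a) * z + of_real (\<sigma> * b)) / (of_real (\<sigma> * c) * z + of_real (\<sigma> * a))) > 0"
        using h(4) mob_Fin(2)[OF det z(1)] unfolding x(3) hs P by auto
      then show ?thesis unfolding mob_Fin(4)[OF det z(1)] z(2)
        using mob_Fin(1)[OF det z(1)] by (simp add: zero_less_divide_iff)
    qed
    then have "(\<sigma> * a) * (s * (\<sigma> * c) * (cmod z)\<^sup>2 + s * (\<sigma> * b)) > 0" by (simp add: algebra_simps)
    then have pos: "s * (\<sigma> * c) * (cmod z)\<^sup>2 + s * (\<sigma> * b) > 0" using \<sigma>(1) by (simp add: zero_less_mult_iff)
    have bc_pos: "(s * (\<sigma> * b)) * (s * (\<sigma> * c)) > 0" using \<open>b * c > 0\<close> \<sigma>(3) assms(1) by auto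
    have "s * (\<sigma> * b) > 0 \<and> s * (\<sigma> * c) > 0"
    proof (rule ccontr)
      assume "\<not> ?thesis"
      then have neg: "s * (\<sigma> * b) < 0" "s * (\<sigma> * c) < 0"
        using bc_pos unfolding zero_less_mult_iff[of "s * (\<sigma> * b)"] by blast+
      then have "s * (\<sigma> * c) * (cmod z)\<^sup>2 \<le> 0"
        using mult_nonpos_nonneg[of "s * (\<sigma> * c)" "(cmod z)\<^sup>2"] by simp
      then show False using pos neg(1) by linarith
    qed
    then show "h \<in> {mob a b c a | a b c. a * a - b * c = 1 \<and> a > 0 \<and> s * b > 0 \<and> s * c > 0}"
      using hs det \<sigma>(1) by blast
  qed
  show "{mob a b c a | a b c. a * a - b * c = 1 \<and> a > 0 \<and> s * b > 0 \<and> s * c > 0} \<subseteq> SQ l0 P"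
  proof clarify
    fix a b c :: real assume det: "a * a - b * c = 1" and pos: "a > 0" "s * b > 0" "s * c > 0"
    have bc: "b * c > 0" "b / c > 0" using pos assms(1) by (auto simp: zero_less_mult_iff zero_less_divide_iff mult_less_0_iff)
    have c0: "c \<noteq> 0" using pos by auto
    have "a * a > 1" using det bc by simp
    then have "a > 1" using pos(1) by (metis mult_le_one not_less less_imp_le)
    then have hyp: "hyperbolic (mob a b c a)" unfolding hyperbolic_mob[OF det] by simp
    \<comment> \<open>The fixed points are the solutions \<open>\<plusminus>r\<close> of
      \<open>c x\<^sup>2 = b\<close>, and the axis crosses \<open>l0\<close> at
      \<open>i r\<close>.\<close>
    define r where "r = sqrt (b / c)"
    have "r > 0" "r\<^sup>2 = b / c" using bc by (simp_all add: r_def)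
    then have r: "r > 0" "r * r * c = b" using c0 by (simp_all add: power2_eq_square)
    define A where "A = geod (rp (-r) 1) (rp r 1)"
    have "rp (-r) 1 \<noteq> rp r 1" using r by (subst rp_eq_iff) auto
    then have A: "is_ends A (rp (-r) 1) (rp r 1)" by (simp only: is_ends_def A_def rp_bdry simp_thms)
    have "mob a b c a (rp x 1) = rp x 1" if "x * x * c = b" for x
    proof -
      have one: "x \<noteq> 0 \<or> (1::real) \<noteq> 0" by simp
      have "(a * x + b * 1) * 1 = x * (c * x + a * 1)" using that by (simp add: algebra_simps)
      then show ?thesis unfolding mob_rp[OF det one]
        by (subst rp_eq_iff[OF det_nonzero_vec_real[OF det one] one])
    qed
    then have "mob a b c a (rp (-r) 1) = rp (-r) 1" "mob a b c a (rp r 1) = rp r 1"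
      using r(2) by (simp_all only: minus_mult_minus)
    then have ax: "is_axis (mob a b c a) A" using hyp A unfolding is_axis_def by blast
    let ?z = "Complex 0 r"
    have zl: "Fin ?z \<in> l0" using r by (auto simp: l0_def)
    have zA: "Fin ?z \<in> A"
    proof -
      have "cmod ?z = r" using r by (simp add: cmod_def)
      then show ?thesis using r(1) unfolding A_def geod_def by (simp add: cp_def)
    qed
    have "orth_at l0 A (Fin ?z)" unfolding orth_at_def
    proof (intro conjI exI)
      show "Re (tdir (Fin 0) Infty ?z * cnj (tdir (rp (-r) 1) (rp r 1) ?z)) = 0" by (simp add: tdir_def cp_def)
    qed (use zl zA A is_ends_l0 in auto)
    moreover have "mob a b c a (Fin ?z) \<in> P"
    proof -
      have zi: "Im ?z > 0" using r by simp
      have "s * (a * c * (cmod ?z)\<^sup>2 + (a * a + b * c) * Re ?z + b * a) = a * (s * c * (cmod ?z)\<^sup>2 + s * b)"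
        by (simp add: algebra_simps)
      also have "\<dots> > 0"
        by (rule mult_pos_pos[OF pos(1) add_nonneg_pos[OF mult_nonneg_nonneg pos(2)]]) (use pos in auto)
      finally have "s * Re ((of_real a * ?z + of_real b) / (of_real c * ?z + of_real a)) > 0"
        unfolding mob_Fin(4)[OF det zi] using mob_Fin(1)[OF det zi] by (simp add: zero_less_divide_iff)
      then show ?thesis unfolding P mob_Fin(2)[OF det zi] using mob_Fin(3)[OF det zi] by blast
    qed
    ultimately show "mob a b c a \<in> SQ l0 P" unfolding SQ_def using hyp ax by blast
  qed
qed

section \<open>The two sides of a geodesic line\<close>

lemma components_disjoint_open_Un:
  fixes A B :: "'a::topological_space set"
  assumes A: "open A" "connected A" "A \<noteq> {}" and B: "open B" "connected B" "B \<noteq> {}" and "A \<inter> B = {}"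
  shows "components (A \<union> B) = {A, B}"
proof -
  have max: "C = X" if "open X" "open Y" "X \<inter> Y = {}" "X \<noteq> {}" "connected C" "X \<subseteq> C" "C \<subseteq> X \<union> Y" for X Y C :: "'a set"
  proof -
    have "X \<inter> Y \<inter> C = {}" using that(3) by blast
    then have "X \<inter> C = {} \<or> Y \<inter> C = {}" using connectedD[OF that(5,1,2)] that(7) by blast
    moreover have "X \<inter> C \<noteq> {}" using that(4,6) by blast
    ultimately show ?thesis using that(6,7) by blast
  qed
  have AB: "A \<in> components (A \<union> B)" "B \<in> components (A \<union> B)"
  proof -
    have "D = A" if "A \<subseteq> D" "D \<subseteq> A \<union> B" "connected D" for D
      by (rule max[OF A(1) B(1) assms(7) A(3) that(3,1,2)])
    moreover have "D = B" if "B \<subseteq> D" "D \<subseteq> A \<union> B" "connected D" for D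
    proof (rule max[OF B(1) A(1) _ B(3) that(3,1)])
      show "B \<inter> A = {}" "D \<subseteq> B \<union> A" using assms(7) that(2) by blast+
    qed
    ultimately show "A \<in> components (A \<union> B)" "B \<in> components (A \<union> B)"
      unfolding in_components_maximal using A B by simp_all
  qed
  have "C = A \<or> C = B" if "C \<in> components (A \<union> B)" for C
    using components_nonoverlap[OF that AB(1)] components_nonoverlap[OF that AB(2)]
      in_components_subset[OF that] in_components_nonempty[OF that] by blast
  then show ?thesis using AB by blast
qed

lemma G0_image_half_plane:
  assumes "k \<in> G0" "s = 1 \<or> s = (-1::real)"
  shows "open {z. Fin z \<in> k ` {Fin z | z. Im z > 0 \<and> s * Re z > 0}}"
    "connected {z. Fin z \<in> k ` {Fin z | z. Im z > 0 \<and> s * Re z > 0}}"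
    "{z. Fin z \<in> k ` {Fin z | z. Im z > 0 \<and> s * Re z > 0}} \<noteq> {}"
proof -
  obtain a b c d where k: "k = mob a b c d" and det: "a * d - b * c = 1" using assms(1) by (rule G0E)
  define Q where "Q = {z. Im z > 0 \<and> s * Re z > 0}"
  define f where "f z = (of_real a * z + of_real b) / (of_real c * z + of_real d)" for z :: complex
  have S: "{z. Fin z \<in> k ` {Fin z | z. Im z > 0 \<and> s * Re z > 0}} = f ` Q"
    unfolding k f_def Q_def using mob_Fin(2)[OF det] by (auto simp: image_iff)
  have nz: "of_real c * z + of_real d \<noteq> 0" if "z \<in> Q" for z
    using mob_Fin(1)[OF det] that by (simp add: Q_def)
  have op: "open Q"
    unfolding Q_def by (intro open_Collect_conj open_Collect_less continuous_intros)
  have hol: "continuous_on Q f" unfolding f_def using nz by (intro continuous_intros) auto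
  have "inj_on f Q"
  proof (rule inj_onI)
    fix x y assume "x \<in> Q" "y \<in> Q" "f x = f y"
    then have "k (Fin x) = k (Fin y)" unfolding k f_def Q_def using mob_Fin(2)[OF det] by simp
    then show "x = y" using G0_inj[OF assms(1)] by simp
  qed
  then show "open {z. Fin z \<in> k ` {Fin z | z. Im z > 0 \<and> s * Re z > 0}}"
    unfolding S using invariance_of_domain[OF hol op] by blast
  have "convex Q"
  proof -
    have "Q = {z. Im z > 0} \<inter> {z. Re (of_real s * z) > 0}" by (auto simp: Q_def)
    moreover have "convex {z. Re (of_real s * z) > 0}"
      using assms(2) convex_halfspace_Re_gt[of 0] convex_halfspace_Re_lt[of 0] by auto
    ultimately show ?thesis using convex_halfspace_Im_gt[of 0] by (simp add: convex_Int)
  qed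
  then show "connected {z. Fin z \<in> k ` {Fin z | z. Im z > 0 \<and> s * Re z > 0}}"
    unfolding S using hol convex_connected connected_continuous_image by blast
  have "Complex s 1 \<in> Q" using assms(2) by (auto simp: Q_def)
  then show "{z. Fin z \<in> k ` {Fin z | z. Im z > 0 \<and> s * Re z > 0}} \<noteq> {}" unfolding S by blast
qed

lemma sides_image_l0:
  assumes k: "k \<in> G0" shows "sides (k ` l0) = {k ` Hp, k ` Hm}"
proof -
  define A where "A = {z. Fin z \<in> k ` Hp}"
  define B where "B = {z. Fin z \<in> k ` Hm}"
  have Hp: "Hp = {Fin z | z. Im z > 0 \<and> 1 * Re z > 0}" and Hm: "Hm = {Fin z | z. Im z > 0 \<and> (-1) * Re z > 0}"
    by (auto simp: Hp_def Hm_def)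
  have disj: "Hp \<inter> Hm = {}" "Hp \<inter> l0 = {}" "Hm \<inter> l0 = {}" and Un: "Hp \<union> Hm \<union> l0 = Hpl"
    by (auto simp: Hp_def Hm_def l0_def Hpl_def)
  have kd: "k ` X \<inter> k ` Y = {}" if "X \<inter> Y = {}" for X Y
    using that bij_is_inj[OF bij_G0[OF k]] by (simp flip: image_Int)
  have "k ` Hpl = Hpl"
  proof
    show "k ` Hpl \<subseteq> Hpl" using G0_Hpl[OF k] by blast
    have "inv k ` Hpl \<subseteq> Hpl" using G0_Hpl[OF inv_G0[OF k]] by blast
    then show "Hpl \<subseteq> k ` Hpl" using G0_image_inv(2)[OF k, of Hpl] by blast
  qed
  then have kU: "k ` Hp \<union> k ` Hm \<union> k ` l0 = Hpl" using Un by (simp flip: image_Un)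
  have "{z. Im z > 0} - {z. Fin z \<in> k ` l0} = {z. Fin z \<in> Hpl - k ` l0}" by (auto simp: Hpl_def)
  also have "Hpl - k ` l0 = k ` Hp \<union> k ` Hm" using kU kd disj by blast
  finally have "{z. Im z > 0} - {z. Fin z \<in> k ` l0} = A \<union> B" by (auto simp: A_def B_def)
  moreover have "components (A \<union> B) = {A, B}"
  proof (rule components_disjoint_open_Un)
    show "open A" "connected A" "A \<noteq> {}"
      unfolding A_def Hp using G0_image_half_plane[OF k, of 1] by auto
    show "open B" "connected B" "B \<noteq> {}"
      unfolding B_def Hm using G0_image_half_plane[OF k, of "-1"] by auto
    show "A \<inter> B = {}" using kd[OF disj(1)] by (auto simp: A_def B_def)
  qed
  moreover have "Fin ` A = k ` Hp" "Fin ` B = k ` Hm"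
  proof -
    have *: "Fin ` {z. Fin z \<in> S} = S" if "S \<subseteq> Hpl" for S using that unfolding Hpl_def by blast
    show "Fin ` A = k ` Hp" "Fin ` B = k ` Hm" unfolding A_def B_def using kU by (intro *; blast)+
  qed
  ultimately show ?thesis unfolding sides_def by simp
qed

text \<open>The half-turn about \<open>i\<close>. Composing a parametrisation \<open>k\<close> of a
  line with it keeps the line and exchanges its two sides, so either transverse orientation can be
  given the normal form.\<close>

definition rot :: "pt \<Rightarrow> pt" where "rot = mob 0 (-1) 1 0"

lemma rot_G0: "rot \<in> G0" unfolding rot_def by (rule mob_G0) simp

lemma rot_images: "rot ` l0 = l0" "rot ` Hp = Hm" "rot ` Hm = Hp"
proof -
  have det: "0 * 0 - (-1) * 1 = (1::real)" by simp
  have r: "rot (Fin z) = Fin (- 1 / z)" "Im (- 1 / z) > 0"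
     "Re (- 1 / z) = - Re z / (cmod z)\<^sup>2" "cmod z > 0" if "Im z > 0" for z
    using mob_Fin[OF det that] that unfolding rot_def by auto
  have inv: "rot (rot x) = x" for x
  proof -
    have "rot \<circ> rot = mob (-1) (-0) (-0) (-1)" unfolding rot_def using mob_comp[OF det det] by simp
    also have "\<dots> = id" using mob_minus[of 1 1 0 0] by simp
    finally show ?thesis by (simp add: fun_eq_iff)
  qed
  have sub: "rot ` l0 \<subseteq> l0" "rot ` Hp \<subseteq> Hm" "rot ` Hm \<subseteq> Hp"
    unfolding l0_def Hp_def Hm_def using r by (auto simp: divide_less_0_iff zero_less_divide_iff)
  have "X \<subseteq> rot ` Y" if "rot ` X \<subseteq> Y" for X Y using that inv by (metis image_subset_iff imageI subsetI)
  then show "rot ` l0 = l0" "rot ` Hp = Hm" "rot ` Hm = Hp" using sub by (simp_all add: subset_antisym)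
qed

lemma SQ_Hp: "SQ l0 Hp = {mob a b c a | a b c. a * a - b * c = 1 \<and> a > 0 \<and> b > 0 \<and> c > 0}"
  using SQ_l0[of 1 Hp] by (simp add: Hp_def)

lemma SQ_Hm: "SQ l0 Hm = inv ` SQ l0 Hp"
proof -
  have "SQ l0 Hm = {mob a b c a | a b c. a * a - b * c = 1 \<and> a > 0 \<and> b < 0 \<and> c < 0}"
    using SQ_l0[of "-1" Hm] by (simp add: Hm_def)
  also have "\<dots> = inv ` SQ l0 Hp"
  proof (intro equalityI subsetI)
    fix h assume "h \<in> {mob a b c a | a b c. a * a - b * c = 1 \<and> a > 0 \<and> b < 0 \<and> c < 0}"
    then obtain a b c where h: "h = mob a b c a" "a * a - b * c = 1" "a > 0" "b < 0" "c < 0" by blast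
    have det: "a * a - (-b) * (-c) = 1" using h by simp
    have "h = inv (mob a (-b) (-c) a)" unfolding inv_mob[OF det] h(1) by simp
    moreover have "mob a (-b) (-c) a \<in> SQ l0 Hp" unfolding SQ_Hp using det h by force
    ultimately show "h \<in> inv ` SQ l0 Hp" by blast
  next
    fix h assume "h \<in> inv ` SQ l0 Hp"
    then obtain a b c where h: "h = inv (mob a b c a)" "a * a - b * c = 1" "a > 0" "b > 0" "c > 0"
      unfolding SQ_Hp by blast
    have "h = mob a (-b) (-c) a" unfolding h(1) inv_mob[OF h(2)] ..
    then show "h \<in> {mob a b c a | a b c. a * a - b * c = 1 \<and> a > 0 \<and> b < 0 \<and> c < 0}"
      using h(2-5) by (intro CollectI exI[of _ a] exI[of _ "-b"] exI[of _ "-c"]) simp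
  qed
  finally show ?thesis .
qed

lemma SQ_Hp_G0: "SQ l0 Hp \<subseteq> G0" unfolding SQ_Hp G0_def by blast

section \<open>Reduction to matrices\<close>

text \<open>A common point is \<open>g k h k\<^sup>-\<^sup>1 = g' k' h' k'\<^sup>-\<^sup>1\<close>.
  Cancelling \<open>g k\<close> on the left and \<open>k'\<^sup>-\<^sup>1\<close> on the right
  leaves \<open>h M = N h'\<close>.\<close>

lemma crooked_planes_meet_iff:
  assumes k: "k \<in> G0" "k' \<in> G0" and g: "g \<in> G0" "g' \<in> G0"
    and M: "inv k \<circ> k' = mob m11 m12 m21 m22" "m11 * m22 - m12 * m21 = 1"
    and N: "inv (g \<circ> k) \<circ> (g' \<circ> k') = mob n11 n12 n21 n22" "n11 * n22 - n12 * n21 = 1"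
  shows "setmul {g} (Cset (k ` l0)) \<inter> setmul {g'} (Cset (k' ` l0)) \<noteq> {} \<longleftrightarrow>
    meets m11 m12 m21 m22 n11 n12 n21 n22"
proof -
  note I = G0_inv_comp
  have C: "Cset l0 = {mob a b c d | a b c d. Cset_matrix a b c d}"
  proof (intro equalityI subsetI)
    fix h assume h: "h \<in> Cset l0"
    then obtain a b c d where "h = mob a b c d" "a * d - b * c = 1" unfolding Cset_def by (auto elim: G0E)
    then show "h \<in> {mob a b c d | a b c d. Cset_matrix a b c d}" using h Cset_l0 by blast
  qed (use Cset_l0 Cset_matrix_def in blast)
  have "setmul {g} (Cset (k ` l0)) \<inter> setmul {g'} (Cset (k' ` l0)) \<noteq> {} \<longleftrightarrow>
    (\<exists>h\<in>Cset l0. \<exists>h'\<in>Cset l0. g \<circ> (k \<circ> h \<circ> inv k) = g' \<circ> (k' \<circ> h' \<circ> inv k'))"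
    unfolding Cset_image[OF k(1)] Cset_image[OF k(2)] setmul_def by blast
  also have "\<dots> \<longleftrightarrow> (\<exists>h\<in>Cset l0. \<exists>h'\<in>Cset l0. h \<circ> (inv k \<circ> k') = (inv (g \<circ> k) \<circ> (g' \<circ> k')) \<circ> h')"
  proof -
    have "g \<circ> (k \<circ> h \<circ> inv k) = g' \<circ> (k' \<circ> h' \<circ> inv k') \<longleftrightarrow> h \<circ> (inv k \<circ> k') = (inv (g \<circ> k) \<circ> (g' \<circ> k')) \<circ> h'" for h h'
    proof
      assume "g \<circ> (k \<circ> h \<circ> inv k) = g' \<circ> (k' \<circ> h' \<circ> inv k')"
      then have e: "g (k (h (inv k x))) = g' (k' (h' (inv k' x)))" for x by (simp add: fun_eq_iff)
      show "h \<circ> (inv k \<circ> k') = (inv (g \<circ> k) \<circ> (g' \<circ> k')) \<circ> h'"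
      proof
        fix x
        show "(h \<circ> (inv k \<circ> k')) x = ((inv (g \<circ> k) \<circ> (g' \<circ> k')) \<circ> h') x"
          using arg_cong[OF e[of "k' x"], of "\<lambda>y. inv k (inv g y)"] unfolding inv_comp_G0[OF g(1) k(1)]
          by (simp add: I(4)[OF g(1)] I(4)[OF k(1)] I(4)[OF k(2)])
      qed
    next
      assume "h \<circ> (inv k \<circ> k') = (inv (g \<circ> k) \<circ> (g' \<circ> k')) \<circ> h'"
      then have e: "h (inv k (k' x)) = inv k (inv g (g' (k' (h' x))))" for x
        unfolding inv_comp_G0[OF g(1) k(1)] by (simp add: fun_eq_iff)
      show "g \<circ> (k \<circ> h \<circ> inv k) = g' \<circ> (k' \<circ> h' \<circ> inv k')"
      proof
        fix x
        show "(g \<circ> (k \<circ> h \<circ> inv k)) x = (g' \<circ> (k' \<circ> h' \<circ> inv k')) x"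
          using arg_cong[OF e[of "inv k' x"], of "\<lambda>y. g (k y)"]
          by (simp add: I(5)[OF g(1)] I(5)[OF k(1)] I(5)[OF k(2)])
      qed
    qed
    then show ?thesis by simp
  qed
  also have "\<dots> \<longleftrightarrow> meets m11 m12 m21 m22 n11 n12 n21 n22"
  proof
    assume "\<exists>h\<in>Cset l0. \<exists>h'\<in>Cset l0. h \<circ> (inv k \<circ> k') = (inv (g \<circ> k) \<circ> (g' \<circ> k')) \<circ> h'"
    then obtain a b c d a' b' c' d' where s: "Cset_matrix a b c d" "Cset_matrix a' b' c' d'"
      and e: "mob a b c d \<circ> mob m11 m12 m21 m22 = mob n11 n12 n21 n22 \<circ> mob a' b' c' d'"
      unfolding C M N by blast
    have det: "a * d - b * c = 1" "a' * d' - b' * c' = 1" using s by (simp_all add: Cset_matrix_def)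
    have D1: "(a * m11 + b * m21) * (c * m12 + d * m22) - (a * m12 + b * m22) * (c * m11 + d * m21) = 1"
    proof -
      have "(a * m11 + b * m21) * (c * m12 + d * m22) - (a * m12 + b * m22) * (c * m11 + d * m21)
        = (a * d - b * c) * (m11 * m22 - m12 * m21)" by (simp add: algebra_simps)
      then show ?thesis using det M by simp
    qed
    have D2: "(n11 * a' + n12 * c') * (n21 * b' + n22 * d') - (n11 * b' + n12 * d') * (n21 * a' + n22 * c') = 1"
    proof -
      have "(n11 * a' + n12 * c') * (n21 * b' + n22 * d') - (n11 * b' + n12 * d') * (n21 * a' + n22 * c')
        = (n11 * n22 - n12 * n21) * (a' * d' - b' * c')" by (simp add: algebra_simps)
      then show ?thesis using det N by simp
    qed
    from mob_eqD[OF D1 D2 e[unfolded mob_comp[OF det(1) M(2)] mob_comp[OF N(2) det(2)]]]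
    show "meets m11 m12 m21 m22 n11 n12 n21 n22"
    proof
      assume "a * m11 + b * m21 = n11 * a' + n12 * c' \<and> a * m12 + b * m22 = n11 * b' + n12 * d' \<and>
        c * m11 + d * m21 = n21 * a' + n22 * c' \<and> c * m12 + d * m22 = n21 * b' + n22 * d'"
      then show ?thesis using s meetsI by blast
    next
      assume "a * m11 + b * m21 = - (n11 * a' + n12 * c') \<and> a * m12 + b * m22 = - (n11 * b' + n12 * d') \<and>
        c * m11 + d * m21 = - (n21 * a' + n22 * c') \<and> c * m12 + d * m22 = - (n21 * b' + n22 * d')"
      then show ?thesis
        by (intro meetsI[of a b c d "-a'" "-b'" "-c'" "-d'"]) (use s Cset_matrix_minus in auto)
    qed
  next
    assume "meets m11 m12 m21 m22 n11 n12 n21 n22"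
    then obtain a b c d a' b' c' d' where s: "Cset_matrix a b c d" "Cset_matrix a' b' c' d'" and
      e: "a * m11 + b * m21 = n11 * a' + n12 * c'" "a * m12 + b * m22 = n11 * b' + n12 * d'"
        "c * m11 + d * m21 = n21 * a' + n22 * c'" "c * m12 + d * m22 = n21 * b' + n22 * d'"
      by (rule meetsE)
    have det: "a * d - b * c = 1" "a' * d' - b' * c' = 1" using s by (simp_all add: Cset_matrix_def)
    have "mob a b c d \<circ> (inv k \<circ> k') = (inv (g \<circ> k) \<circ> (g' \<circ> k')) \<circ> mob a' b' c' d'"
      unfolding M(1) N(1) mob_comp[OF det(1) M(2)] mob_comp[OF N(2) det(2)] e ..
    then show "\<exists>h\<in>Cset l0. \<exists>h'\<in>Cset l0. h \<circ> (inv k \<circ> k') = (inv (g \<circ> k) \<circ> (g' \<circ> k')) \<circ> h'"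
      unfolding C using s by blast
  qed
  finally show ?thesis .
qed

text \<open>The positive side of \<open>l\<close> is \<open>k Hm\<close>, that of \<open>l'\<close>
  is \<open>k' Hp\<close>. As \<open>SQ l0 Hm\<close> consists of the inverses of
  \<open>SQ l0 Hp\<close>, the inversion of the first quadrant makes both factors positive
  matrices.\<close>

lemma stem_product_iff:
  assumes k: "k \<in> G0" "k' \<in> G0" and g: "g \<in> G0" "g' \<in> G0"
  shows "inv g \<circ> g' \<in> setmul (setinv (SQ (k ` l0) (k ` Hm))) (SQ (k' ` l0) (k' ` Hp)) \<longleftrightarrow>
    (\<exists>u\<in>SQ l0 Hp. \<exists>t\<in>SQ l0 Hp. inv (g \<circ> k) \<circ> (g' \<circ> k') = u \<circ> (inv k \<circ> k') \<circ> t)"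
proof -
  note I = G0_inv_comp
  have inv1: "inv (k \<circ> inv u \<circ> inv k) = k \<circ> u \<circ> inv k" if "u \<in> SQ l0 Hp" for u
  proof -
    have u: "u \<in> G0" using that SQ_Hp_G0 by blast
    show ?thesis using k(1) u by (simp add: inv_comp_G0 comp_G0 inv_G0 I(3) comp_assoc)
  qed
  have "setinv (SQ (k ` l0) (k ` Hm)) = (\<lambda>u. inv (k \<circ> inv u \<circ> inv k)) ` SQ l0 Hp"
    unfolding setinv_def SQ_image[OF k(1)] SQ_Hm image_image ..
  also have "\<dots> = (\<lambda>u. k \<circ> u \<circ> inv k) ` SQ l0 Hp"
    by (rule image_cong[OF refl inv1])
  finally have eq: "setinv (SQ (k ` l0) (k ` Hm)) = (\<lambda>u. k \<circ> u \<circ> inv k) ` SQ l0 Hp" .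
  have "inv g \<circ> g' \<in> setmul (setinv (SQ (k ` l0) (k ` Hm))) (SQ (k' ` l0) (k' ` Hp)) \<longleftrightarrow>
    (\<exists>u\<in>SQ l0 Hp. \<exists>t\<in>SQ l0 Hp. inv g \<circ> g' = (k \<circ> u \<circ> inv k) \<circ> (k' \<circ> t \<circ> inv k'))"
    unfolding eq SQ_image[OF k(2)] setmul_def by blast
  also have "\<dots> \<longleftrightarrow> (\<exists>u\<in>SQ l0 Hp. \<exists>t\<in>SQ l0 Hp. inv (g \<circ> k) \<circ> (g' \<circ> k') = u \<circ> (inv k \<circ> k') \<circ> t)"
  proof -
    have "inv g \<circ> g' = (k \<circ> u \<circ> inv k) \<circ> (k' \<circ> t \<circ> inv k') \<longleftrightarrow> inv (g \<circ> k) \<circ> (g' \<circ> k') = u \<circ> (inv k \<circ> k') \<circ> t" for u t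
    proof
      assume "inv g \<circ> g' = (k \<circ> u \<circ> inv k) \<circ> (k' \<circ> t \<circ> inv k')"
      then have e: "inv g (g' x) = k (u (inv k (k' (t (inv k' x)))))" for x by (simp add: fun_eq_iff)
      show "inv (g \<circ> k) \<circ> (g' \<circ> k') = u \<circ> (inv k \<circ> k') \<circ> t"
        unfolding inv_comp_G0[OF g(1) k(1)] by (simp add: fun_eq_iff e I(4)[OF k(1)] I(4)[OF k(2)])
    next
      assume "inv (g \<circ> k) \<circ> (g' \<circ> k') = u \<circ> (inv k \<circ> k') \<circ> t"
      then have e: "inv k (inv g (g' (k' x))) = u (inv k (k' (t x)))" for x
        unfolding inv_comp_G0[OF g(1) k(1)] by (simp add: fun_eq_iff)
      show "inv g \<circ> g' = (k \<circ> u \<circ> inv k) \<circ> (k' \<circ> t \<circ> inv k')"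
      proof
        fix x
        show "(inv g \<circ> g') x = ((k \<circ> u \<circ> inv k) \<circ> (k' \<circ> t \<circ> inv k')) x"
          using e[of "inv k' x"] I(5)[OF k(2), of x] I(5)[OF k(1), of "inv g (g' x)"] by (simp add: o_def)
      qed
    qed
    then show ?thesis by simp
  qed
  finally show ?thesis .
qed

text \<open>Every entry of \<open>u M t\<close> is a sum of nonnegative terms, one of which is
  \<open>a p\<close> times the same entry of \<open>M\<close>, with \<open>a p > 1\<close>. Where
  \<open>M\<close> has a zero entry, the other entry of that column is positive and
  contributes.\<close>

lemma stem_product_entries:
  assumes M: "m11 * m22 - m12 * m21 = 1" and N: "n11 * n22 - n12 * n21 = 1"
    and m: "m11 \<ge> 0" "m12 \<ge> 0" "m21 \<ge> 0" "m22 \<ge> 0"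
    and u: "u \<in> SQ l0 Hp" and t: "t \<in> SQ l0 Hp"
    and eq: "mob n11 n12 n21 n22 = u \<circ> mob m11 m12 m21 m22 \<circ> t"
  shows "\<bar>m11\<bar> < \<bar>n11\<bar> \<and> \<bar>m12\<bar> < \<bar>n12\<bar> \<and> \<bar>m21\<bar> < \<bar>n21\<bar> \<and> \<bar>m22\<bar> < \<bar>n22\<bar>"
proof -
  obtain a b c where u: "u = mob a b c a" "a * a - b * c = 1" "a > 0" "b > 0" "c > 0" using u unfolding SQ_Hp by blast
  obtain p q r where t: "t = mob p q r p" "p * p - q * r = 1" "p > 0" "q > 0" "r > 0" using t unfolding SQ_Hp by blast
  have one: "x > 1" if "x * x - y * z = 1" "x > 0" "y > 0" "z > 0" for x y z :: real
  proof -
    have "y * z > 0" using that by simp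
    then have "x * x > 1" using that by linarith
    then show ?thesis using that(2) by (metis mult_le_one not_less less_imp_le)
  qed
  have ap: "a * p > 1" using one[OF u(2-5)] one[OF t(2-5)] by (simp add: less_1_mult)
  define k11 where "k11 = a * m11 + b * m21"
  define k12 where "k12 = a * m12 + b * m22"
  define k21 where "k21 = c * m11 + a * m21"
  define k22 where "k22 = c * m12 + a * m22"
  have D: "k11 * k22 - k12 * k21 = 1"
  proof -
    have "k11 * k22 - k12 * k21 = (a * a - b * c) * (m11 * m22 - m12 * m21)"
      by (simp add: k11_def k12_def k21_def k22_def algebra_simps)
    then show ?thesis using u M by simp
  qed
  have D': "(k11 * p + k12 * r) * (k21 * q + k22 * p) - (k11 * q + k12 * p) * (k21 * p + k22 * r) = 1"
  proof -
    have "(k11 * p + k12 * r) * (k21 * q + k22 * p) - (k11 * q + k12 * p) * (k21 * p + k22 * r)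
      = (k11 * k22 - k12 * k21) * (p * p - q * r)" by (simp add: algebra_simps)
    then show ?thesis using D t by simp
  qed
  have "mob n11 n12 n21 n22 = mob (k11 * p + k12 * r) (k11 * q + k12 * p) (k21 * p + k22 * r) (k21 * q + k22 * p)"
    unfolding eq u(1) t(1) mob_comp[OF u(2) M] k11_def[symmetric] k12_def[symmetric] k21_def[symmetric] k22_def[symmetric]
      mob_comp[OF D t(2)] ..
  from mob_eqD[OF N D' this]
  have n: "\<bar>n11\<bar> = \<bar>k11 * p + k12 * r\<bar>" "\<bar>n12\<bar> = \<bar>k11 * q + k12 * p\<bar>"
    "\<bar>n21\<bar> = \<bar>k21 * p + k22 * r\<bar>" "\<bar>n22\<bar> = \<bar>k21 * q + k22 * p\<bar>" by auto
  have pos: "\<bar>x1\<bar> < \<bar>(a * x1 + f * x2) * p + (a * x3 + f * x4) * h\<bar>"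
    if "x1 \<ge> 0" "x2 \<ge> 0" "x3 \<ge> 0" "x4 \<ge> 0" "f > 0" "h > 0" "x1 > 0 \<or> x2 > 0" for x1 x2 x3 x4 f h
  proof -
    have "x1 < a * p * x1 + f * x2 * p"
    proof (cases "x1 = 0")
      case True then show ?thesis using that t(3) by auto
    next
      case False
      then have "x1 < a * p * x1" using ap that(1) by simp
      moreover have "f * x2 * p \<ge> 0" using that t(3) by simp
      ultimately show ?thesis by linarith
    qed
    moreover have "(a * x3 + f * x4) * h \<ge> 0" using that u(3) by simp
    ultimately have "x1 < (a * x1 + f * x2) * p + (a * x3 + f * x4) * h" by (simp add: algebra_simps)
    then show ?thesis using that(1) by linarith
  qed
  have nz: "m11 > 0 \<or> m21 > 0" "m12 > 0 \<or> m22 > 0" using M m by (auto simp: le_less)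
  show ?thesis unfolding n k11_def k12_def k21_def k22_def
    using pos[of m11 m21 m12 m22 b r] pos[of m12 m22 m11 m21 b q] pos[of m21 m11 m22 m12 c r] pos[of m22 m12 m21 m11 c q]
      nz m u t by (simp add: add.commute disj_commute)
qed

text \<open>The image of \<open>l0\<close> lies in \<open>Hp\<close>, and the inverse image of
  \<open>l0\<close> avoids \<open>Hp\<close>. The real parts at \<open>i y\<close> turn this into
  two inequalities affine in \<open>y\<^sup>2\<close>, valid for all \<open>y > 0\<close>. Their
  coefficients are products of two entries and must be nonnegative, which gives all entries a common
  sign.\<close>

lemma transition_matrix_nonneg:
  assumes det: "m11 * m22 - m12 * m21 = 1"
    and 1: "mob m11 m12 m21 m22 ` l0 \<inter> (l0 \<union> Hm) = {}" and 2: "mob m11 m12 m21 m22 ` Hp \<inter> l0 = {}"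
  obtains s where "s = 1 \<or> s = -1" "s * m11 \<ge> 0" "s * m12 \<ge> 0" "s * m21 \<ge> 0" "s * m22 \<ge> 0"
proof -
  let ?m = "mob m11 m12 m21 m22"
  have det': "m22 * m11 - (- m12) * (- m21) = 1" using det by (simp add: algebra_simps)
  have cz: "(cmod (Complex 0 y))\<^sup>2 = y\<^sup>2" for y by (simp add: cmod_power2)
  have fwd: "m11 * m21 * y\<^sup>2 + m12 * m22 > 0" if "y > 0" for y
  proof -
    let ?z = "Complex 0 y"
    have z: "Im ?z > 0" using that by simp
    have "?m (Fin ?z) \<in> Hp"
    proof -
      have "Fin ?z \<in> l0" using that by (auto simp: l0_def)
      then have "?m (Fin ?z) \<notin> l0 \<union> Hm" using 1 by blast
      then show ?thesis unfolding mob_Fin(2)[OF det z] using mob_Fin(3)[OF det z] by (auto simp: l0_def Hm_def Hp_def)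
    qed
    then have "Re ((of_real m11 * ?z + of_real m12) / (of_real m21 * ?z + of_real m22)) > 0"
      unfolding mob_Fin(2)[OF det z] Hp_def by auto
    moreover have "(cmod (of_real m21 * ?z + of_real m22))\<^sup>2 > 0" using mob_Fin(1)[OF det z] by simp
    ultimately show ?thesis unfolding mob_Fin(4)[OF det z] cz zero_less_divide_iff by auto
  qed
  have bwd: "m22 * m21 * y\<^sup>2 + m12 * m11 \<ge> 0" if "y > 0" for y
  proof -
    let ?z = "Complex 0 y"
    have z: "Im ?z > 0" using that by simp
    let ?w = "mob m22 (-m12) (-m21) m11 (Fin ?z)"
    have "?m ?w = Fin ?z" using mob_inverse(1)[OF det] by (metis comp_apply id_apply)
    moreover have "Fin ?z \<in> l0" using that by (auto simp: l0_def)
    ultimately have "?w \<notin> Hp" using 2 imageI[of ?w Hp ?m] by auto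
    then have "\<not> Re ((of_real m22 * ?z + of_real (-m12)) / (of_real (-m21) * ?z + of_real m11)) > 0"
      unfolding mob_Fin(2)[OF det' z] Hp_def using mob_Fin(3)[OF det' z] by blast
    moreover have "(cmod (of_real (-m21) * ?z + of_real m11))\<^sup>2 > 0" using mob_Fin(1)[OF det' z] by simp
    ultimately show ?thesis unfolding mob_Fin(4)[OF det' z] cz zero_less_divide_iff by (auto simp: algebra_simps)
  qed
  \<comment> \<open>The limits of \<open>y\<close> to infinity and to 0, with an explicit
    \<open>y\<^sup>2 = t\<close> that violates the inequality.\<close>
  have lim: "\<alpha> \<ge> 0 \<and> \<beta> \<ge> 0" if "\<And>y. y > 0 \<Longrightarrow> \<alpha> * y\<^sup>2 + \<beta> \<ge> 0" for \<alpha> \<beta> :: real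
  proof (intro conjI; rule ccontr)
    assume a: "\<not> \<alpha> \<ge> 0"
    define t where "t = (\<bar>\<beta>\<bar> + 1) / - \<alpha>"
    have "t > 0" unfolding t_def using a by (intro divide_pos_pos) auto
    then have "\<alpha> * t + \<beta> \<ge> 0" using that[of "sqrt t"] by simp
    moreover have "\<alpha> * t = - (\<bar>\<beta>\<bar> + 1)" unfolding t_def using a by (simp add: field_simps)
    ultimately show False by linarith
  next
    assume b: "\<not> \<beta> \<ge> 0"
    define t where "t = - \<beta> / (2 * (\<bar>\<alpha>\<bar> + 1))"
    have t: "t > 0" unfolding t_def using b by (intro divide_pos_pos) auto
    have "\<beta> = - 2 * ((\<bar>\<alpha>\<bar> + 1) * t)" unfolding t_def by (simp add: field_simps)
    moreover have "\<alpha> * t + \<beta> \<ge> 0" using that[of "sqrt t"] t by simp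
    moreover have "\<alpha> * t \<le> (\<bar>\<alpha>\<bar> + 1) * t" using t by (intro mult_right_mono) auto
    moreover have "(\<bar>\<alpha>\<bar> + 1) * t > 0" using t by (intro mult_pos_pos) auto
    ultimately show False by linarith
  qed
  have p1: "m11 * m21 \<ge> 0" "m12 * m22 \<ge> 0" using lim[of "m11 * m21" "m12 * m22"] fwd less_imp_le by blast+
  have p2: "m22 * m21 \<ge> 0" "m12 * m11 \<ge> 0" using lim[of "m22 * m21" "m12 * m11"] bwd by blast+
  have ne: "m11 * m21 > 0 \<or> m12 * m22 > 0" using fwd[of 1] p1 by (auto simp: le_less)
  consider "m11 > 0" "m21 > 0" | "m11 < 0" "m21 < 0" | "m12 > 0" "m22 > 0" | "m12 < 0" "m22 < 0"
    using ne unfolding zero_less_mult_iff by blast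
  then show ?thesis
  proof cases
    case 1 then show ?thesis using p2 that[of 1] by (simp add: zero_le_mult_iff)
  next
    case 2 then show ?thesis using p2 that[of "-1"] by (simp add: zero_le_mult_iff)
  next
    case 3 then show ?thesis using p2 that[of 1] by (simp add: zero_le_mult_iff)
  next
    case 4 then show ?thesis using p2 that[of "-1"] by (simp add: zero_le_mult_iff)
  qed
qed

text \<open>The assumptions \<open>d\<close> on the original lines make a representative of
  \<open>M\<close> nonnegative; a stem product then enlarges every entry, and the form argument
  separates the crooked planes.\<close>

lemma disjoint_if_stem_product:
  assumes k: "k \<in> G0" "k' \<in> G0" and g: "g \<in> G0" "g' \<in> G0"
    and d: "k ` l0 \<inter> k' ` l0 = {}" "k ` Hm \<inter> k' ` l0 = {}" "k' ` Hp \<inter> k ` l0 = {}"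
    and st: "inv g \<circ> g' \<in> setmul (setinv (SQ (k ` l0) (k ` Hm))) (SQ (k' ` l0) (k' ` Hp))"
  shows "setmul {g} (Cset (k ` l0)) \<inter> setmul {g'} (Cset (k' ` l0)) = {}"
proof -
  have "inv k \<circ> k' \<in> G0" using k by blast
  then obtain m11 m12 m21 m22 where M: "inv k \<circ> k' = mob m11 m12 m21 m22" "m11 * m22 - m12 * m21 = 1" by (rule G0E)
  have "inv (g \<circ> k) \<circ> (g' \<circ> k') \<in> G0" using k g by blast
  then obtain n11 n12 n21 n22 where N: "inv (g \<circ> k) \<circ> (g' \<circ> k') = mob n11 n12 n21 n22" "n11 * n22 - n12 * n21 = 1" by (rule G0E)
  have tr: "(inv k \<circ> k') ` X \<inter> Y = {}" if "k ` Y \<inter> k' ` X = {}" for X Y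
  proof -
    have "k ` ((inv k \<circ> k') ` X) = k' ` X" by (simp add: image_image G0_inv_comp(5)[OF k(1)])
    then show ?thesis using that by blast
  qed
  have "mob m11 m12 m21 m22 ` l0 \<inter> (l0 \<union> Hm) = {}" "mob m11 m12 m21 m22 ` Hp \<inter> l0 = {}"
    unfolding M(1)[symmetric] Int_Un_distrib tr[OF d(1)] tr[OF d(2)] tr[OF d(3)[unfolded Int_commute[of "k' ` Hp"]]]
    by simp_all
  then obtain s where s: "s = 1 \<or> s = -1" "s * m11 \<ge> 0" "s * m12 \<ge> 0" "s * m21 \<ge> 0" "s * m22 \<ge> 0"
    using transition_matrix_nonneg[OF M(2)] by metis
  have Ms: "inv k \<circ> k' = mob (s * m11) (s * m12) (s * m21) (s * m22)" "(s * m11) * (s * m22) - (s * m12) * (s * m21) = 1"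
    using s(1) M mob_minus[OF M(2)] by auto
  obtain u t where ut: "u \<in> SQ l0 Hp" "t \<in> SQ l0 Hp" "inv (g \<circ> k) \<circ> (g' \<circ> k') = u \<circ> (inv k \<circ> k') \<circ> t"
    using st stem_product_iff[OF k g] by blast
  have "\<not> meets (s * m11) (s * m12) (s * m21) (s * m22) n11 n12 n21 n22"
    using stem_product_entries[OF Ms(2) N(2) s(2-5) ut(1,2)] ut(3) unfolding N(1) Ms(1)
    by (intro not_meets_if_all_gt) auto
  then show ?thesis using crooked_planes_meet_iff[OF k g Ms N] by blast
qed

text \<open>A positive \<open>N\<close> maps \<open>l0\<close> and \<open>Hp\<close> into
  \<open>Hp\<close>, which yields all disjointness claims for the translated lines. The stem factors
  come from \<open>stem_factor_exists\<close> up to scaling and sign.\<close>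

lemma stem_product_if_disjoint_pos:
  assumes k: "k \<in> G0" "k' \<in> G0" and g: "g \<in> G0" "g' \<in> G0"
    and disj: "setmul {g} (Cset (k ` l0)) \<inter> setmul {g'} (Cset (k' ` l0)) = {}"
    and N: "inv (g \<circ> k) \<circ> (g' \<circ> k') = mob n11 n12 n21 n22" "n11 * n22 - n12 * n21 = 1"
    and n: "n11 > 0" "n12 > 0" "n21 > 0" "n22 > 0"
  shows "g ` k ` l0 \<inter> g' ` k' ` l0 = {} \<and> g ` k ` Hm \<inter> g' ` k' ` l0 = {} \<and> g' ` k' ` Hp \<inter> g ` k ` l0 = {} \<and>
    inv g \<circ> g' \<in> setmul (setinv (SQ (k ` l0) (k ` Hm))) (SQ (k' ` l0) (k' ` Hp))"
proof -
  have "inv k \<circ> k' \<in> G0" using k by blast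
  then obtain m11 m12 m21 m22 where M: "inv k \<circ> k' = mob m11 m12 m21 m22" "m11 * m22 - m12 * m21 = 1" by (rule G0E)
  have "\<not> meets m11 m12 m21 m22 n11 n12 n21 n22" using crooked_planes_meet_iff[OF k g M N] disj by blast
  then have m: "\<bar>m11\<bar> < n11" "\<bar>m12\<bar> < n12" "\<bar>m21\<bar> < n21" "\<bar>m22\<bar> < n22"
    using meets_or_all_gt[OF M(2) N(2)] n by auto
  have im: "mob n11 n12 n21 n22 (Fin z) \<in> Hp" if "Im z > 0" "Re z \<ge> 0" for z
  proof -
    have "n11 * n21 * (cmod z)\<^sup>2 + (n11 * n22 + n12 * n21) * Re z + n12 * n22 > 0"
      using n that by (intro add_nonneg_pos add_nonneg_nonneg) auto
    then show ?thesis unfolding mob_Fin(2)[OF N(2) that(1)]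
      using mob_Fin(1,3,4)[OF N(2) that(1)] by (auto simp: Hp_def zero_less_divide_iff)
  qed
  have gk: "g \<circ> k \<in> G0" using g k by blast
  have tr: "g ` k ` Y \<inter> g' ` k' ` X = {}" if "mob n11 n12 n21 n22 ` X \<inter> Y = {}" for X Y
  proof -
    have "(g \<circ> k) ` (mob n11 n12 n21 n22 ` X) = g' ` k' ` X"
    proof -
      have "(g \<circ> k) \<circ> (inv (g \<circ> k) \<circ> (g' \<circ> k')) = g' \<circ> k'"
        by (simp only: o_assoc G0_inv_comp(2)[OF gk] id_o)
      then show ?thesis unfolding N(1)[symmetric] by (simp only: image_comp)
    qed
    moreover have "(g \<circ> k) ` (mob n11 n12 n21 n22 ` X) \<inter> (g \<circ> k) ` Y = (g \<circ> k) ` (mob n11 n12 n21 n22 ` X \<inter> Y)"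
      by (rule image_Int[symmetric]) (rule bij_is_inj[OF bij_G0[OF gk]])
    ultimately show ?thesis using that by (simp add: image_comp Int_commute)
  qed
  have disj_sets: "Hp \<inter> l0 = {}" "Hp \<inter> Hm = {}" by (auto simp: l0_def Hp_def Hm_def)
  have "mob n11 n12 n21 n22 ` l0 \<subseteq> Hp" "mob n11 n12 n21 n22 ` Hp \<subseteq> Hp"
    using im by (auto simp: l0_def Hp_def)
  then have "mob n11 n12 n21 n22 ` l0 \<inter> l0 = {}" "mob n11 n12 n21 n22 ` l0 \<inter> Hm = {}" "mob n11 n12 n21 n22 ` Hp \<inter> l0 = {}"
    using disj_sets by blast+
  note T = this[THEN tr]
  obtain b c p q r where f: "b > 0" "c > 0" "b * c < 1" "p * q > 0" "p * r > 0"
     "m11 + b * m21 = p * n11 - r * n12" "m12 + b * m22 = p * n12 - q * n11"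
     "c * m11 + m21 = p * n21 - r * n22" "c * m12 + m22 = p * n22 - q * n21"
    using stem_factor_exists[OF M(2) N(2) n m] unfolding stem_factor_def by blast
  \<comment> \<open>The unnormalised \<open>u\<close> and \<open>t\<close> have the same determinant
    \<open>1 - b c\<close>, so \<open>D\<close> normalises both.\<close>
  define D where "D = sqrt (1 - b * c)"
  have D: "D > 0" "D * D = 1 - b * c" using f(3) by (simp_all add: D_def)
  have det: "1 - b * c = p\<^sup>2 - q * r" using stem_factor_det[OF M(2) N(2) f(6-9)] .
  \<comment> \<open>\<open>p\<close>, \<open>q\<close>, \<open>r\<close> may all be negative. The
    sign makes the matrix of \<open>t\<close> positive and is lost in the group.\<close>
  define s where "s = (if p > 0 then 1 else -1 :: real)"
  have s: "s * s = 1" "s * p > 0" "s * q > 0" "s * r > 0"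
    using f(4,5) by (auto simp: s_def zero_less_mult_iff mult_less_0_iff)
  define u where "u = mob (1 / D) (b / D) (c / D) (1 / D)"
  define t where "t = mob (s * p / D) (s * q / D) (s * r / D) (s * p / D)"
  have u_det: "1 / D * (1 / D) - b / D * (c / D) = 1"
  proof -
    have "1 / D * (1 / D) - b / D * (c / D) = (1 - b * c) / (D * D)"
      by (simp add: diff_divide_distrib)
    then show ?thesis unfolding D(2) using f(3) by simp
  qed
  have t_det: "s * p / D * (s * p / D) - s * q / D * (s * r / D) = 1"
  proof -
    have "s * p / D * (s * p / D) - s * q / D * (s * r / D) = (s * s) * (p\<^sup>2 - q * r) / (D * D)"
      by (simp add: power2_eq_square algebra_simps diff_divide_distrib)
    then show ?thesis unfolding s(1) D(2) det[symmetric] using f(3) by simp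
  qed
  have uS: "u \<in> SQ l0 Hp" and tS: "t \<in> SQ l0 Hp"
    unfolding SQ_Hp u_def t_def using u_det t_det D(1) f(1,2) s by (auto intro!: exI) 
  have "u \<circ> (inv k \<circ> k') = mob n11 n12 n21 n22 \<circ> inv t"
  proof -
    have t'_det: "s * p / D * (s * p / D) - (- (s * q / D)) * (- (s * r / D)) = 1" using t_det by simp
    have e: "1 / D * m11 + b / D * m21 = s * (n11 * (s * p / D) + n12 * - (s * r / D))"
      "1 / D * m12 + b / D * m22 = s * (n11 * - (s * q / D) + n12 * (s * p / D))"
      "c / D * m11 + 1 / D * m21 = s * (n21 * (s * p / D) + n22 * - (s * r / D))"
      "c / D * m12 + 1 / D * m22 = s * (n21 * - (s * q / D) + n22 * (s * p / D))"
    proof -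
      have div1: "x / D = s * (y * (s * v / D) + z * - (s * w / D))"
        and div2: "x / D = s * (z * - (s * w / D) + y * (s * v / D))"
        if "x = v * y - w * z" for x y z v w
      proof -
        have "s * (y * (s * v / D) + z * - (s * w / D)) = (s * s) * ((v * y - w * z) / D)"
          by (simp add: algebra_simps diff_divide_distrib)
        then show "x / D = s * (y * (s * v / D) + z * - (s * w / D))" using s(1) that by simp
        then show "x / D = s * (z * - (s * w / D) + y * (s * v / D))" by (simp only: add.commute)
      qed
      have "1 / D * x + y / D * z = (x + y * z) / D" "y / D * z + 1 / D * x = (y * z + x) / D" for x y z
        by (simp_all add: add_divide_distrib)
      note d = this
      show "1 / D * m11 + b / D * m21 = s * (n11 * (s * p / D) + n12 * - (s * r / D))"
        unfolding d by (rule div1[OF f(6)])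
      show "1 / D * m12 + b / D * m22 = s * (n11 * - (s * q / D) + n12 * (s * p / D))"
        unfolding d by (rule div2[OF f(7)])
      show "c / D * m11 + 1 / D * m21 = s * (n21 * (s * p / D) + n22 * - (s * r / D))"
        unfolding d by (rule div1[OF f(8)])
      show "c / D * m12 + 1 / D * m22 = s * (n21 * - (s * q / D) + n22 * (s * p / D))"
        unfolding d by (rule div2[OF f(9)])
    qed
    have "u \<circ> (inv k \<circ> k') = mob (1 / D * m11 + b / D * m21) (1 / D * m12 + b / D * m22) (c / D * m11 + 1 / D * m21) (c / D * m12 + 1 / D * m22)"
      unfolding u_def M(1) mob_comp[OF u_det M(2)] ..
    also have "\<dots> = mob (n11 * (s * p / D) + n12 * - (s * r / D)) (n11 * - (s * q / D) + n12 * (s * p / D))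
       (n21 * (s * p / D) + n22 * - (s * r / D)) (n21 * - (s * q / D) + n22 * (s * p / D))"
    proof -
      have ms: "mob (s * x) (s * y) (s * z) (s * w) = mob x y z w" if "x * w - y * z = 1" for x y z w
        using mob_minus[OF that] by (simp add: s_def)
      have det': "(n11 * (s * p / D) + n12 * - (s * r / D)) * (n21 * - (s * q / D) + n22 * (s * p / D)) -
         (n11 * - (s * q / D) + n12 * (s * p / D)) * (n21 * (s * p / D) + n22 * - (s * r / D)) = 1"
      proof -
        have idf: "(n11 * P + n12 * - R) * (n21 * - Q + n22 * P) - (n11 * - Q + n12 * P) * (n21 * P + n22 * - R)
          = (n11 * n22 - n12 * n21) * (P * P - Q * R)" for P Q R by (simp add: algebra_simps)
        show ?thesis unfolding idf N(2) t_det by simp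
      qed
      show ?thesis unfolding e by (rule ms[OF det'])
    qed
    also have "\<dots> = mob n11 n12 n21 n22 \<circ> inv t"
      unfolding t_def inv_mob[OF t_det] mob_comp[OF N(2) t'_det] ..
    finally show ?thesis .
  qed
  then have "u \<circ> (inv k \<circ> k') \<circ> t = mob n11 n12 n21 n22 \<circ> (inv t \<circ> t)" by (simp add: comp_assoc)
  then have "inv (g \<circ> k) \<circ> (g' \<circ> k') = u \<circ> (inv k \<circ> k') \<circ> t"
    using G0_inv_comp(1)[of t] tS SQ_Hp_G0 N(1) by auto
  then show ?thesis using stem_product_iff[OF k g] uS tS T by blast
qed

theorem theoremB1:
  assumes "is_geodesic l" and "is_geodesic l'" and "g \<in> G0" and "g' \<in> G0"
  shows "(setmul {g} (Cset l) \<inter> setmul {g'} (Cset l') = {} \<longrightarrow>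
            (g ` l \<inter> g' ` l' = {} \<and>
             (\<exists>P P'. P \<in> sides l \<and> P' \<in> sides l' \<and>
                g ` P \<inter> g' ` l' = {} \<and> g' ` P' \<inter> g ` l = {} \<and>
                inv g \<circ> g' \<in> setmul (setinv (SQ l P)) (SQ l' P'))))
       \<and> (\<forall>P P'. (l \<inter> l' = {} \<and> P \<in> sides l \<and> P' \<in> sides l' \<and>
                  P \<inter> l' = {} \<and> P' \<inter> l = {} \<and>
                  g ` l \<inter> g' ` l' = {} \<and>
                  g ` P \<inter> g' ` l' = {} \<and> g' ` P' \<inter> g ` l = {} \<and>
                  inv g \<circ> g' \<in> setmul (setinv (SQ l P)) (SQ l' P'))
              \<longrightarrow> setmul {g} (Cset l) \<inter> setmul {g'} (Cset l') = {})"
proof (intro conjI impI allI)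
  obtain k where k: "k \<in> G0" "l = k ` l0" using assms(1) by (rule geodesic_image_l0)
  obtain k' where k': "k' \<in> G0" "l' = k' ` l0" using assms(2) by (rule geodesic_image_l0)
  note g = assms(3,4)
  have rot: "j \<circ> rot \<in> G0" "(j \<circ> rot) ` l0 = j ` l0" "(j \<circ> rot) ` Hp = j ` Hm" "(j \<circ> rot) ` Hm = j ` Hp" if "j \<in> G0" for j
    using that rot_G0 comp_G0 rot_images by (simp_all only: image_comp[symmetric])
  {
    assume disj: "setmul {g} (Cset l) \<inter> setmul {g'} (Cset l') = {}"
    have "inv k \<circ> k' \<in> G0" using k k' by blast
    then obtain m11 m12 m21 m22 where M: "inv k \<circ> k' = mob m11 m12 m21 m22" "m11 * m22 - m12 * m21 = 1" by (rule G0E)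
    have "inv (g \<circ> k) \<circ> (g' \<circ> k') \<in> G0" using k k' g by blast
    then obtain n11 n12 n21 n22 where N: "inv (g \<circ> k) \<circ> (g' \<circ> k') = mob n11 n12 n21 n22" "n11 * n22 - n12 * n21 = 1" by (rule G0E)
    have "\<not> meets m11 m12 m21 m22 n11 n12 n21 n22"
      using crooked_planes_meet_iff[OF k(1) k'(1) g M N] disj k k' by blast
    then have gt: "\<bar>m11\<bar> < \<bar>n11\<bar>" "\<bar>m12\<bar> < \<bar>n12\<bar>" "\<bar>m21\<bar> < \<bar>n21\<bar>" "\<bar>m22\<bar> < \<bar>n22\<bar>"
      using meets_or_all_gt[OF M(2) N(2)] by auto
    \<comment> \<open>If the two products had opposite signs or one vanished, then
      \<open>n11 n22 - n12 n21 = 1\<close> would be, up to sign, the sum of their absolute values.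
      This sum exceeds the corresponding one for \<open>M\<close>, which is at least 1.\<close>
    have same: "n11 * n22 * (n12 * n21) > 0"
    proof (rule ccontr)
      assume c: "\<not> ?thesis"
      have "\<bar>m11 * m22\<bar> < \<bar>n11 * n22\<bar>" "\<bar>m12 * m21\<bar> < \<bar>n12 * n21\<bar>"
        unfolding abs_mult using gt by (auto intro!: mult_strict_mono')
      moreover have "n11 * n22 \<ge> 0 \<and> n12 * n21 \<le> 0 \<or> n11 * n22 \<le> 0 \<and> n12 * n21 \<ge> 0"
        using c by (auto simp: not_less mult_le_0_iff)
      ultimately show False using M(2) N(2) by linarith
    qed
    define Q where "Q j j' \<longleftrightarrow> (\<exists>a b c d. inv (g \<circ> j) \<circ> (g' \<circ> j') = mob a b c d \<and> a * d - b * c = 1 \<and> a > 0 \<and> b > 0 \<and> c > 0 \<and> d > 0)" for j j'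
    have Q: "Q j j'" if "inv (g \<circ> j) \<circ> (g' \<circ> j') = mob a b c d" "a * d - b * c = 1"
      "a > 0 \<and> b > 0 \<and> c > 0 \<and> d > 0 \<or> a < 0 \<and> b < 0 \<and> c < 0 \<and> d < 0" for j j' a b c d
      using that(3)
    proof
      assume "a < 0 \<and> b < 0 \<and> c < 0 \<and> d < 0"
      moreover have "inv (g \<circ> j) \<circ> (g' \<circ> j') = mob (-a) (-b) (-c) (-d)" using that(1) mob_minus[OF that(2)] by simp
      moreover have "(-a) * (-d) - (-b) * (-c) = 1" using that(2) by simp
      ultimately show ?thesis unfolding Q_def by (metis neg_0_less_iff_less)
    qed (use that in \<open>unfold Q_def, blast\<close>)
    have rotdet: "0 * 0 - (-1) * 1 = (1::real)" "0 * 0 - 1 * (-1) = (1::real)" by simp_all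
    have irot: "inv rot = mob 0 1 (-1) 0" unfolding rot_def using inv_mob[OF rotdet(1)] by simp
    have right: "inv (g \<circ> j) \<circ> (g' \<circ> (k' \<circ> rot)) = mob b (-a) d (-c)"
      if "inv (g \<circ> j) \<circ> (g' \<circ> k') = mob a b c d" "a * d - b * c = 1" for j a b c d
    proof -
      have "inv (g \<circ> j) \<circ> (g' \<circ> (k' \<circ> rot)) = mob a b c d \<circ> rot" unfolding that(1)[symmetric] by (simp only: o_assoc)
      also have "\<dots> = mob b (-a) d (-c)" unfolding rot_def mob_comp[OF that(2) rotdet(1)] by simp
      finally show ?thesis .
    qed
    have left: "inv (g \<circ> (k \<circ> rot)) \<circ> (g' \<circ> k') = mob n21 n22 (-n11) (-n12)"
    proof -
      have "inv (g \<circ> (k \<circ> rot)) = inv rot \<circ> inv (g \<circ> k)"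
        using inv_comp_G0[OF comp_G0[OF g(1) k(1)] rot_G0] by (simp only: o_assoc)
      then have "inv (g \<circ> (k \<circ> rot)) \<circ> (g' \<circ> k') = inv rot \<circ> mob n11 n12 n21 n22"
        unfolding N(1)[symmetric] by (simp only: o_assoc)
      also have "\<dots> = mob n21 n22 (-n11) (-n12)" unfolding irot mob_comp[OF rotdet(2) N(2)] by simp
      finally show ?thesis .
    qed
    have dets: "n12 * (-n21) - (-n11) * n22 = 1" "n21 * (-n12) - n22 * (-n11) = 1" "n22 * n11 - (-n21) * (-n12) = 1"
      using N(2) by (simp_all add: mult.commute)
    have both: "inv (g \<circ> (k \<circ> rot)) \<circ> (g' \<circ> (k' \<circ> rot)) = mob n22 (-n21) (-n12) n11"
      using right[OF left dets(2)] by simp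
    have "\<exists>j\<in>{k, k \<circ> rot}. \<exists>j'\<in>{k', k' \<circ> rot}. Q j j'"
    proof -
      have nz: "n11 \<noteq> 0" "n12 \<noteq> 0" "n21 \<noteq> 0" "n22 \<noteq> 0" using gt by auto
      \<comment> \<open>By \<open>same\<close>, four sign patterns of \<open>N\<close> remain up to
        a global sign. A half-turn on neither side, on the right, on the left or on both sides makes
        the entries all of one sign.\<close>
      then consider "n11 > 0 \<and> n12 > 0 \<and> n21 > 0 \<and> n22 > 0 \<or> n11 < 0 \<and> n12 < 0 \<and> n21 < 0 \<and> n22 < 0"
        | "n12 > 0 \<and> -n11 > 0 \<and> n22 > 0 \<and> -n21 > 0 \<or> n12 < 0 \<and> -n11 < 0 \<and> n22 < 0 \<and> -n21 < 0"
        | "n21 > 0 \<and> n22 > 0 \<and> -n11 > 0 \<and> -n12 > 0 \<or> n21 < 0 \<and> n22 < 0 \<and> -n11 < 0 \<and> -n12 < 0"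
        | "n22 > 0 \<and> -n21 > 0 \<and> -n12 > 0 \<and> n11 > 0 \<or> n22 < 0 \<and> -n21 < 0 \<and> -n12 < 0 \<and> n11 < 0"
        using same by (auto simp: zero_less_mult_iff mult_less_0_iff)
      then show ?thesis
      proof cases
        case 1 then show ?thesis using Q[OF N] by blast
      next
        case 2 then show ?thesis using Q[OF right[OF N] dets(1)] by blast
      next
        case 3 then show ?thesis using Q[OF left dets(2)] by blast
      next
        case 4 then show ?thesis using Q[OF both dets(3)] by blast
      qed
    qed
    then obtain j j' where j: "j \<in> {k, k \<circ> rot}" "j' \<in> {k', k' \<circ> rot}" "Q j j'" by blast
    have jG: "j \<in> G0" "j' \<in> G0" and jl: "l = j ` l0" "l' = j' ` l0"
      using j(1,2) k k' rot(1,2)[OF k(1)] rot(1,2)[OF k'(1)] by blast+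
    have C: "g ` j ` l0 \<inter> g' ` j' ` l0 = {} \<and> g ` j ` Hm \<inter> g' ` j' ` l0 = {} \<and> g' ` j' ` Hp \<inter> g ` j ` l0 = {} \<and>
      inv g \<circ> g' \<in> setmul (setinv (SQ (j ` l0) (j ` Hm))) (SQ (j' ` l0) (j' ` Hp))"
    proof -
      obtain a b c d where N': "inv (g \<circ> j) \<circ> (g' \<circ> j') = mob a b c d" "a * d - b * c = 1"
        "a > 0" "b > 0" "c > 0" "d > 0" using j(3) unfolding Q_def by blast
      show ?thesis
        by (rule stem_product_if_disjoint_pos[OF jG g disj[unfolded jl] N'])
    qed
    then show "g ` l \<inter> g' ` l' = {}" using jl by simp
    show "\<exists>P P'. P \<in> sides l \<and> P' \<in> sides l' \<and> g ` P \<inter> g' ` l' = {} \<and> g' ` P' \<inter> g ` l = {} \<and>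
                inv g \<circ> g' \<in> setmul (setinv (SQ l P)) (SQ l' P')"
      unfolding jl sides_image_l0[OF jG(1)] sides_image_l0[OF jG(2)]
      by (intro exI[of _ "j ` Hm"] exI[of _ "j' ` Hp"] conjI) (simp_all only: C insert_iff simp_thms)
  }
  fix P P'
  assume H: "l \<inter> l' = {} \<and> P \<in> sides l \<and> P' \<in> sides l' \<and> P \<inter> l' = {} \<and> P' \<inter> l = {} \<and>
                  g ` l \<inter> g' ` l' = {} \<and> g ` P \<inter> g' ` l' = {} \<and> g' ` P' \<inter> g ` l = {} \<and>
                  inv g \<circ> g' \<in> setmul (setinv (SQ l P)) (SQ l' P')"
  then have S: "P \<in> {k ` Hp, k ` Hm}" "P' \<in> {k' ` Hp, k' ` Hm}"
    by (simp_all only: k(2) k'(2) sides_image_l0[OF k(1)] sides_image_l0[OF k'(1)])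
  \<comment> \<open>The given orientations determine whether a half-turn is inserted, so that the
    positive sides become the images of \<open>Hm\<close> and \<open>Hp\<close>.\<close>
  obtain j where j: "j \<in> G0" "l = j ` l0" "P = j ` Hm"
    using S(1) that[of k] that[of "k \<circ> rot"] k rot[OF k(1)] by (metis insertE singletonD)
  obtain j' where j': "j' \<in> G0" "l' = j' ` l0" "P' = j' ` Hp"
    using S(2) that[of k'] that[of "k' \<circ> rot"] k' rot[OF k'(1)] by (metis insertE singletonD)
  show "setmul {g} (Cset l) \<inter> setmul {g'} (Cset l') = {}"
    unfolding j(2) j'(2)
  proof (rule disjoint_if_stem_product[OF j(1) j'(1) g])
    show "j ` l0 \<inter> j' ` l0 = {}" "j ` Hm \<inter> j' ` l0 = {}" "j' ` Hp \<inter> j ` l0 = {}"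
      "inv g \<circ> g' \<in> setmul (setinv (SQ (j ` l0) (j ` Hm))) (SQ (j' ` l0) (j' ` Hp))"
      by (simp_all only: H[unfolded j(2,3) j'(2,3)])
  qed
qed

end
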